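(* Let $C=\begin{pmatrix}C_{11}&C_{12}\\ C_{21}&C_{22}\end{pmatrix}$ be the real $4d\times4d$ matrix with $2d\times2d$ blocks $$C_{11}=C_{21}=I_{2d},\qquad C_{12}=\begin{pmatrix}0&0\\0&I_d\end{pmatrix},\qquad C_{22}=\begin{pmatrix}I_d&0\\0&0\end{pmatrix}.$$ Let $\omega_1$ and $\omega_2$ be weights on $\mathbf C^d$, let $\omega$ be a weight on $\mathbf C^d\times\mathbf C^d$ such that $$\frac{\omega_2(z)}{\omega_1(w)}\lesssim\omega(z,\overline w),\qquad z,w\in\mathbf C^d,$$ and let $p,q\in[1,\infty]$. Let $K\in\widetilde A(\mathbf C^d\times\mathbf C^d)$ and let $G_{K,C,\omega}=K_\omega\circ U_{d,d}^{-1}\circ C\circ U_{d,d}$, where $$K_\omega(z,w)=e^{-\frac12(|z|^2+|w|^2)}|K(z,w)|\,\omega(\sqrt2\,\overline z,\sqrt2\,w),$$ that is, $G_{K,C,\omega}(x+i\xi,y+i\eta)=K_\omega\big(x+i(\xi+\eta),(x+y)+i\xi\big)$ for $x,\xi,y,\eta\in\mathbf R^d$. If $G_{K,C,\omega}\in L^{p,q}_*(\mathbf C^{2d})$, then $T_K$ from $\mathcal A_{\flat_1}(\mathbf C^d)$ to $A(\mathbf C^d)$ is uniquely extendable to a continuous mapping from $A^{q',p'}_{(\omega_1)}(\mathbf C^d)$ to $A^{p,q}_{*,(\omega_2)}(\mathbf C^d)$, and $$\|T_KF\|_{A^{p,q}_{*,(\omega_2)}}\lesssim\|G_{K,C,\omega}\|_{L^{p,q}_*}\|F\|_{A^{q',p'}_{(\omega_1)}},\qquad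 F\in A^{q',p'}_{(\omega_1)}(\mathbf C^d).$$
   Context: General: $f\lesssim g$ means $f\le Cg$ for a constant $C>0$. $p'$ denotes the conjugate exponent of $p$, $\frac1p+\frac1{p'}=1$. A weight is a positive function $\omega\in L^\infty_{loc}$ with $1/\omega\in L^\infty_{loc}$. $\mathbf C^d$ is identified with $\mathbf R^{2d}$ via $x+i\xi\leftrightarrow(x,\xi)$; weights on $\mathbf C^d$ are regarded as weights on $\mathbf R^{2d}$ in this way. $U_{d,d}(x_1+i\xi_1,x_2+i\xi_2)=(x_1,\xi_1,x_2,\xi_2)\in\mathbf R^{4d}$. $I_n$ is the $n\times n$ identity matrix. For $G$ on $\mathbf C^{2d}=\mathbf C^d\times\mathbf C^d$, $\|G\|_{L^{p,q}_*(\mathbf C^{2d})}$ is obtained by first taking the $L^q(\mathbf C^d)$ norm of $G(z,w)$ in $w$ and then the $L^p(\mathbf C^d)$ norm in $z$. Spaces of entire functions: $A(\mathbf C^d)$ is the set of entire functions on $\mathbf C^d$. For $F\in A(\mathbf C^d)$ and a weight $\omega$ on $\mathbf C^d$ let $g_{F,\omega}(x,\xi)=(2\pi)^{-d/2}e^{-(|x|^2+|\xi|^2)/4}\,|F((x-i\xi)/\sqrt2)|\,\omega(x,\xi)$, $x,\xi\in\mathbf R^d$. For $p,q\in[1,\infty]$: $A^{p,q}_{(\omega)}(\mathbf C^d)$ is the normed space of all $F\in A(\mathbf C^d)$ for which $\|F\|_{A^{p,q}_{(\omega)}}<\infty$, where this norm is obtained by taking first the $L^p(\mathbf R^d)$ norm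 of $g_{F,\omega}(x,\xi)$ in $x$ and then the $L^q(\mathbf R^d)$ norm in $\xi$; $A^{p,q}_{*,(\omega)}(\mathbf C^d)$ is defined in the same way with the norm obtained by taking first the $L^q(\mathbf R^d)$ norm of $g_{F,\omega}(x,\xi)$ in $\xi$ and then the $L^p(\mathbf R^d)$ norm in $x$. $\widetilde A(\mathbf C^d\times\mathbf C^d)$ is the set of all $K$ such that $(z,w)\mapsto K(z,\overline w)$ is entire on $\mathbf C^{2d}$. Operators: with $e_\alpha(z)=z^\alpha/\sqrt{\alpha!}$, $\mathcal A_{\flat_1}(\mathbf C^d)$ is the space of all $F=\sum_\alpha c(F,\alpha)e_\alpha$ with $|c(F,\alpha)|\lesssim h^{|\alpha|}(\alpha!)^{-1/2}$ for some $h>0$ (equivalently, entire $F$ with $|F(z)|\lesssim e^{r|z|}$ for some $r>0$). For $K(z,w)=\sum c_K(\alpha,\beta)e_\alpha(z)e_\beta(\overline w)$ in $\widetilde A(\mathbf C^d\times\mathbf C^d)$, $T_KF(z)=\langle K(z,\cdot),F\rangle_{A^2(\mathbf C^d)}$, which is the duality extension of $\int_{\mathbf C^d}K(z,w)F(w)\,d\mu(w)$, $d\mu(w)=\pi^{-d}e^{-|w|^2}d\lambda(w)$; in coefficients $T_KF=\sum_\alpha\big(\sum_\beta c_K(\alpha,\beta)c(F,\beta)\big)e_\alpha$.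
   Formalization: Unique extendability fails in general (p=q=1, weights 1, K=0). Proved: a continuous extension agreeing with T_K on A_♭1 ∩ A^{q',p'}_{(ω1)}, unique on the closure of A_♭1 (everywhere if A_♭1 is dense; density not proved), and equal to the integral of K(z,w)F(w)dμ(w) on the whole space. *)

theory Defs
  imports "HOL-Analysis.Analysis" "HOL-Probability.Essential_Supremum"
begin

section \<open>Vectors, multi-indices, entire functions\<close>

text \<open>\<open>\<complex>\<^sup>d\<close> is \<^typ>\<open>complex ^ 'd\<close>, \<open>\<real>\<^sup>d\<close> is \<^typ>\<open>real ^ 'd\<close>, and Lebesgue measure on
  \<^typ>\<open>complex ^ 'd\<close> is that of the underlying \<open>2d\<close>-dimensional Euclidean space.\<close>

definition cvec :: "real ^ 'd \<Rightarrow> real ^ 'd \<Rightarrow> complex ^ 'd" where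
  "cvec x \<xi> = (\<chi> i. Complex (x $ i) (\<xi> $ i))"

definition cnj_vec :: "complex ^ 'd \<Rightarrow> complex ^ 'd" where
  "cnj_vec z = (\<chi> i. cnj (z $ i))"

text \<open>\<open>e\<^sub>\<alpha>(z) = z\<^sup>\<alpha> / \<surd>\<alpha>!\<close>\<close>

definition mfact :: "('d::finite \<Rightarrow> nat) \<Rightarrow> real" where
  "mfact \<alpha> = (\<Prod>i\<in>UNIV. fact (\<alpha> i))"

definition monom_e :: "('d::finite \<Rightarrow> nat) \<Rightarrow> complex ^ 'd \<Rightarrow> complex" where
  "monom_e \<alpha> z = (\<Prod>i\<in>UNIV. (z $ i) ^ \<alpha> i) / complex_of_real (sqrt (mfact \<alpha>))"

text \<open>Entire means Frechet differentiable everywhere with complex-linear derivative. The complex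
  scalar multiplication is a parameter because products such as
  \<^typ>\<open>(complex ^ 'd) \<times> (complex ^ 'd)\<close> only carry a real vector space structure in the library.\<close>

definition entire_wrt ::
    "(complex \<Rightarrow> 'a \<Rightarrow> 'a) \<Rightarrow> ('a::real_normed_vector \<Rightarrow> complex) \<Rightarrow> bool" where
  "entire_wrt smul F \<longleftrightarrow>
     (\<forall>z. \<exists>F'. (F has_derivative F') (at z) \<and> (\<forall>c v. F' (smul c v) = c * F' v))"

definition A_entire :: "(complex ^ 'd \<Rightarrow> complex) set" where
  "A_entire = {F. entire_wrt (*s) F}"

definition A_tilde :: "((complex ^ 'd) \<times> (complex ^ 'd) \<Rightarrow> complex) set" where
  "A_tilde = {K. entire_wrt (\<lambda>(c::complex) (z, w). (c *s z, c *s w)) (\<lambda>(z, w). K (z, cnj_vec w))}"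


section \<open>Weights and Lebesgue norms\<close>

definition L_inf_loc :: "('a::euclidean_space \<Rightarrow> real) \<Rightarrow> bool" where
  "L_inf_loc f \<longleftrightarrow> f \<in> borel_measurable lebesgue \<and>
     (\<forall>S. compact S \<longrightarrow> (\<exists>B. AE x in lebesgue. x \<in> S \<longrightarrow> \<bar>f x\<bar> \<le> B))"

definition weight :: "('a::euclidean_space \<Rightarrow> real) \<Rightarrow> bool" where
  "weight \<omega> \<longleftrightarrow> (\<forall>x. \<omega> x > 0) \<and> L_inf_loc \<omega> \<and> L_inf_loc (\<lambda>x. 1 / \<omega> x)"

text \<open>Powers with a positive real exponent on \<open>[0,\<infinity>]\<close>.\<close>

definition epowr :: "ennreal \<Rightarrow> real \<Rightarrow> ennreal" where
  "epowr x a = (if x = \<infinity> then \<infinity> else ennreal (enn2real x powr a))"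

text \<open>The \<open>L\<^sup>p\<close> norm, \<open>p \<in> [1,\<infinity>]\<close>, of a nonnegative function.\<close>

definition Lp_norm :: "ennreal \<Rightarrow> ('a::euclidean_space \<Rightarrow> ennreal) \<Rightarrow> ennreal" where
  "Lp_norm p f = (if p = \<infinity> then esssup lebesgue f
     else epowr (\<integral>\<^sup>+ x. epowr (f x) (enn2real p) \<partial>lebesgue) (1 / enn2real p))"

definition Lpq_star_norm ::
    "ennreal \<Rightarrow> ennreal \<Rightarrow> ((complex ^ 'd) \<times> (complex ^ 'd) \<Rightarrow> real) \<Rightarrow> ennreal" where
  "Lpq_star_norm p q G = Lp_norm p (\<lambda>z. Lp_norm q (\<lambda>w. ennreal \<bar>G (z, w)\<bar>))"

definition Lpq_star ::
    "ennreal \<Rightarrow> ennreal \<Rightarrow> ((complex ^ 'd) \<times> (complex ^ 'd) \<Rightarrow> real) set" where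
  "Lpq_star p q = {G. G \<in> borel_measurable lebesgue \<and> Lpq_star_norm p q G < \<infinity>}"


section \<open>Weighted spaces of entire functions\<close>

definition g_fun ::
    "(complex ^ 'd \<Rightarrow> complex) \<Rightarrow> (complex ^ 'd \<Rightarrow> real) \<Rightarrow> real ^ 'd \<Rightarrow> real ^ 'd \<Rightarrow> real" where
  "g_fun F \<omega> x \<xi> = (2 * pi) powr (- real CARD('d) / 2)
     * exp (- ((norm x)\<^sup>2 + (norm \<xi>)\<^sup>2) / 4)
     * cmod (F ((1 / sqrt 2) *\<^sub>R cvec x (- \<xi>))) * \<omega> (cvec x \<xi>)"

definition A_norm ::
    "ennreal \<Rightarrow> ennreal \<Rightarrow> (complex ^ 'd \<Rightarrow> real) \<Rightarrow> (complex ^ 'd \<Rightarrow> complex) \<Rightarrow> ennreal" where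
  "A_norm p q \<omega> F = Lp_norm q (\<lambda>\<xi>. Lp_norm p (\<lambda>x. ennreal (g_fun F \<omega> x \<xi>)))"

definition A_star_norm ::
    "ennreal \<Rightarrow> ennreal \<Rightarrow> (complex ^ 'd \<Rightarrow> real) \<Rightarrow> (complex ^ 'd \<Rightarrow> complex) \<Rightarrow> ennreal" where
  "A_star_norm p q \<omega> F = Lp_norm p (\<lambda>x. Lp_norm q (\<lambda>\<xi>. ennreal (g_fun F \<omega> x \<xi>)))"

definition A_space ::
    "ennreal \<Rightarrow> ennreal \<Rightarrow> (complex ^ 'd \<Rightarrow> real) \<Rightarrow> (complex ^ 'd \<Rightarrow> complex) set" where
  "A_space p q \<omega> = {F \<in> A_entire. A_norm p q \<omega> F < \<infinity>}"

definition A_star_space ::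
    "ennreal \<Rightarrow> ennreal \<Rightarrow> (complex ^ 'd \<Rightarrow> real) \<Rightarrow> (complex ^ 'd \<Rightarrow> complex) set" where
  "A_star_space p q \<omega> = {F \<in> A_entire. A_star_norm p q \<omega> F < \<infinity>}"

text \<open>The norm topologies.\<close>

definition A_top ::
    "ennreal \<Rightarrow> ennreal \<Rightarrow> (complex ^ 'd \<Rightarrow> real) \<Rightarrow> (complex ^ 'd \<Rightarrow> complex) topology" where
  "A_top p q \<omega> = Metric_space.mtopology (A_space p q \<omega>)
     (\<lambda>F H. enn2real (A_norm p q \<omega> (\<lambda>z. F z - H z)))"

definition A_star_top ::
    "ennreal \<Rightarrow> ennreal \<Rightarrow> (complex ^ 'd \<Rightarrow> real) \<Rightarrow> (complex ^ 'd \<Rightarrow> complex) topology" where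
  "A_star_top p q \<omega> = Metric_space.mtopology (A_star_space p q \<omega>)
     (\<lambda>F H. enn2real (A_star_norm p q \<omega> (\<lambda>z. F z - H z)))"


section \<open>Operators\<close>

definition coeff_F :: "(complex ^ 'd \<Rightarrow> complex) \<Rightarrow> ('d \<Rightarrow> nat) \<Rightarrow> complex" where
  "coeff_F F = (THE c. \<forall>z. ((\<lambda>\<alpha>. c \<alpha> * monom_e \<alpha> z) has_sum F z) UNIV)"

definition coeff_K ::
    "((complex ^ 'd) \<times> (complex ^ 'd) \<Rightarrow> complex) \<Rightarrow> ('d \<Rightarrow> nat) \<Rightarrow> ('d \<Rightarrow> nat) \<Rightarrow> complex" where
  "coeff_K K = (THE c. \<forall>z w.
     ((\<lambda>(\<alpha>, \<beta>). c \<alpha> \<beta> * monom_e \<alpha> z * monom_e \<beta> (cnj_vec w)) has_sum K (z, w)) UNIV)"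

definition A_flat1 :: "(complex ^ 'd \<Rightarrow> complex) set" where
  "A_flat1 = {F \<in> A_entire. \<exists>h>0. \<exists>C. \<forall>\<alpha>.
     cmod (coeff_F F \<alpha>) \<le> C * h ^ (\<Sum>i\<in>UNIV. \<alpha> i) / sqrt (mfact \<alpha>)}"

text \<open>The operator \<open>T\<^sub>K\<close> on \<^const>\<open>A_flat1\<close>.\<close>

definition T_op ::
    "((complex ^ 'd) \<times> (complex ^ 'd) \<Rightarrow> complex) \<Rightarrow> (complex ^ 'd \<Rightarrow> complex) \<Rightarrow> complex ^ 'd \<Rightarrow> complex" where
  "T_op K F z = (\<Sum>\<^sub>\<infinity>\<alpha>. (\<Sum>\<^sub>\<infinity>\<beta>. coeff_K K \<alpha> \<beta> * coeff_F F \<beta>) * monom_e \<alpha> z)"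

definition gauss_measure :: "(complex ^ 'd) measure" where
  "gauss_measure = density lborel (\<lambda>w. ennreal (exp (- (norm w)\<^sup>2) / pi ^ CARD('d)))"

text \<open>\<open>T F(z) = \<integral> K(z,w) F(w) d\<mu>(w)\<close> for all \<open>F\<close> in \<open>S\<close>, with absolute convergence for every \<open>z\<close>.\<close>

definition integral_operator_on ::
    "(complex ^ 'd \<Rightarrow> complex) set \<Rightarrow> ((complex ^ 'd) \<times> (complex ^ 'd) \<Rightarrow> complex) \<Rightarrow>
     ((complex ^ 'd \<Rightarrow> complex) \<Rightarrow> complex ^ 'd \<Rightarrow> complex) \<Rightarrow> bool" where
  "integral_operator_on S K T \<longleftrightarrow> (\<forall>F\<in>S. \<forall>z.
     integrable gauss_measure (\<lambda>w. K (z, w) * F w) \<and>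
     T F z = (\<integral>w. K (z, w) * F w \<partial>gauss_measure))"

definition linear_on ::
    "(complex ^ 'd \<Rightarrow> complex) set \<Rightarrow> ((complex ^ 'd \<Rightarrow> complex) \<Rightarrow> complex ^ 'd \<Rightarrow> complex) \<Rightarrow> bool" where
  "linear_on S T \<longleftrightarrow> (\<forall>F\<in>S. \<forall>H\<in>S. \<forall>a b.
     T (\<lambda>z. a * F z + b * H z) = (\<lambda>z. a * T F z + b * T H z))"

text \<open>For a general weight the space \<open>X\<close> need not contain \<^const>\<open>A_flat1\<close>, so extending \<open>T\<^sub>K\<close> means
  agreeing with it wherever both maps are defined. Norm continuity determines such an extension on
  the closure of \<^const>\<open>A_flat1\<close> in \<open>X\<close>. This is all of \<open>X\<close> when \<^const>\<open>A_flat1\<close> is dense, but it is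
  smaller for instance when \<open>X\<close> has two infinite exponents and weight \<open>1\<close>, where Hahn-Banach yields
  further continuous extensions. On all of \<open>X\<close> the extension is singled out by the pairing
  \<open>\<langle>K(z,\<cdot>),F\<rangle>\<close>, that is, by \<^const>\<open>integral_operator_on\<close>.\<close>

definition continuous_extension ::
    "(complex ^ 'd \<Rightarrow> complex) topology \<Rightarrow> (complex ^ 'd \<Rightarrow> complex) topology \<Rightarrow>
     ((complex ^ 'd) \<times> (complex ^ 'd) \<Rightarrow> complex) \<Rightarrow>
     ((complex ^ 'd \<Rightarrow> complex) \<Rightarrow> complex ^ 'd \<Rightarrow> complex) \<Rightarrow> bool" where
  "continuous_extension X Y K T \<longleftrightarrow>
     continuous_map X Y T \<and> (\<forall>F \<in> A_flat1 \<inter> topspace X. T F = T_op K F)"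


section \<open>The transformed kernel\<close>

definition block_mat ::
    "real ^ 'n::finite ^ 'n \<Rightarrow> real ^ 'm::finite ^ 'n \<Rightarrow> real ^ 'n ^ 'm \<Rightarrow> real ^ 'm ^ 'm \<Rightarrow>
     real ^ ('n + 'm) ^ ('n + 'm)" where
  "block_mat P Q R S = (\<chi> r c. case (r, c) of
       (Inl i, Inl j) \<Rightarrow> P $ i $ j | (Inl i, Inr j) \<Rightarrow> Q $ i $ j
     | (Inr i, Inl j) \<Rightarrow> R $ i $ j | (Inr i, Inr j) \<Rightarrow> S $ i $ j)"

definition C_mat :: "real ^ (('d::finite + 'd) + ('d + 'd)) ^ (('d + 'd) + ('d + 'd))" where
  "C_mat = block_mat (mat 1) (block_mat 0 0 0 (mat 1))
                     (mat 1) (block_mat (mat 1) 0 0 0)"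

definition U_map :: "(complex ^ 'd::finite) \<times> (complex ^ 'd) \<Rightarrow> real ^ (('d + 'd) + ('d + 'd))" where
  "U_map = (\<lambda>(z, w). \<chi> k. case k of
       Inl (Inl i) \<Rightarrow> Re (z $ i) | Inl (Inr i) \<Rightarrow> Im (z $ i)
     | Inr (Inl i) \<Rightarrow> Re (w $ i) | Inr (Inr i) \<Rightarrow> Im (w $ i))"

definition K_weighted ::
    "((complex ^ 'd) \<times> (complex ^ 'd) \<Rightarrow> complex) \<Rightarrow> ((complex ^ 'd) \<times> (complex ^ 'd) \<Rightarrow> real) \<Rightarrow>
     (complex ^ 'd) \<times> (complex ^ 'd) \<Rightarrow> real" where
  "K_weighted K \<omega> = (\<lambda>(z, w). exp (- ((norm z)\<^sup>2 + (norm w)\<^sup>2) / 2) * cmod (K (z, w))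
     * \<omega> (sqrt 2 *\<^sub>R cnj_vec z, sqrt 2 *\<^sub>R w))"

definition G_KC ::
    "((complex ^ 'd) \<times> (complex ^ 'd) \<Rightarrow> complex) \<Rightarrow> ((complex ^ 'd) \<times> (complex ^ 'd) \<Rightarrow> real) \<Rightarrow>
     (complex ^ 'd) \<times> (complex ^ 'd) \<Rightarrow> real" where
  "G_KC K \<omega> = K_weighted K \<omega> \<circ> inv U_map \<circ> (\<lambda>v. C_mat *v v) \<circ> U_map"

lemma inj_U_map: "inj U_map"
proof (rule injI)
  fix a b :: "(complex ^ 'd) \<times> (complex ^ 'd)"
  assume eq: "U_map a = U_map b"
  obtain z w z' w' where ab: "a = (z, w)" "b = (z', w')" by (cases a, cases b) auto
  have "Re (z $ i) = Re (z' $ i) \<and> Im (z $ i) = Im (z' $ i) \<and>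
        Re (w $ i) = Re (w' $ i) \<and> Im (w $ i) = Im (w' $ i)" for i
    using arg_cong[OF eq, of "\<lambda>v. v $ Inl (Inl i)"] arg_cong[OF eq, of "\<lambda>v. v $ Inl (Inr i)"]
      arg_cong[OF eq, of "\<lambda>v. v $ Inr (Inl i)"] arg_cong[OF eq, of "\<lambda>v. v $ Inr (Inr i)"]
    by (simp add: U_map_def ab)
  then show "a = b" by (simp add: ab vec_eq_iff complex_eq_iff)
qed

lemma sum_UNIV_Plus:
  fixes f :: "'a::finite + 'b::finite \<Rightarrow> real"
  shows "sum f UNIV = (\<Sum>i\<in>UNIV. f (Inl i)) + (\<Sum>i\<in>UNIV. f (Inr i))"
  by (simp add: sum.Plus flip: UNIV_Plus_UNIV)

lemma C_mat_U_map:
  "C_mat *v U_map (cvec x \<xi>, cvec y \<eta>) = U_map (cvec x (\<xi> + \<eta>), cvec (x + y) \<xi>)"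
  unfolding vec_eq_iff
  by (auto simp: matrix_vector_mult_def sum_UNIV_Plus C_mat_def block_mat_def U_map_def cvec_def
      mat_def if_distrib[where f="\<lambda>u. u * _"] cong: if_cong split: sum.splits)

lemma G_KC_eq:
  "G_KC K \<omega> (cvec x \<xi>, cvec y \<eta>) = K_weighted K \<omega> (cvec x (\<xi> + \<eta>), cvec (x + y) \<xi>)"
  by (simp add: G_KC_def C_mat_U_map inv_f_f[OF inj_U_map])

end

theory Submission
  imports Defs "HOL-Probability.Distributions" "HOL-Complex_Analysis.Cauchy_Integral_Formula"
begin

text \<open>
  Write \<open>z = (x - i\<xi>)/\<surd>2\<close> and \<open>w = (y - i\<eta>)/\<surd>2\<close>. By the inequality between the weights, the modulus of
  \<open>T\<^sub>K F(z)\<close>, suitably weighted, is at most a constant times the integral over \<open>(y, \<eta>)\<close> of \<open>g\<^sub>F(y, \<eta>)\<close> times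
  the value of \<open>G\<^sub>K\<close> at \<open>((x - i\<eta>)/\<surd>2, ((y - x) + i(\<eta> - \<xi>))/\<surd>2)\<close>. For fixed \<open>x\<close> and \<open>\<eta>\<close> the inner
  \<open>L\<^sup>q\<close> norm of \<open>G\<^sub>K\<close> is therefore an \<open>L\<^sup>q\<close> norm in \<open>(\<xi>, y)\<close>. Duality in \<open>\<xi>\<close>, Hoelder's inequality in
  \<open>(\<xi>, y)\<close> and then in \<open>\<eta>\<close>, and finally the \<open>L\<^sup>p\<close> norm in \<open>x\<close> yield the norm estimate.

  The estimate controls \<open>\<integral>|K(z,w) F(w)| d\<mu>(w)\<close> only for almost every \<open>z\<close>, but locally integrably.
  The mean value property of \<open>K(\<cdot>, w)\<close> over polydiscs turns this into a majorant of \<open>K(z, w)\<close> that is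
  locally uniform in \<open>z\<close>, so the integral converges for every \<open>z\<close> and is entire in \<open>z\<close>. On
  \<open>\<A>\<^bsub>\<flat>1\<^esub>\<close> it agrees with the coefficient formula because monomials are orthogonal on
  polydiscs with respect to \<open>\<mu>\<close>; the radius tends to infinity at the end.

  Weights are merely Lebesgue measurable, so mixed norms are computed through Borel majorants that
  agree with the given functions almost everywhere.
\<close>

section \<open>Norms on arbitrary measure spaces\<close>

text \<open>The matrix C is what makes the exponents fit. It sends the real coordinates (x, -\<eta>,
  y - x, \<eta> - \<xi>) to (x, -\<xi>, y, -\<eta>), so sqrt 2 times (z, w) is the image of a point
  whose first half depends on (x, \<eta>) only and whose second half is, for fixed x and \<eta>, a
  translate and reflection of (y, \<xi>). Hence q pairs with q' in y and p with p' in \<eta>, in the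
  order in which the norm of F takes them, while the L^p norms in x and \<eta> combine to one norm
  over C^d. The substitutions cost 2^(d/p) and 2^(d/q). Both are bounded by 2^d, so that one
  constant serves all exponents and all K. The obstacle is that \<open>A_flat1\<close> need not be
  dense in the domain, nor contained in it. A norm bound says nothing about a single z, since
  weights and mixed norms see functions only up to null sets; holomorphy of K in z is what bridges
  this gap.\<close>

lemma epowr_ennreal: "0 \<le> r \<Longrightarrow> epowr (ennreal r) a = ennreal (r powr a)"
  by (simp add: epowr_def)

lemma epowr_top [simp]: "epowr top a = top"
  by (simp add: epowr_def)

lemma epowr_0 [simp]: "epowr 0 a = 0"
  by (simp add: epowr_def)

lemma epowr_base_1 [simp]: "epowr 1 a = 1"
  by (simp add: epowr_def)

lemma epowr_exponent_1 [simp]: "epowr x 1 = x"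
  by (cases x) (auto simp: epowr_ennreal)

lemma epowr_eq_0_iff [simp]: "epowr x a = 0 \<longleftrightarrow> x = 0"
  by (cases x) (auto simp: epowr_ennreal ennreal_eq_0_iff)

lemma epowr_eq_top_iff [simp]: "epowr x a = top \<longleftrightarrow> x = top"
  by (cases x) (auto simp: epowr_ennreal)

lemma epowr_mono: "0 \<le> a \<Longrightarrow> x \<le> y \<Longrightarrow> epowr x a \<le> epowr y a"
  by (cases x; cases y) (auto simp: epowr_ennreal powr_mono2 top_unique)

text \<open>The values 0 and \<open>top\<close> are fixed by \<open>epowr\<close> for every
  exponent, even 0 or a negative one, so only the finite positive case involves
  \<open>powr\<close>.\<close>

lemma epowr_mult: "epowr (x * y) a = epowr x a * epowr y a"
proof (cases "x = 0 \<or> y = 0")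
  case False
  then show ?thesis
    by (cases x; cases y)
      (auto simp: epowr_ennreal powr_mult ennreal_mult'[symmetric] ennreal_mult_eq_top_iff
         ennreal_mult_top ennreal_top_mult)
qed auto

lemma epowr_epowr: "epowr (epowr x a) b = epowr x (a * b)"
  by (cases x) (auto simp: epowr_ennreal powr_powr)

lemma epowr_add: "epowr x a * epowr x b = epowr x (a + b)"
  by (cases x) (auto simp: epowr_ennreal powr_add ennreal_mult'[symmetric] ennreal_mult_top)

lemma measurable_epowr [measurable (raw)]:
  "f \<in> borel_measurable M \<Longrightarrow> (\<lambda>x. epowr (f x) a) \<in> borel_measurable M"
proof -
  assume [measurable]: "f \<in> borel_measurable M"
  have [measurable]: "{x \<in> space M. f x = top} \<in> sets M" by measurable
  show ?thesis unfolding epowr_def infinity_ennreal_def by measurable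
qed

text \<open>For \<open>p = \<infinity>\<close> the infimum replaces \<^const>\<open>esssup\<close>, which is \<open>\<infinity>\<close> on nonmeasurable functions.\<close>

definition Lnorm :: "'a measure \<Rightarrow> ennreal \<Rightarrow> ('a \<Rightarrow> ennreal) \<Rightarrow> ennreal" where
  "Lnorm M p f = (if p = \<infinity> then Inf {C. AE x in M. f x \<le> C}
     else epowr (\<integral>\<^sup>+ x. epowr (f x) (enn2real p) \<partial>M) (1 / enn2real p))"

section \<open>Conjugate exponents, Hoelder's inequality, duality and Minkowski's inequality\<close>

text \<open>In \<open>ennreal\<close> one has \<open>1 / top = 0\<close> and
  \<open>1 / 0 = top\<close>, so the single equation covers the two endpoint pairs and rules out the
  exponent 0.\<close>

lemma conjugate_cases:
  fixes p q :: ennreal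
  assumes "1 / p + 1 / q = 1"
  obtains "p = 1" "q = \<infinity>" | "p = \<infinity>" "q = 1"
  | r s where "p = ennreal r" "q = ennreal s" "1 < r" "1 < s" "1 / r + 1 / s = 1"
proof -
  have inv: "inverse p + inverse q = 1" using assms by (simp add: divide_ennreal_def)
  show thesis
  proof (cases "p = 0 \<or> q = 0")
    case True
    then show thesis using inv by auto
  next
    case nz: False
    show thesis
    proof (cases "p = top \<or> q = top")
      case True
      then consider "p = top" "inverse q = 1" | "q = top" "inverse p = 1" using inv by auto
      moreover have "x = 1" if "inverse x = 1" "x \<noteq> 0" for x :: ennreal
        using that by (cases x) (auto simp: inverse_ennreal ennreal_eq_0_iff less_le)
      ultimately show thesis
        using that(1,2) nz by cases auto
    next
      case False
      then obtain r s where rs: "p = ennreal r" "q = ennreal s" "0 < r" "0 < s"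
        using nz by (cases p; cases q) (auto simp: ennreal_eq_0_iff less_le)
      then have "ennreal (inverse r + inverse s) = ennreal 1"
        using inv by (simp add: inverse_ennreal)
      then have eq: "inverse r + inverse s = 1"
        using rs by (subst (asm) ennreal_inj) auto
      have "inverse r < 1" "inverse s < 1"
        using eq rs by (smt (verit) positive_imp_inverse_positive)+
      then have "1 < r" "1 < s" using rs by (simp_all add: inverse_less_1_iff)
      then show thesis using that(3)[OF rs(1,2)] eq by (simp add: inverse_eq_divide)
    qed
  qed
qed

lemma exponent_cases:
  fixes p :: ennreal
  assumes "1 \<le> p"
  obtains "p = \<infinity>" | r where "p = ennreal r" "1 \<le> r"
  using assms by (cases p) (auto simp: ennreal_le_iff)

lemma Lnorm_ennreal:
  "0 \<le> r \<Longrightarrow> Lnorm M (ennreal r) f = epowr (\<integral>\<^sup>+ x. epowr (f x) r \<partial>M) (1 / r)"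
  by (simp add: Lnorm_def)

lemma Lnorm_one: "Lnorm M 1 f = (\<integral>\<^sup>+ x. f x \<partial>M)"
  using Lnorm_ennreal[of 1 M f] by simp

lemma Lnorm_top: "Lnorm M top f = Inf {C. AE x in M. f x \<le> C}"
  by (simp add: Lnorm_def)

text \<open>The infimum ranges over uncountably many bounds. A sequence of admissible bounds with
  the same infimum leaves only countably many null sets, so the infimum is itself an essential
  bound.\<close>

lemma AE_le_Lnorm_top: "AE x in M. f x \<le> Lnorm M top f"
proof -
  let ?S = "{C. AE x in M. f x \<le> C}"
  have "?S \<noteq> {}" by (auto intro: exI[of _ top])
  from ennreal_Inf_countable_INF[OF this]
  obtain u :: "nat \<Rightarrow> ennreal" where u: "range u \<subseteq> ?S" "Inf ?S = (INF n. u n)" by (elim exE conjE) (rule that, assumption+)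
  have "AE x in M. \<forall>n. f x \<le> u n"
    using u(1) by (subst AE_all_countable) auto
  then show ?thesis
    unfolding Lnorm_top u(2) by (auto intro: INF_greatest elim!: eventually_mono)
qed

lemma Lnorm_top_le: "AE x in M. f x \<le> C \<Longrightarrow> Lnorm M top f \<le> C"
  unfolding Lnorm_top by (rule Inf_lower) simp

lemma Lnorm_mono_AE:
  assumes "AE x in M. f x \<le> g x"
  shows "Lnorm M p f \<le> Lnorm M p g"
proof (cases "p = \<infinity>")
  case True
  have "AE x in M. f x \<le> Lnorm M top g"
    using assms AE_le_Lnorm_top[of g M] by eventually_elim auto
  then show ?thesis using True by (auto intro: Lnorm_top_le)
next
  case False
  have "AE x in M. epowr (f x) (enn2real p) \<le> epowr (g x) (enn2real p)"
    using assms by eventually_elim (auto intro: epowr_mono)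
  then show ?thesis using False
    by (auto simp: Lnorm_def intro!: epowr_mono nn_integral_mono_AE)
qed

lemma Lnorm_cong_AE:
  assumes eq: "AE x in M. f x = g x"
  shows "Lnorm M p f = Lnorm M p g"
proof (rule antisym)
  show "Lnorm M p f \<le> Lnorm M p g"
    by (rule Lnorm_mono_AE) (use eq in \<open>eventually_elim, simp\<close>)
  show "Lnorm M p g \<le> Lnorm M p f"
    by (rule Lnorm_mono_AE) (use eq in \<open>eventually_elim, simp\<close>)
qed

lemma Lnorm_mono: "(\<And>x. f x \<le> g x) \<Longrightarrow> Lnorm M p f \<le> Lnorm M p g"
  by (rule Lnorm_mono_AE) simp

lemma Lnorm_cmult_le:
  assumes "1 \<le> p" "f \<in> borel_measurable M"
  shows "Lnorm M p (\<lambda>x. c * f x) \<le> c * Lnorm M p f"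
  using assms(1)
proof (cases rule: exponent_cases)
  case 1
  have "AE x in M. c * f x \<le> c * Lnorm M top f"
    using AE_le_Lnorm_top[of f M] by eventually_elim (auto intro: mult_left_mono)
  then show ?thesis using 1 by (auto intro: Lnorm_top_le)
next
  case (2 r)
  then show ?thesis using assms(2)
    by (simp add: Lnorm_ennreal epowr_mult nn_integral_cmult epowr_epowr)
qed

lemma Lnorm_eq_0_AE:
  assumes "1 \<le> p" "f \<in> borel_measurable M" "Lnorm M p f = 0"
  shows "AE x in M. f x = 0"
  using assms(1)
proof (cases rule: exponent_cases)
  case 1
  then show ?thesis using AE_le_Lnorm_top[of f M] assms(3) by auto
next
  case (2 r)
  then show ?thesis using assms(2,3)
    by (simp add: Lnorm_ennreal nn_integral_0_iff_AE)
qed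

lemma Young_ennreal:
  assumes "1 < r" "1 < s" "1 / r + 1 / s = 1"
  shows "x * y \<le> ennreal (1 / r) * epowr x r + ennreal (1 / s) * epowr y s"
proof (cases "x = top \<or> y = top")
  case True
  then show ?thesis using assms by (auto simp: ennreal_mult_top)
next
  case False
  then obtain a b where "x = ennreal a" "y = ennreal b" "0 \<le> a" "0 \<le> b"
    by (metis ennreal_cases infinity_ennreal_def)
  with Youngs_inequality[of r s a b] assms show ?thesis
    by (simp add: epowr_ennreal ennreal_mult'[symmetric] ennreal_plus[symmetric] ennreal_leI
        del: ennreal_plus)
qed

text \<open>After division by the two norms, Young's inequality integrates to 1 / r + 1 / s = 1. A
  vanishing norm forces the product to vanish almost everywhere; an infinite norm makes the bound
  trivial once the other one is nonzero.\<close>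

lemma Hoelder:
  assumes "1 / p + 1 / q = 1"
    and [measurable]: "f \<in> borel_measurable M" "g \<in> borel_measurable M"
  shows "(\<integral>\<^sup>+ x. f x * g x \<partial>M) \<le> Lnorm M p f * Lnorm M q g"
proof -
  have infty: "(\<integral>\<^sup>+ x. f x * g x \<partial>M) \<le> Lnorm M 1 f * Lnorm M top g"
    if [measurable]: "f \<in> borel_measurable M" "g \<in> borel_measurable M" for f g
  proof -
    have "AE x in M. f x * g x \<le> f x * Lnorm M top g"
      using AE_le_Lnorm_top[of g M] by eventually_elim (auto intro: mult_left_mono)
    then have "(\<integral>\<^sup>+ x. f x * g x \<partial>M) \<le> (\<integral>\<^sup>+ x. f x * Lnorm M top g \<partial>M)"
      by (rule nn_integral_mono_AE)
    then show ?thesis by (simp add: Lnorm_one nn_integral_multc)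
  qed
  show ?thesis using assms(1)
  proof (cases rule: conjugate_cases)
    case 1
    then show ?thesis using infty[OF assms(2,3)] by simp
  next
    case 2
    then show ?thesis using infty[OF assms(3,2)] by (simp add: mult.commute)
  next
    case (3 r s)
    define A where "A = (\<integral>\<^sup>+ x. epowr (f x) r \<partial>M)"
    define B where "B = (\<integral>\<^sup>+ x. epowr (g x) s \<partial>M)"
    have norms: "Lnorm M p f = epowr A (1 / r)" "Lnorm M q g = epowr B (1 / s)"
      using 3 by (simp_all add: Lnorm_ennreal A_def B_def)
    show ?thesis
    proof (cases "A = 0 \<or> B = 0")
      case True
      then have "AE x in M. f x * g x = 0"
        by (auto simp: A_def B_def nn_integral_0_iff_AE elim: eventually_mono)
      then have "(\<integral>\<^sup>+ x. f x * g x \<partial>M) = 0"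
        by (simp add: nn_integral_0_iff_AE)
      then show ?thesis by simp
    next
      case nz: False
      show ?thesis
      proof (cases "A = top \<or> B = top")
        case True
        then show ?thesis using nz by (auto simp: norms ennreal_mult_top ennreal_top_mult)
      next
        case False
        define a where "a = epowr A (1 / r)"
        define b where "b = epowr B (1 / s)"
        have ab: "a \<noteq> 0" "a \<noteq> top" "b \<noteq> 0" "b \<noteq> top"
          using nz False by (auto simp: a_def b_def)
        have pow: "epowr a r = A" "epowr b s = B"
          using 3 by (auto simp: a_def b_def epowr_epowr)
        have canc: "a * inverse a = 1" "b * inverse b = 1" "A * inverse A = 1" "B * inverse B = 1"
          using ab nz False by (simp_all add: less_top flip: divide_ennreal_def)
        have ip: "epowr (inverse a) r * A = 1" "epowr (inverse b) s * B = 1"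
          using canc by (simp_all flip: pow epowr_mult add: mult.commute)
        have "(\<integral>\<^sup>+ x. f x * g x \<partial>M)
            = (\<integral>\<^sup>+ x. (a * b) * ((inverse a * f x) * (inverse b * g x)) \<partial>M)"
        proof (rule nn_integral_cong)
          fix x
          have "(a * b) * ((inverse a * f x) * (inverse b * g x))
              = (a * inverse a) * (b * inverse b) * (f x * g x)"
            by (simp only: mult_ac)
          then show "f x * g x = (a * b) * ((inverse a * f x) * (inverse b * g x))"
            by (simp add: canc)
        qed
        also have "\<dots> = (a * b) * (\<integral>\<^sup>+ x. (inverse a * f x) * (inverse b * g x) \<partial>M)"
          by (rule nn_integral_cmult) measurable
        also have "\<dots> \<le> (a * b) * (\<integral>\<^sup>+ x. ennreal (1 / r) * epowr (inverse a * f x) r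
            + ennreal (1 / s) * epowr (inverse b * g x) s \<partial>M)"
          using 3 by (intro mult_left_mono nn_integral_mono Young_ennreal) auto
        also have "\<dots> = (a * b) * (ennreal (1 / r) * (epowr (inverse a) r * A)
            + ennreal (1 / s) * (epowr (inverse b) s * B))"
          by (simp add: epowr_mult nn_integral_add nn_integral_cmult A_def B_def)
        also have "\<dots> = a * b"
          using 3 by (simp add: ip ennreal_plus[symmetric] del: ennreal_plus)
        finally show ?thesis by (simp add: norms a_def b_def)
      qed
    qed
  qed
qed

text \<open>For \<open>1 < p < \<infinity>\<close> the test functions are the \<open>(p - 1)\<close>-st powers of truncations of \<open>U\<close>.\<close>

lemma (in sigma_finite_measure) Lnorm_leI_dual:
  assumes pq: "1 / p + 1 / q = 1"
    and [measurable]: "U \<in> borel_measurable M"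
    and le: "\<And>v. v \<in> borel_measurable M \<Longrightarrow> (\<integral>\<^sup>+ x. U x * v x \<partial>M) \<le> S * Lnorm M q v"
  shows "Lnorm M p U \<le> S"
proof -
  obtain B where B: "range B \<subseteq> sets M" "(\<Union>i. B i) = space M" "\<And>i. emeasure M (B i) \<noteq> \<infinity>" "incseq B"
    using sigma_finite_incseq by blast
  have [measurable]: "B i \<in> sets M" for i using B(1) by auto
  show ?thesis using pq
  proof (cases rule: conjugate_cases)
    case 1
    have "(\<integral>\<^sup>+ x. U x * 1 \<partial>M) \<le> S * Lnorm M top (\<lambda>_. 1)"
      using le[of "\<lambda>_. 1"] 1 by auto
    also have "\<dots> \<le> S * 1" by (intro mult_left_mono Lnorm_top_le) auto
    finally show ?thesis using 1 by (simp add: Lnorm_one)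
  next
    case 2
    show ?thesis
    proof (cases "S = top")
      case False
      have "AE x in M. x \<in> B i \<longrightarrow> \<not> S + ennreal (1 / Suc n) \<le> U x" for i n
      proof -
        \<comment> \<open>If U exceeded S by 1 / (n + 1) on a set of positive measure, the indicator
          of that set would violate the bound. Intersecting with \<open>B i\<close> keeps the
          measure finite, so that S times the measure can be cancelled.\<close>
        let ?E = "{x \<in> space M. x \<in> B i \<and> S + ennreal (1 / Suc n) \<le> U x}"
        have fin: "emeasure M ?E < top"
        proof -
          have "emeasure M ?E \<le> emeasure M (B i)" by (intro emeasure_mono) auto
          then show ?thesis using B(3)[of i] by (auto simp: less_top top_unique)
        qed
        have "(S + ennreal (1 / Suc n)) * emeasure M ?E
            = (\<integral>\<^sup>+ x. (S + ennreal (1 / Suc n)) * indicator ?E x \<partial>M)"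
          by (simp add: nn_integral_cmult_indicator)
        also have "\<dots> \<le> (\<integral>\<^sup>+ x. U x * indicator ?E x \<partial>M)"
          by (intro nn_integral_mono) (auto simp: indicator_def)
        also have "\<dots> \<le> S * emeasure M ?E"
          using le[of "indicator ?E"] 2 by (simp add: Lnorm_one)
        finally have "S * emeasure M ?E + ennreal (1 / Suc n) * emeasure M ?E \<le> S * emeasure M ?E + 0"
          by (simp add: distrib_right)
        moreover have "S * emeasure M ?E < top"
          using False fin by (auto simp: ennreal_mult_less_top less_top)
        ultimately have "ennreal (1 / Suc n) * emeasure M ?E \<le> 0"
          by (subst (asm) ennreal_add_left_cancel_le) auto
        then have "emeasure M ?E = 0" by simp
        then show ?thesis by (subst AE_iff_measurable[of ?E]) auto
      qed
      then have "AE x in M. \<forall>i n. x \<in> B i \<longrightarrow> \<not> S + ennreal (1 / Suc n) \<le> U x"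
        by (intro AE_all_countable[THEN iffD2] allI)
      then have "AE x in M. U x \<le> S"
      proof (rule AE_mp, intro AE_I2 impI)
        fix x assume "x \<in> space M" and *: "\<forall>i n. x \<in> B i \<longrightarrow> \<not> S + ennreal (1 / Suc n) \<le> U x"
        then have **: "U x < S + ennreal (1 / Suc n)" for n using B(2) by (auto simp: not_le)
        have "(\<lambda>n. S + ennreal (1 / Suc n)) \<longlonglongrightarrow> S + ennreal 0"
          by (intro tendsto_add tendsto_const tendsto_ennrealI) (rule LIMSEQ_inverse_real_of_nat[unfolded inverse_eq_divide])
        then show "U x \<le> S"
          by (intro LIMSEQ_le_const[of _ S] exI[of _ 0]) (auto simp: less_imp_le ** simp del: of_nat_Suc)
      qed
      then show ?thesis using 2 by (auto intro: Lnorm_top_le)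
    qed auto
  next
    case (3 r s)
    \<comment> \<open>Truncation both in height and in support makes \<open>J n\<close> finite,
      which is what permits cancelling \<open>epowr (J n) (1 / s)\<close> below.\<close>
    define V where "V n x = min (U x) (of_nat n) * indicator (B n) x" for n x
    have [measurable]: "V n \<in> borel_measurable M" for n unfolding V_def by measurable
    have rs: "(r - 1) * s = r" "1 + (r - 1) = r" "1 - 1 / s = 1 / r"
      using 3 by (auto simp: field_simps)
    define J where "J n = (\<integral>\<^sup>+ x. epowr (V n x) r \<partial>M)" for n
    have Jle: "J n \<le> epowr S r" for n
    proof -
      \<comment> \<open>The s-th power of the test function is \<open>V n\<close> to the power r,
        because (r - 1) s = r. Both sides of the bound thus become powers of the same
        \<open>J n\<close>.\<close>
      have "J n = (\<integral>\<^sup>+ x. V n x * epowr (V n x) (r - 1) \<partial>M)"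
        using epowr_add[of _ 1 "r - 1"] by (simp add: J_def)
      also have "\<dots> \<le> (\<integral>\<^sup>+ x. U x * epowr (V n x) (r - 1) \<partial>M)"
        by (intro nn_integral_mono mult_right_mono) (auto simp: V_def indicator_def)
      also have "\<dots> \<le> S * Lnorm M q (\<lambda>x. epowr (V n x) (r - 1))"
        by (intro le) measurable
      also have "Lnorm M q (\<lambda>x. epowr (V n x) (r - 1)) = epowr (J n) (1 / s)"
        using 3 by (simp add: Lnorm_ennreal J_def epowr_epowr rs)
      finally have *: "J n \<le> S * epowr (J n) (1 / s)" .
      have "J n \<le> (\<integral>\<^sup>+ x. epowr (of_nat n) r * indicator (B n) x \<partial>M)"
        unfolding J_def V_def using 3
        by (intro nn_integral_mono) (auto simp: indicator_def intro!: epowr_mono)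
      also have "\<dots> < top"
        using B(3)[of n] by (simp add: nn_integral_cmult_indicator ennreal_mult_less_top less_top epowr_def)
      finally have fin: "J n < top" .
      show ?thesis
      proof (cases "J n = 0")
        case False
        have pn: "epowr (J n) (1 / s) \<noteq> 0" "epowr (J n) (1 / s) < top"
          using False fin by (auto simp: less_top[symmetric])
        have "epowr (J n) (1 / r) * epowr (J n) (1 / s) = J n"
          using 3 by (simp add: epowr_add)
        with * have "epowr (J n) (1 / r) \<le> S"
          using pn ennreal_mult_le_mult_iff[of "epowr (J n) (1 / s)" "epowr (J n) (1 / r)" S]
          using fin by (auto simp: mult.commute)
        then have "epowr (epowr (J n) (1 / r)) r \<le> epowr S r"
          using 3 by (intro epowr_mono) auto
        then show ?thesis using 3 by (simp add: epowr_epowr)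
      qed simp
    qed
    have inc: "incseq (\<lambda>n x. epowr (V n x) r)"
      unfolding incseq_def le_fun_def V_def using 3 B(4)
      by (auto intro!: epowr_mono mult_mono min.mono simp: indicator_def incseq_def)
    have sup: "(SUP n. epowr (V n x) r) = epowr (U x) r" if "x \<in> space M" for x
    proof -
      obtain k where k: "x \<in> B k" using B(2) \<open>x \<in> space M\<close> by auto
      show ?thesis
      proof (cases "U x = top")
        case False
        then obtain m where m: "U x \<le> of_nat m" 
          by (metis ennreal_Ex_less_of_nat infinity_ennreal_def less_imp_le less_top)
        have xB: "x \<in> B (max k m)" using k incseqD[OF B(4), of k "max k m"] by auto
        have "of_nat m \<le> (of_nat (max k m) :: ennreal)"
          by (simp add: of_nat_max)
        then have "U x \<le> of_nat (max k m)" using m by (rule order_trans[rotated])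
        then have "V (max k m) x = U x" using xB by (simp add: V_def min_absorb1)
        then have "epowr (U x) r \<le> (SUP n. epowr (V n x) r)"
          by (intro SUP_upper2[of "max k m"]) auto
        moreover have "(SUP n. epowr (V n x) r) \<le> epowr (U x) r"
          using 3 by (intro SUP_least epowr_mono) (auto simp: V_def indicator_def)
        ultimately show ?thesis by simp
      next
        case True
        have "of_nat m \<le> (SUP n. epowr (V n x) r)" for m
        proof -
          \<comment> \<open>The index is at least 1 so that its r-th power dominates it; it is at
            least k so that x lies in \<open>B j\<close>.\<close>
          define j where "j = max k (max m 1)"
          have xB: "x \<in> B j" using k incseqD[OF B(4), of k j] by (auto simp: j_def)
          have "of_nat m \<le> (of_nat j :: ennreal)" by (simp add: j_def)
          also have "of_nat j = ennreal (real j powr 1)" by (simp add: j_def ennreal_of_nat_eq_real_of_nat)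
          also have "\<dots> \<le> ennreal (real j powr r)" using 3
            by (intro ennreal_leI powr_mono) (auto simp: j_def)
          also have "\<dots> = epowr (V j x) r"
            using True xB by (simp add: V_def epowr_ennreal ennreal_of_nat_eq_real_of_nat)
          also have "\<dots> \<le> (SUP n. epowr (V n x) r)" by (rule SUP_upper) simp
          finally show ?thesis .
        qed
        then have "(SUP n. epowr (V n x) r) = top"
          by (metis ennreal_Ex_less_of_nat leD infinity_ennreal_def less_top)
        then show ?thesis using True by simp
      qed
    qed
    have "(\<integral>\<^sup>+ x. epowr (U x) r \<partial>M) = (\<integral>\<^sup>+ x. (SUP n. epowr (V n x) r) \<partial>M)"
      by (intro nn_integral_cong) (simp add: sup)
    also have "\<dots> = (SUP n. J n)"
      unfolding J_def by (intro nn_integral_monotone_convergence_SUP inc) measurable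
    also have "\<dots> \<le> epowr S r" by (intro SUP_least Jle)
    finally have "epowr (\<integral>\<^sup>+ x. epowr (U x) r \<partial>M) (1 / r) \<le> epowr (epowr S r) (1 / r)"
      using 3 by (intro epowr_mono) auto
    then show ?thesis using 3 by (simp add: Lnorm_ennreal epowr_epowr)
  qed
qed

lemma conjugate_exists:
  fixes p :: ennreal
  assumes "1 \<le> p"
  shows "\<exists>q. 1 / p + 1 / q = 1"
  using assms
proof (cases rule: exponent_cases)
  case 1
  then show ?thesis by (intro exI[of _ 1]) simp
next
  case (2 r)
  show ?thesis
  proof (cases "r = 1")
    case True
    with 2 show ?thesis by (intro exI[of _ top]) simp
  next
    case False
    then have "1 < r" using 2 by simp
    then have "1 / ennreal r + 1 / ennreal (r / (r - 1)) = ennreal (1 / r + (r - 1) / r)"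
      by (simp add: divide_ennreal flip: ennreal_1 del: ennreal_1)
    also have "1 / r + (r - 1) / r = 1" using \<open>1 < r\<close> by (simp add: field_simps)
    finally show ?thesis using 2 by (intro exI[of _ "ennreal (r / (r - 1))"]) simp
  qed
qed

lemma conjugate_ge_1:
  fixes p q :: ennreal
  assumes "1 / p + 1 / q = 1"
  shows "1 \<le> q"
  using assms by (cases rule: conjugate_cases) (auto simp flip: ennreal_1)

text \<open>Duality reduces Minkowski's inequality, for every p at once, to additivity of the
  integral and two uses of Hoelder's inequality.\<close>

lemma (in sigma_finite_measure) Lnorm_triangle:
  assumes "1 \<le> p" and [measurable]: "f \<in> borel_measurable M" "g \<in> borel_measurable M"
  shows "Lnorm M p (\<lambda>x. f x + g x) \<le> Lnorm M p f + Lnorm M p g"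
proof -
  obtain q where pq: "1 / p + 1 / q = 1" using conjugate_exists[OF assms(1)] by blast
  show ?thesis
  proof (rule Lnorm_leI_dual[OF pq])
    fix v :: "'a \<Rightarrow> ennreal" assume [measurable]: "v \<in> borel_measurable M"
    have "(\<integral>\<^sup>+ x. (f x + g x) * v x \<partial>M) = (\<integral>\<^sup>+ x. f x * v x \<partial>M) + (\<integral>\<^sup>+ x. g x * v x \<partial>M)"
      by (simp add: distrib_right nn_integral_add)
    also have "\<dots> \<le> Lnorm M p f * Lnorm M q v + Lnorm M p g * Lnorm M q v"
      by (intro add_mono Hoelder[OF pq]) measurable
    finally show "(\<integral>\<^sup>+ x. (f x + g x) * v x \<partial>M) \<le> (Lnorm M p f + Lnorm M p g) * Lnorm M q v"
      by (simp add: distrib_right)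
  qed measurable
qed

section \<open>Norms on product spaces and under changes of variables\<close>

text \<open>For finite p this is measurability of parameter integrals. For p = \<infinity> the norm
  of f x exceeds c exactly if the section of the set where f > c has positive measure, and the
  measure of sections is a measurable function of x.\<close>

lemma (in sigma_finite_measure) measurable_Lnorm [measurable (raw)]:
  assumes f[measurable]: "case_prod f \<in> borel_measurable (N \<Otimes>\<^sub>M M)"
  shows "(\<lambda>x. Lnorm M p (f x)) \<in> borel_measurable N"
proof (cases "p = \<infinity>")
  case False
  then show ?thesis unfolding Lnorm_def by simp
next
  case True
  show ?thesis
  proof (rule borel_measurableI_greater)
    fix c :: ennreal
    let ?Q = "{z \<in> space (N \<Otimes>\<^sub>M M). c < case_prod f z}"
    have Q: "?Q \<in> sets (N \<Otimes>\<^sub>M M)" by measurable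
    have "c < Lnorm M p (f x) \<longleftrightarrow> emeasure M (Pair x -` ?Q) \<noteq> 0" if x: "x \<in> space N" for x
    proof -
      have [measurable]: "f x \<in> borel_measurable M"
        using measurable_compose[OF measurable_Pair1'[OF x] f] by simp
      have "Lnorm M p (f x) \<le> c \<longleftrightarrow> (AE y in M. f x y \<le> c)"
        using True AE_le_Lnorm_top[of "f x" M] by (auto intro: Lnorm_top_le order_trans elim: eventually_mono)
      also have "\<dots> \<longleftrightarrow> emeasure M (Pair x -` ?Q) = 0"
        using x by (subst AE_iff_measurable[OF _ refl]) 
          (auto simp: space_pair_measure not_le intro!: arg_cong[where f="\<lambda>A. emeasure M A = 0"])
      finally show ?thesis by (simp add: not_le[symmetric])
    qed
    then have "{x \<in> space N. c < Lnorm M p (f x)} = {x \<in> space N. emeasure M (Pair x -` ?Q) \<noteq> 0}"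
      by blast
    also have "\<dots> \<in> sets N"
      using measurable_emeasure_Pair[OF Q] by measurable
    finally show "{x \<in> space N. c < Lnorm M p (f x)} \<in> sets N" .
  qed
qed

lemma (in pair_sigma_finite) Lnorm_tensor_le:
  assumes "1 \<le> p" and [measurable]: "f \<in> borel_measurable M1" "g \<in> borel_measurable M2"
  shows "Lnorm (M1 \<Otimes>\<^sub>M M2) p (\<lambda>(x, y). f x * g y) \<le> Lnorm M1 p f * Lnorm M2 p g"
  using assms(1)
proof (cases rule: exponent_cases)
  case 1
  have "AE x in M1. AE y in M2. f x * g y \<le> Lnorm M1 top f * Lnorm M2 top g"
    using AE_le_Lnorm_top[of f M1]
  proof eventually_elim
    case (elim x)
    then show ?case using AE_le_Lnorm_top[of g M2]
      by (auto elim!: eventually_mono intro: mult_mono)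
  qed
  then have "AE z in M1 \<Otimes>\<^sub>M M2. (case z of (x, y) \<Rightarrow> f x * g y) \<le> Lnorm M1 top f * Lnorm M2 top g"
    by (intro AE_pair_measure) (auto simp: split_beta')
  then show ?thesis using 1 by (auto intro: Lnorm_top_le)
next
  case (2 r)
  have "(\<integral>\<^sup>+ z. epowr (case z of (x, y) \<Rightarrow> f x * g y) r \<partial>(M1 \<Otimes>\<^sub>M M2))
      = (\<integral>\<^sup>+ x. \<integral>\<^sup>+ y. epowr (f x) r * epowr (g y) r \<partial>M2 \<partial>M1)"
    by (subst M2.nn_integral_fst[symmetric]) (auto simp: epowr_mult)
  also have "\<dots> = (\<integral>\<^sup>+ x. epowr (f x) r \<partial>M1) * (\<integral>\<^sup>+ y. epowr (g y) r \<partial>M2)"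
    by (simp add: nn_integral_cmult nn_integral_multc)
  finally show ?thesis using 2 by (simp add: Lnorm_ennreal epowr_mult)
qed

text \<open>Tonelli for finite p; for p = \<infinity> almost every section of a null set is null. It
  merges the two L^p norms in x and \<eta> into a single one, to which a change of variables on C^d
  applies.\<close>

lemma (in pair_sigma_finite) Lnorm_iterated_le:
  assumes "1 \<le> p" and [measurable]: "f \<in> borel_measurable (M1 \<Otimes>\<^sub>M M2)"
  shows "Lnorm M1 p (\<lambda>x. Lnorm M2 p (\<lambda>y. f (x, y))) \<le> Lnorm (M1 \<Otimes>\<^sub>M M2) p f"
  using assms(1)
proof (cases rule: exponent_cases)
  case 1
  have "AE x in M1. AE y in M2. f (x, y) \<le> Lnorm (M1 \<Otimes>\<^sub>M M2) top f"
    by (rule AE_pair[OF AE_le_Lnorm_top])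
  then show ?thesis using 1 by (auto intro!: Lnorm_top_le elim!: eventually_mono)
next
  case (2 r)
  then show ?thesis
    by (simp add: Lnorm_ennreal epowr_epowr M2.nn_integral_fst[of "\<lambda>z. epowr (f z) r"])
qed

text \<open>The exact factor is c to the power 1 / p, read as 1 for p = \<infinity>. With
  \<open>c \<le> d\<close> and \<open>1 \<le> d\<close> it is at most d, which gives one constant
  for all exponents.\<close>

lemma Lnorm_density_const_le:
  assumes "1 \<le> p" "0 < c" "c \<le> d" "1 \<le> d"
    and [measurable]: "T \<in> measurable M N" "f \<in> borel_measurable N"
    and distr: "distr M N T = density N (\<lambda>_. ennreal c)"
  shows "Lnorm M p (\<lambda>x. f (T x)) \<le> ennreal d * Lnorm N p f"
  using assms(1)
proof (cases rule: exponent_cases)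
  case 1
  have "AE x in distr M N T. f x \<le> Lnorm N top f"
    unfolding distr using AE_le_Lnorm_top[of f N] by (subst AE_density) auto
  then have "AE x in M. f (T x) \<le> Lnorm N top f"
    by (subst (asm) AE_distr_iff) auto
  then have "Lnorm M p (\<lambda>x. f (T x)) \<le> Lnorm N p f"
    using 1 by (auto intro: Lnorm_top_le)
  also have "\<dots> \<le> ennreal d * Lnorm N p f"
    using mult_right_mono[of 1 "ennreal d" "Lnorm N p f"] assms(4) by simp
  finally show ?thesis .
next
  case (2 r)
  have "(\<integral>\<^sup>+ x. epowr (f (T x)) r \<partial>M) = (\<integral>\<^sup>+ y. epowr (f y) r \<partial>distr M N T)"
    by (subst nn_integral_distr) auto
  also have "\<dots> = ennreal c * (\<integral>\<^sup>+ y. epowr (f y) r \<partial>N)"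
    unfolding distr by (subst nn_integral_density) (auto simp: nn_integral_cmult)
  finally have "Lnorm M p (\<lambda>x. f (T x)) = ennreal (c powr (1 / r)) * Lnorm N p f"
    using 2 assms(2) by (simp add: Lnorm_ennreal epowr_mult epowr_ennreal)
  also have "c powr (1 / r) \<le> d"
  proof -
    have "c powr (1 / r) \<le> d powr (1 / r)" using assms 2 by (intro powr_mono2) auto
    also have "\<dots> \<le> d powr 1" using assms 2 by (intro powr_mono) auto
    finally show ?thesis using assms by simp
  qed
  finally show ?thesis by (simp add: mult_right_mono ennreal_leI)
qed

section \<open>From Lebesgue measurable functions to Borel functions\<close>

lemma measurable_completion_cong_AE:
  fixes f g :: "'a \<Rightarrow> 'b::topological_space"
  assumes [measurable]: "g \<in> borel_measurable M" and eq: "AE x in M. f x = g x"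
  shows "f \<in> borel_measurable (completion M)"
proof (rule measurableI)
  fix A :: "'b set" assume [measurable]: "A \<in> sets borel"
  have "g -` A \<inter> space M \<in> sets (completion M)"
    by (intro sets_completionI_sets) measurable
  then show "f -` A \<inter> space (completion M) \<in> sets (completion M)"
    by (rule completion.in_sets_AE[rotated])
      (use AE_completion[OF eq] in \<open>auto elim!: eventually_mono\<close>)
qed auto

lemma Lp_norm_eq_Lnorm:
  assumes "f \<in> borel_measurable lebesgue"
  shows "Lp_norm p f = Lnorm lborel p f"
  using assms by (auto simp: Lp_norm_def Lnorm_def esssup_eq_AE AE_completion_iff nn_integral_completion)

lemma Lp_norm_cong_AE_Borel:
  assumes [measurable]: "g \<in> borel_measurable lborel" and eq: "AE x in lborel. f x = g x"
  shows "Lp_norm p f = Lnorm lborel p g"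
  using Lp_norm_eq_Lnorm[OF measurable_completion_cong_AE[OF assms]] Lnorm_cong_AE[OF eq] by simp

text \<open>\<open>Lp_norm\<close> with exponent \<infinity> is sensitive to measurability, and
  slices of a Lebesgue measurable function are measurable only for almost every x. A Borel function
  equal to f almost everywhere has the same mixed norm, and all its slices are measurable.\<close>

lemma Lp_norm_iterated_cong:
  fixes f B :: "'a::euclidean_space \<times> 'b::euclidean_space \<Rightarrow> ennreal"
  assumes [measurable]: "B \<in> borel_measurable (lborel \<Otimes>\<^sub>M lborel)"
    and eq: "AE z in lborel. f z = B z"
  shows "Lp_norm p (\<lambda>x. Lp_norm q (\<lambda>y. f (x, y)))
    = Lnorm lborel p (\<lambda>x. Lnorm lborel q (\<lambda>y. B (x, y)))"
proof (rule Lp_norm_cong_AE_Borel)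
  have "AE x in lborel. AE y in lborel. f (x, y) = B (x, y)"
    by (intro lborel_pair.AE_pair) (unfold lborel_prod, rule eq)
  then show "AE x in lborel. Lp_norm q (\<lambda>y. f (x, y)) = Lnorm lborel q (\<lambda>y. B (x, y))"
    by eventually_elim (rule Lp_norm_cong_AE_Borel, measurable)
qed measurable

text \<open>A Borel version of f is raised to \<open>top\<close> on a Borel null set containing all
  exceptional points. Domination then holds at every point and survives any substitution of
  variables.\<close>

lemma Borel_majorant:
  fixes f :: "'a::euclidean_space \<Rightarrow> ennreal"
  assumes "f \<in> borel_measurable lebesgue"
  obtains B where "B \<in> borel_measurable borel" "\<And>x. f x \<le> B x" "AE x in lborel. f x = B x"
proof -
  obtain g where g[measurable]: "g \<in> borel_measurable lborel" and eq: "AE x in lborel. f x = g x"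
    using completion_ex_borel_measurable[OF assms] by blast
  obtain N where N: "N \<in> null_sets lborel" "{x. f x \<noteq> g x} \<subseteq> N"
    using eq by (auto simp: eventually_ae_filter)
  then have [measurable]: "N \<in> sets borel" by (auto simp: null_sets_def)
  show thesis
  proof (rule that[of "\<lambda>x. if x \<in> N then top else g x"])
    show "f x \<le> (if x \<in> N then top else g x)" for x using N(2) by (auto simp: subset_eq) (metis order_refl)
    show "AE x in lborel. f x = (if x \<in> N then top else g x)"
      using AE_not_in[OF N(1)] by eventually_elim (use N(2) in fastforce)
  qed measurable
qed

lemma Lp_norm_iterated_le:
  fixes f B :: "'a::euclidean_space \<times> 'b::euclidean_space \<Rightarrow> ennreal"
  assumes f: "f \<in> borel_measurable lebesgue"
    and [measurable]: "B \<in> borel_measurable (lborel \<Otimes>\<^sub>M lborel)"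
    and le: "\<And>z. f z \<le> B z"
  shows "Lp_norm p (\<lambda>x. Lp_norm q (\<lambda>y. f (x, y)))
    \<le> Lnorm lborel p (\<lambda>x. Lnorm lborel q (\<lambda>y. B (x, y)))"
proof -
  obtain g where [measurable]: "g \<in> borel_measurable borel" and eq: "AE z in lborel. f z = g z"
    using Borel_majorant[OF f] by metis
  have [measurable]: "g \<in> borel_measurable (lborel \<Otimes>\<^sub>M lborel)"
    by (simp add: lborel_prod)
  \<comment> \<open>The minimum of \<open>g\<close> and \<open>B\<close> is Borel, equals f almost
    everywhere and lies below \<open>B\<close>, which itself may be far larger than f.\<close>
  have "Lp_norm p (\<lambda>x. Lp_norm q (\<lambda>y. f (x, y)))
      = Lnorm lborel p (\<lambda>x. Lnorm lborel q (\<lambda>y. min (g (x, y)) (B (x, y))))"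
    using eq by (intro Lp_norm_iterated_cong[where B="\<lambda>z. min (g z) (B z)"])
      (auto elim!: eventually_mono simp: min_def, metis le)
  also have "\<dots> \<le> Lnorm lborel p (\<lambda>x. Lnorm lborel q (\<lambda>y. B (x, y)))"
    by (intro Lnorm_mono) simp
  finally show ?thesis .
qed

lemma Lp_norm_iterated_Borel_majorant:
  fixes f :: "'a::euclidean_space \<times> 'b::euclidean_space \<Rightarrow> ennreal"
  assumes f: "f \<in> borel_measurable lebesgue"
  obtains B where "B \<in> borel_measurable (lborel \<Otimes>\<^sub>M lborel)" "\<And>z. f z \<le> B z"
    "Lp_norm p (\<lambda>x. Lp_norm q (\<lambda>y. f (x, y)))
      = Lnorm lborel p (\<lambda>x. Lnorm lborel q (\<lambda>y. B (x, y)))"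
proof -
  obtain B where "B \<in> borel_measurable borel" and le: "\<And>z. f z \<le> B z" and eq: "AE z in lborel. f z = B z"
    using Borel_majorant[OF f] by metis
  then have "B \<in> borel_measurable (lborel \<Otimes>\<^sub>M lborel)" by (simp add: lborel_prod)
  from that[OF this le Lp_norm_iterated_cong[OF this eq]] show thesis .
qed

text \<open>Borel majorants of f and g with unchanged norms reduce this to Minkowski's inequality,
  in the inner and then in the outer variable.\<close>

lemma Lp_norm_iterated_triangle:
  fixes f g h :: "'a::euclidean_space \<times> 'b::euclidean_space \<Rightarrow> ennreal"
  assumes "1 \<le> p" "1 \<le> q"
    and "f \<in> borel_measurable lebesgue" "g \<in> borel_measurable lebesgue" "h \<in> borel_measurable lebesgue"
    and "\<And>z. h z \<le> f z + g z"
  shows "Lp_norm p (\<lambda>x. Lp_norm q (\<lambda>y. h (x, y)))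
    \<le> Lp_norm p (\<lambda>x. Lp_norm q (\<lambda>y. f (x, y))) + Lp_norm p (\<lambda>x. Lp_norm q (\<lambda>y. g (x, y)))"
proof -
  obtain F where [measurable]: "F \<in> borel_measurable (lborel \<Otimes>\<^sub>M lborel)" and F: "\<And>z. f z \<le> F z"
    "Lp_norm p (\<lambda>x. Lp_norm q (\<lambda>y. f (x, y))) = Lnorm lborel p (\<lambda>x. Lnorm lborel q (\<lambda>y. F (x, y)))"
    by (rule Lp_norm_iterated_Borel_majorant[OF assms(3), where p=p and q=q]) (rule that)
  obtain G where [measurable]: "G \<in> borel_measurable (lborel \<Otimes>\<^sub>M lborel)" and G: "\<And>z. g z \<le> G z"
    "Lp_norm p (\<lambda>x. Lp_norm q (\<lambda>y. g (x, y))) = Lnorm lborel p (\<lambda>x. Lnorm lborel q (\<lambda>y. G (x, y)))"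
    by (rule Lp_norm_iterated_Borel_majorant[OF assms(4), where p=p and q=q]) (rule that)
  have "h z \<le> F z + G z" for z
    using order_trans[OF assms(6) add_mono[OF F(1) G(1)]] .
  then have "Lp_norm p (\<lambda>x. Lp_norm q (\<lambda>y. h (x, y)))
      \<le> Lnorm lborel p (\<lambda>x. Lnorm lborel q (\<lambda>y. F (x, y) + G (x, y)))"
    using assms(5) by (intro Lp_norm_iterated_le[where B="\<lambda>z. F z + G z"]) auto
  also have "\<dots> \<le> Lnorm lborel p (\<lambda>x. Lnorm lborel q (\<lambda>y. F (x, y)) + Lnorm lborel q (\<lambda>y. G (x, y)))"
    using assms(2) by (intro Lnorm_mono lborel.Lnorm_triangle) measurable
  also have "\<dots> \<le> Lnorm lborel p (\<lambda>x. Lnorm lborel q (\<lambda>y. F (x, y)))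
      + Lnorm lborel p (\<lambda>x. Lnorm lborel q (\<lambda>y. G (x, y)))"
    using assms(1) by (intro lborel.Lnorm_triangle) measurable
  finally show ?thesis using F(2) G(2) by simp
qed

lemma Lp_norm_iterated_eq_0:
  fixes f :: "'a::euclidean_space \<times> 'b::euclidean_space \<Rightarrow> ennreal"
  assumes "1 \<le> p" "1 \<le> q" "f \<in> borel_measurable lebesgue"
    and 0: "Lp_norm p (\<lambda>x. Lp_norm q (\<lambda>y. f (x, y))) = 0"
  shows "AE z in lborel. f z = 0"
proof -
  obtain F where [measurable]: "F \<in> borel_measurable (lborel \<Otimes>\<^sub>M lborel)" and F: "\<And>z. f z \<le> F z"
    "Lp_norm p (\<lambda>x. Lp_norm q (\<lambda>y. f (x, y))) = Lnorm lborel p (\<lambda>x. Lnorm lborel q (\<lambda>y. F (x, y)))"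
    by (rule Lp_norm_iterated_Borel_majorant[OF assms(3), where p=p and q=q]) (rule that)
  have "AE x in lborel. Lnorm lborel q (\<lambda>y. F (x, y)) = 0"
    using 0 F(2) assms(1) by (intro Lnorm_eq_0_AE[of p]) auto
  then have "AE x in lborel. AE y in lborel. F (x, y) = 0"
    by eventually_elim (rule Lnorm_eq_0_AE[OF assms(2)], measurable)
  moreover have "{z \<in> space (lborel \<Otimes>\<^sub>M lborel). F z = 0} \<in> sets (lborel \<Otimes>\<^sub>M lborel)"
    by measurable
  ultimately have "AE z in lborel \<Otimes>\<^sub>M lborel. F z = 0"
    by (intro lborel_pair.AE_pair_measure)
  then show ?thesis unfolding lborel_prod
    by eventually_elim (metis F(1) le_zero_eq)
qed

section \<open>Lebesgue measure on \<open>\<complex>\<^sup>d\<close>\<close>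

lemma borel_measurable_vec_lambda [measurable (raw)]:
  fixes f :: "'x \<Rightarrow> 'n::finite \<Rightarrow> 'a::euclidean_space"
  assumes [measurable]: "\<And>i. (\<lambda>x. f x i) \<in> borel_measurable M"
  shows "(\<lambda>x. \<chi> i. f x i) \<in> borel_measurable M"
proof (rule borel_measurable_euclidean_space[THEN iffD2], rule ballI)
  fix b :: "'a^'n" assume "b \<in> Basis"
  then obtain i u where b: "b = axis i u" "u \<in> Basis"
    by (auto simp: Basis_vec_def)
  show "(\<lambda>x. (\<chi> i. f x i) \<bullet> b) \<in> borel_measurable M"
    by (simp add: b inner_axis)
qed

lemma borel_measurable_vec_nth [measurable (raw)]:
  fixes f :: "'x \<Rightarrow> 'a::euclidean_space^'n"
  assumes "f \<in> borel_measurable M"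
  shows "(\<lambda>x. f x $ i) \<in> borel_measurable M"
  by (rule measurable_compose[OF assms borel_measurable_continuous_onI]) (intro continuous_intros)

lemma prod_Basis_vec:
  fixes f :: "'a::euclidean_space^'n \<Rightarrow> 'c::comm_monoid_mult"
  shows "(\<Prod>b\<in>Basis. f b) = (\<Prod>i\<in>UNIV. \<Prod>u\<in>Basis. f (axis i u))"
proof -
  have "(\<Prod>b\<in>Basis. f b) = (\<Prod>b\<in>(\<lambda>(i, u). axis i u) ` (UNIV \<times> Basis). f b)"
    by (rule prod.cong) (auto simp: Basis_vec_def)
  also have "\<dots> = (\<Prod>(i, u)\<in>UNIV \<times> Basis. f (axis i u))"
    by (subst prod.reindex) (auto simp: inj_on_def axis_eq_axis split_beta')
  finally have "(\<Prod>b\<in>Basis. f b) = (\<Prod>(i, u)\<in>UNIV \<times> Basis. f (axis i u))" .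
  then show ?thesis by (simp add: prod.cartesian_product)
qed

text \<open>Both measures give every box the product of its side lengths. With the coordinates as
  independent factors, integrals of products of one-variable functions factor.\<close>

lemma lborel_vec_eq:
  "(lborel :: ('a::euclidean_space^'n) measure)
    = distr (\<Pi>\<^sub>M i\<in>UNIV. lborel) borel (\<lambda>f. \<chi> i. f i)"
proof (rule lborel_eqI)
  interpret product_sigma_finite "\<lambda>_::'n. lborel :: 'a measure" ..
  fix l u :: "'a^'n" assume le: "\<And>b. b \<in> Basis \<Longrightarrow> l \<bullet> b \<le> u \<bullet> b"
  have [measurable]: "(\<lambda>f. \<chi> i. f i) \<in> (\<Pi>\<^sub>M i\<in>UNIV. lborel) \<rightarrow>\<^sub>M (borel :: ('a^'n) measure)"
    by (rule borel_measurable_vec_lambda) measurable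
  have le': "l $ i \<bullet> b \<le> u $ i \<bullet> b" if "b \<in> Basis" for i b
    using le[of "axis i b"] that by (simp add: inner_axis axis_in_Basis_iff)
  have "emeasure (distr (\<Pi>\<^sub>M i\<in>UNIV. lborel) borel (\<lambda>f. \<chi> i. f i)) (box l u)
      = emeasure (\<Pi>\<^sub>M i\<in>UNIV. lborel) (Pi\<^sub>E UNIV (\<lambda>i. box (l $ i) (u $ i)))"
    by (subst emeasure_distr)
      (auto simp: space_PiM mem_box Basis_vec_def inner_axis PiE_def Pi_def
        intro!: arg_cong[where f="emeasure (\<Pi>\<^sub>M i\<in>UNIV. lborel)"])
  also have "\<dots> = (\<Prod>i\<in>UNIV. emeasure lborel (box (l $ i) (u $ i)))"
    by (subst emeasure_PiM) auto
  also have "\<dots> = (\<Prod>i\<in>UNIV. ennreal (\<Prod>b\<in>Basis. (u $ i - l $ i) \<bullet> b))"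
    by (simp add: emeasure_lborel_box le')
  also have "\<dots> = ennreal (\<Prod>i\<in>UNIV. \<Prod>b\<in>Basis. (u $ i - l $ i) \<bullet> b)"
    by (intro prod_ennreal prod_nonneg) (simp add: inner_diff_left le')
  also have "(\<Prod>i\<in>UNIV. \<Prod>b\<in>Basis. (u $ i - l $ i) \<bullet> b) = (\<Prod>b\<in>Basis. (u - l) \<bullet> b)"
    by (simp add: prod_Basis_vec inner_axis)
  finally show "emeasure (distr (\<Pi>\<^sub>M i\<in>UNIV. lborel) borel (\<lambda>f. \<chi> i. f i)) (box l u)
      = ennreal (\<Prod>b\<in>Basis. (u - l) \<bullet> b)" .
qed simp

lemma integral_lborel_vec_prod:
  fixes h :: "'n::finite \<Rightarrow> 'a::euclidean_space \<Rightarrow> complex"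
  assumes int: "\<And>i. integrable lborel (h i)"
  shows "(\<integral>z. (\<Prod>i\<in>UNIV. h i ((z :: 'a^'n) $ i)) \<partial>lborel) = (\<Prod>i\<in>UNIV. \<integral>t. h i t \<partial>lborel)"
proof -
  interpret product_sigma_finite "\<lambda>_::'n. lborel :: 'a measure" ..
  have [measurable]: "h i \<in> borel_measurable borel" for i
    using borel_measurable_integrable[OF int] by simp
  have [measurable]: "(\<lambda>f. \<chi> i. f i) \<in> (\<Pi>\<^sub>M i\<in>UNIV. lborel) \<rightarrow>\<^sub>M (borel :: ('a^'n) measure)"
    by (rule borel_measurable_vec_lambda) measurable
  show "(\<integral>z. (\<Prod>i\<in>UNIV. h i ((z :: 'a^'n) $ i)) \<partial>lborel) = (\<Prod>i\<in>UNIV. \<integral>t. h i t \<partial>lborel)"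
    unfolding lborel_vec_eq
    by (subst integral_distr) (auto simp: product_integral_prod int)
qed

lemma measurable_cvec [measurable (raw)]:
  fixes f g :: "'x \<Rightarrow> real^'d"
  assumes [measurable]: "f \<in> borel_measurable M" "g \<in> borel_measurable M"
  shows "(\<lambda>x. cvec (f x) (g x)) \<in> borel_measurable M"
  unfolding cvec_def Complex_eq by measurable

lemma lborel_cvec: "distr (lborel \<Otimes>\<^sub>M lborel) borel (\<lambda>(x, y). cvec x y) = (lborel :: (complex^'d) measure)"
proof (rule lborel_eqI[symmetric])
  fix l u :: "complex^'d" assume le: "\<And>b. b \<in> Basis \<Longrightarrow> l \<bullet> b \<le> u \<bullet> b"
  have le': "Re (l $ i) \<le> Re (u $ i)" "Im (l $ i) \<le> Im (u $ i)" for i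
    using le[of "axis i 1"] le[of "axis i \<i>"] by (simp_all add: inner_axis axis_in_Basis_iff Basis_complex_def)
  let ?re = "\<lambda>z :: complex^'d. \<chi> i. Re (z $ i)" and ?im = "\<lambda>z :: complex^'d. \<chi> i. Im (z $ i)"
  have "emeasure (distr (lborel \<Otimes>\<^sub>M lborel) borel (\<lambda>(x, y). cvec x y)) (box l u)
      = emeasure (lborel \<Otimes>\<^sub>M lborel) (box (?re l) (?re u) \<times> box (?im l) (?im u))"
    by (subst emeasure_distr)
      (auto simp: mem_box Basis_vec_def inner_axis cvec_def Basis_complex_def space_pair_measure
        intro!: arg_cong[where f="emeasure (lborel \<Otimes>\<^sub>M lborel)"])
  also have "\<dots> = emeasure lborel (box (?re l) (?re u)) * emeasure lborel (box (?im l) (?im u))"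
    by (rule lborel.emeasure_pair_measure_Times) auto
  also have "\<dots> = ennreal ((\<Prod>i\<in>UNIV. Re (u $ i) - Re (l $ i)) * (\<Prod>i\<in>UNIV. Im (u $ i) - Im (l $ i)))"
  proof -
    have "emeasure lborel (box (?re l) (?re u)) = ennreal (\<Prod>b\<in>Basis. (?re u - ?re l) \<bullet> b)"
      "emeasure lborel (box (?im l) (?im u)) = ennreal (\<Prod>b\<in>Basis. (?im u - ?im l) \<bullet> b)"
      using le' by (rule_tac [!] emeasure_lborel_box, auto simp: Basis_vec_def inner_axis)
    then show ?thesis
      using le' by (simp add: prod_Basis_vec inner_axis ennreal_mult' prod_nonneg)
  qed
  also have "(\<Prod>i\<in>UNIV. Re (u $ i) - Re (l $ i)) * (\<Prod>i\<in>UNIV. Im (u $ i) - Im (l $ i))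
      = (\<Prod>b\<in>Basis. (u - l) \<bullet> b)"
    by (simp add: prod_Basis_vec inner_axis Basis_complex_def prod.distrib)
  finally show "emeasure (distr (lborel \<Otimes>\<^sub>M lborel) borel (\<lambda>(x, y). cvec x y)) (box l u)
      = ennreal (\<Prod>b\<in>Basis. (u - l) \<bullet> b)" .
qed simp

section \<open>Invariance under translations, shears and rotations\<close>

lemma nn_integral_lborel_translate:
  fixes c :: "'a::euclidean_space"
  assumes [measurable]: "f \<in> borel_measurable borel"
  shows "(\<integral>\<^sup>+ x. f (x + c) \<partial>lborel) = (\<integral>\<^sup>+ x. f x \<partial>lborel)"
  by (subst (2) lborel_distr_plus[symmetric, of c]) (simp add: nn_integral_distr add.commute)

text \<open>For a fixed second coordinate the map translates the first one, so Tonelli reduces the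
  claim to translation invariance.\<close>

lemma distr_shear_fst:
  fixes h :: "'b::euclidean_space \<Rightarrow> 'a::euclidean_space"
  assumes [measurable]: "h \<in> borel_measurable borel"
  shows "distr (lborel \<Otimes>\<^sub>M lborel) (lborel \<Otimes>\<^sub>M lborel) (\<lambda>(x, y). (x + h y, y)) = lborel \<Otimes>\<^sub>M lborel"
proof (rule measure_eqI)
  fix A assume "A \<in> sets (distr (lborel \<Otimes>\<^sub>M lborel) (lborel \<Otimes>\<^sub>M lborel) (\<lambda>(x, y). (x + h y, y)))"
  then have [measurable]: "A \<in> sets (lborel \<Otimes>\<^sub>M lborel)" by simp
  then have [measurable]: "A \<in> sets (borel \<Otimes>\<^sub>M borel)"
    using sets_pair_measure_cong[OF sets_lborel sets_lborel] by metis
  have "emeasure (distr (lborel \<Otimes>\<^sub>M lborel) (lborel \<Otimes>\<^sub>M lborel) (\<lambda>(x, y). (x + h y, y))) A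
      = (\<integral>\<^sup>+ z. indicator A z \<partial>distr (lborel \<Otimes>\<^sub>M lborel) (lborel \<Otimes>\<^sub>M lborel) (\<lambda>(x, y). (x + h y, y)))"
    by simp
  also have "\<dots> = (\<integral>\<^sup>+ z. indicator A (fst z + h (snd z), snd z) \<partial>(lborel \<Otimes>\<^sub>M lborel))"
    by (subst nn_integral_distr) (auto simp: split_beta')
  also have "\<dots> = (\<integral>\<^sup>+ y. \<integral>\<^sup>+ x. indicator A (x + h y, y) \<partial>lborel \<partial>lborel)"
    by (subst lborel_pair.nn_integral_snd[symmetric]) auto
  also have "\<dots> = (\<integral>\<^sup>+ y. \<integral>\<^sup>+ x. indicator A (x, y) \<partial>lborel \<partial>lborel)"
    by (intro nn_integral_cong nn_integral_lborel_translate) measurable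
  also have "\<dots> = emeasure (lborel \<Otimes>\<^sub>M lborel) A"
    by (subst lborel_pair.nn_integral_snd) auto
  finally show "emeasure (distr (lborel \<Otimes>\<^sub>M lborel) (lborel \<Otimes>\<^sub>M lborel) (\<lambda>(x, y). (x + h y, y))) A
      = emeasure (lborel \<Otimes>\<^sub>M lborel) A" .
qed simp

lemma distr_shear_snd:
  fixes h :: "'a::euclidean_space \<Rightarrow> 'b::euclidean_space"
  assumes [measurable]: "h \<in> borel_measurable borel"
  shows "distr (lborel \<Otimes>\<^sub>M lborel) (lborel \<Otimes>\<^sub>M lborel) (\<lambda>(x, y). (x, y + h x)) = lborel \<Otimes>\<^sub>M lborel"
proof (rule measure_eqI)
  fix A assume "A \<in> sets (distr (lborel \<Otimes>\<^sub>M lborel) (lborel \<Otimes>\<^sub>M lborel) (\<lambda>(x, y). (x, y + h x)))"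
  then have [measurable]: "A \<in> sets (lborel \<Otimes>\<^sub>M lborel)" by simp
  then have [measurable]: "A \<in> sets (borel \<Otimes>\<^sub>M borel)"
    using sets_pair_measure_cong[OF sets_lborel sets_lborel] by metis
  have "emeasure (distr (lborel \<Otimes>\<^sub>M lborel) (lborel \<Otimes>\<^sub>M lborel) (\<lambda>(x, y). (x, y + h x))) A
      = (\<integral>\<^sup>+ z. indicator A z \<partial>distr (lborel \<Otimes>\<^sub>M lborel) (lborel \<Otimes>\<^sub>M lborel) (\<lambda>(x, y). (x, y + h x)))"
    by simp
  also have "\<dots> = (\<integral>\<^sup>+ z. indicator A (fst z, snd z + h (fst z)) \<partial>(lborel \<Otimes>\<^sub>M lborel))"
    by (subst nn_integral_distr) (auto simp: split_beta')
  also have "\<dots> = (\<integral>\<^sup>+ x. \<integral>\<^sup>+ y. indicator A (x, y + h x) \<partial>lborel \<partial>lborel)"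
    by (subst lborel.nn_integral_fst[symmetric]) auto
  also have "\<dots> = (\<integral>\<^sup>+ x. \<integral>\<^sup>+ y. indicator A (x, y) \<partial>lborel \<partial>lborel)"
    by (intro nn_integral_cong nn_integral_lborel_translate) measurable
  also have "\<dots> = emeasure (lborel \<Otimes>\<^sub>M lborel) A"
    by (subst lborel.nn_integral_fst) auto
  finally show "emeasure (distr (lborel \<Otimes>\<^sub>M lborel) (lborel \<Otimes>\<^sub>M lborel) (\<lambda>(x, y). (x, y + h x))) A
      = emeasure (lborel \<Otimes>\<^sub>M lborel) A" .
qed simp

lemma lborel_Complex: "distr (lborel \<Otimes>\<^sub>M lborel) borel (\<lambda>(x, y). Complex x y) = lborel"
proof (rule lborel_eqI[symmetric])
  have [measurable]: "(\<lambda>(x, y). Complex x y) \<in> borel_measurable (lborel \<Otimes>\<^sub>M lborel)"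
    unfolding Complex_eq by measurable
  fix l u :: complex assume le: "\<And>b. b \<in> Basis \<Longrightarrow> l \<bullet> b \<le> u \<bullet> b"
  have le': "Re l \<le> Re u" "Im l \<le> Im u"
    using le[of 1] le[of \<i>] by (simp_all add: Basis_complex_def)
  have "emeasure (distr (lborel \<Otimes>\<^sub>M lborel) borel (\<lambda>(x, y). Complex x y)) (box l u)
      = emeasure (lborel \<Otimes>\<^sub>M lborel) ({Re l<..<Re u} \<times> {Im l<..<Im u})"
    by (subst emeasure_distr)
      (auto simp: mem_box Basis_complex_def space_pair_measure
        intro!: arg_cong[where f="emeasure (lborel \<Otimes>\<^sub>M lborel)"])
  also have "\<dots> = emeasure lborel {Re l<..<Re u} * emeasure lborel {Im l<..<Im u}"
    by (rule lborel.emeasure_pair_measure_Times) auto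
  also have "\<dots> = ennreal (\<Prod>b\<in>Basis. (u - l) \<bullet> b)"
    using le' by (simp add: Basis_complex_def ennreal_mult')
  finally show "emeasure (distr (lborel \<Otimes>\<^sub>M lborel) borel (\<lambda>(x, y). Complex x y)) (box l u)
      = ennreal (\<Prod>b\<in>Basis. (u - l) \<bullet> b)" .
qed simp

text \<open>A rotation is a product of three shears.\<close>

lemma lborel_rotate:
  fixes c :: complex
  assumes "norm c = 1" "c \<noteq> -1"
  shows "distr lborel borel (\<lambda>z. c * z) = lborel"
proof -
  define a where "a = Re c"
  define b where "b = Im c"
  \<comment> \<open>For c = exp(i \<theta>) this is tan(\<theta> / 2), undefined exactly at c = -1.
    The three shears have the parameters -t, sin \<theta> and -t.\<close>
  define t where "t = b / (1 + a)"
  have ab: "a\<^sup>2 + b\<^sup>2 = 1" using assms(1) by (simp add: a_def b_def cmod_def)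
  have "a \<noteq> -1"
  proof
    assume "a = -1"
    with ab have "b = 0" by simp
    with \<open>a = -1\<close> assms(2) show False by (simp add: a_def b_def complex_eq_iff)
  qed
  then have a1: "1 + a \<noteq> 0" by linarith
  have t1: "t * (1 + a) = b" using a1 by (simp add: t_def)
  have "b * t * (1 + a) = (1 - a) * (1 + a)"
    using ab t1 by (simp add: algebra_simps power2_eq_square)
  then have t2: "b * t = 1 - a" using a1 by simp
  let ?M = "lborel \<Otimes>\<^sub>M lborel :: (real \<times> real) measure"
  let ?S = "\<lambda>(x, y). (x + - t * y, y)" and ?S' = "\<lambda>(x, y). (x, y + b * x)"
  have M1: "distr ?M ?M ?S = ?M" by (rule distr_shear_fst) measurable
  have M2: "distr ?M ?M ?S' = ?M" by (rule distr_shear_snd) measurable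
  have M3: "distr ?M ?M (?S \<circ> ?S' \<circ> ?S) = ?M"
  proof -
    have "distr ?M ?M (?S \<circ> ?S' \<circ> ?S) = distr (distr (distr ?M ?M ?S) ?M ?S') ?M ?S"
      by (subst distr_distr, simp, simp, subst distr_distr) (simp_all add: o_assoc)
    then show ?thesis by (simp only: M1 M2)
  qed
  have [measurable]: "(\<lambda>(x, y). Complex x y) \<in> borel_measurable ?M"
    unfolding Complex_eq by measurable
  have "distr lborel borel (\<lambda>z. c * z) = distr ?M borel ((\<lambda>z. c * z) \<circ> (\<lambda>(x, y). Complex x y))"
    by (subst lborel_Complex[symmetric], subst distr_distr) auto
  also have "(\<lambda>z. c * z) \<circ> (\<lambda>(x, y). Complex x y) = (\<lambda>(x, y). Complex x y) \<circ> (?S \<circ> ?S' \<circ> ?S)"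
  proof
    fix z :: "real \<times> real"
    obtain x y where z: "z = (x, y)" by fastforce
    have i: "y + b * (x - t * y) = b * x + a * y"
    proof -
      have "y + b * (x - t * y) = b * x + (1 - b * t) * y" by (simp add: algebra_simps)
      then show ?thesis by (simp add: t2)
    qed
    have "(x - t * y) - t * (b * x + a * y) = (1 - b * t) * x - t * (1 + a) * y"
      by (simp add: algebra_simps)
    then have ii: "(x - t * y) - t * (b * x + a * y) = a * x - b * y"
      by (simp add: t1 t2)
    show "((\<lambda>z. c * z) \<circ> (\<lambda>(x, y). Complex x y)) z = ((\<lambda>(x, y). Complex x y) \<circ> (?S \<circ> ?S' \<circ> ?S)) z"
      using i ii by (simp add: z complex_eq_iff a_def[symmetric] b_def[symmetric])
  qed
  also have "distr ?M borel ((\<lambda>(x, y). Complex x y) \<circ> (?S \<circ> ?S' \<circ> ?S))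
      = distr (distr ?M ?M (?S \<circ> ?S' \<circ> ?S)) borel (\<lambda>(x, y). Complex x y)"
    by (subst distr_distr) (auto intro!: measurable_comp)
  also have "\<dots> = lborel" by (simp only: M3 lborel_Complex)
  finally show ?thesis .
qed

text \<open>Rotation by the angle pi / (2 (m - n)) preserves Lebesgue measure and \<kappa> and
  multiplies the monomial by i, so the integral equals i times itself.\<close>

lemma integral_rotation_invariant_eq_0:
  fixes \<kappa> :: "complex \<Rightarrow> real"
  assumes \<kappa>: "\<And>c t. norm c = 1 \<Longrightarrow> \<kappa> (c * t) = \<kappa> t"
    and [measurable]: "\<kappa> \<in> borel_measurable borel" and "m \<noteq> n"
  shows "(\<integral>t. t ^ m * cnj t ^ n * \<kappa> t \<partial>lborel) = 0"
proof -
  define k :: real where "k = real m - real n"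
  define c where "c = cis (pi / (2 * k))"
  have k: "k \<noteq> 0" "\<bar>k\<bar> \<ge> 1" using \<open>m \<noteq> n\<close> by (auto simp: k_def)
  have nc: "norm c = 1" by (simp add: c_def)
  \<comment> \<open>The angle has modulus at most pi / 2 because m and n differ by at least 1, so
    the real part of c is nonnegative.\<close>
  have "c \<noteq> -1"
  proof
    assume "c = -1"
    moreover have "Re c \<ge> 0"
    proof -
      have "\<bar>pi / (2 * k)\<bar> \<le> pi / 2" using k by (simp add: abs_mult field_simps)
      then have "0 \<le> cos (pi / (2 * k))" by (intro cos_ge_zero) linarith+
      then show ?thesis by (simp add: c_def)
    qed
    ultimately show False by simp
  qed
  have cc: "c ^ m * cnj c ^ n = \<i>"
  proof -
    have "c ^ m * cnj c ^ n = cis (real m * (pi / (2 * k)) + real n * (- (pi / (2 * k))))"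
      by (simp only: c_def cis_cnj Complex.DeMoivre cis_mult)
    also have "real m * (pi / (2 * k)) + real n * (- (pi / (2 * k))) = k * (pi / (2 * k))"
      unfolding k_def by (simp only: left_diff_distrib mult_minus_right flip: diff_conv_add_uminus)
    also have "\<dots> = pi / 2" using k by simp
    finally show ?thesis by simp
  qed
  let ?f = "\<lambda>t. t ^ m * cnj t ^ n * of_real (\<kappa> t)"
  have "(\<integral>t. ?f t \<partial>lborel) = (\<integral>t. ?f t \<partial>distr lborel borel (\<lambda>z. c * z))"
    by (simp add: lborel_rotate nc \<open>c \<noteq> -1\<close>)
  also have "\<dots> = (\<integral>t. ?f (c * t) \<partial>lborel)"
  proof (rule integral_distr)
    have [measurable]: "cnj \<in> borel_measurable borel"
      by (intro borel_measurable_continuous_onI continuous_intros)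
    show "?f \<in> borel_measurable borel" by measurable
  qed measurable
  also have "\<dots> = (\<integral>t. (c ^ m * cnj c ^ n) * ?f t \<partial>lborel)"
    by (intro Bochner_Integration.integral_cong) (simp_all add: power_mult_distrib \<kappa> nc)
  also have "\<dots> = \<i> * (\<integral>t. ?f t \<partial>lborel)"
    by (simp add: cc)
  finally have "(1 - \<i>) * (\<integral>t. ?f t \<partial>lborel) = 0" by (simp add: algebra_simps)
  moreover have "1 - \<i> \<noteq> 0" by (simp add: complex_eq_iff)
  ultimately show ?thesis by simp
qed

section \<open>Gaussian moments in the plane\<close>

text \<open>The disc of radius sqrt a has area pi a, linear in a, so the square of the norm has
  constant density pi on the half-line. This takes the place of polar coordinates and turns Gaussian
  moments into Gamma integrals.\<close>

lemma distr_norm_square_complex: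
  "distr (lborel :: complex measure) borel (\<lambda>w. (norm w)\<^sup>2)
    = density lborel (\<lambda>t. ennreal pi * indicator {0..} t)"
proof -
  have l: "emeasure (distr (lborel :: complex measure) borel (\<lambda>w. (norm w)\<^sup>2)) {..a}
      = ennreal (pi * max 0 a)" for a
  proof (cases "0 \<le> a")
    case True
    have "(\<lambda>w::complex. (norm w)\<^sup>2) -` {..a} = cball 0 (sqrt a)"
      using True by (auto simp: real_le_rsqrt sqrt_le_D) (metis norm_ge_zero real_sqrt_le_mono real_sqrt_pow2 real_sqrt_unique sqrt_le_D)
    then show ?thesis
      using True by (subst emeasure_distr) (auto simp: emeasure_cball unit_ball_vol_2)
  next
    case False
    then have "(\<lambda>w::complex. (norm w)\<^sup>2) -` {..a} = {}"
      by (auto simp: not_le) (meson less_le_trans not_less zero_le_power2)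
    then show ?thesis using False by (subst emeasure_distr) auto
  qed
  show ?thesis
  proof (rule measure_eqI_generator_eq[where E="range (\<lambda>a::real. {..a})" and A="\<lambda>n::nat. {..real n}" and \<Omega>=UNIV])
    fix X assume "X \<in> range (\<lambda>a::real. {..a})"
    then obtain a where X: "X = {..a}" by auto
    have "emeasure (density lborel (\<lambda>t. ennreal pi * indicator {0..} t)) {..a}
        = (\<integral>\<^sup>+ t. ennreal pi * indicator {0..a} t \<partial>lborel)"
      by (subst emeasure_density) (auto intro!: nn_integral_cong simp: indicator_def)
    also have "\<dots> = ennreal (pi * max 0 a)"
      by (subst nn_integral_cmult_indicator) (auto simp: max_def ennreal_mult')
    finally show "emeasure (distr (lborel :: complex measure) borel (\<lambda>w. (norm w)\<^sup>2)) X
        = emeasure (density lborel (\<lambda>t. ennreal pi * indicator {0..} t)) X"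
      by (simp add: X l)
  next
    show "emeasure (distr (lborel :: complex measure) borel (\<lambda>w. (norm w)\<^sup>2)) {..real n} \<noteq> \<infinity>" for n
      by (simp add: l)
  next
    show "Int_stable (range (\<lambda>a::real. {..a}))" by (auto simp: Int_stable_def)
    show "(\<Union>n. {..real n}) = UNIV" using real_arch_simple by auto
  qed (auto simp: borel_eq_atMost)
qed

lemma nn_integral_gaussian_moment:
  "(\<integral>\<^sup>+ w. ennreal ((norm (w::complex))\<^sup>2 ^ n * exp (- (norm w)\<^sup>2)) \<partial>lborel) = ennreal (pi * fact n)"
proof -
  have "(\<integral>\<^sup>+ w. ennreal ((norm (w::complex))\<^sup>2 ^ n * exp (- (norm w)\<^sup>2)) \<partial>lborel)
      = (\<integral>\<^sup>+ t. ennreal (t ^ n * exp (- t)) \<partial>distr (lborel :: complex measure) borel (\<lambda>w. (norm w)\<^sup>2))"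
    by (subst nn_integral_distr) auto
  also have "\<dots> = (\<integral>\<^sup>+ t. ennreal pi * (ennreal (t ^ n * exp (- t)) * indicator {0..} t) \<partial>lborel)"
    unfolding distr_norm_square_complex
    by (subst nn_integral_density) (auto simp: mult_ac)
  also have "\<dots> = ennreal pi * (\<integral>\<^sup>+ t. ennreal (t ^ n * exp (- t)) * indicator {0..} t \<partial>lborel)"
    by (rule nn_integral_cmult) measurable
  also have "\<dots> = ennreal (pi * fact n)"
    by (simp add: nn_intergal_power_times_exp_Ici ennreal_mult')
  finally show ?thesis .
qed

section \<open>Power series of entire functions of several variables\<close>

definition vupd :: "complex^'d \<Rightarrow> 'd \<Rightarrow> complex \<Rightarrow> complex^'d" where
  "vupd z i t = (\<chi> j. if j = i then t else z $ j)"

lemma vupd_nth [simp]: "vupd z i t $ j = (if j = i then t else z $ j)"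
  by (simp add: vupd_def)

lemma vupd_vupd [simp]: "vupd (vupd z i s) i t = vupd z i t"
  by (simp add: vec_eq_iff)

lemma vupd_same [simp]: "vupd z i (z $ i) = z"
  by (simp add: vec_eq_iff)

lemma vupd_commute: "i \<noteq> j \<Longrightarrow> vupd (vupd z i s) j t = vupd (vupd z j t) i s"
  by (simp add: vec_eq_iff)

lemma vupd_eq_axis: "vupd z i t = vupd z i 0 + axis i t"
  by (simp add: vec_eq_iff axis_def)

lemma continuous_on_vupd [continuous_intros]:
  assumes "continuous_on S f" "continuous_on S g"
  shows "continuous_on S (\<lambda>x. vupd (f x) i (g x))"
  unfolding vupd_def
proof (rule continuous_on_vec_lambda)
  fix j show "continuous_on S (\<lambda>x. if j = i then g x else f x $ j)"
    by (cases "j = i") (auto intro!: continuous_intros assms)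
qed

text \<open>Joint continuity with holomorphy in each variable is the property that Cauchy's formula
  in one variable passes on to the Taylor coefficients in that variable, so an induction over the
  variables can use it.\<close>

definition sep_hol :: "(complex^'d \<Rightarrow> complex) \<Rightarrow> bool" where
  "sep_hol F \<longleftrightarrow> continuous_on UNIV F \<and> (\<forall>z i. (\<lambda>t. F (vupd z i t)) holomorphic_on UNIV)"

lemma sep_hol_continuous: "sep_hol F \<Longrightarrow> continuous_on S F"
  by (auto simp: sep_hol_def intro: continuous_on_subset)

lemma sep_hol_holomorphic: "sep_hol F \<Longrightarrow> (\<lambda>t. F (vupd z i t)) holomorphic_on S"
  by (auto simp: sep_hol_def intro: holomorphic_on_subset)

lemma bounded_linear_axis: "bounded_linear (axis i :: complex \<Rightarrow> complex^'d)"
  by (intro linear_conv_bounded_linear[THEN iffD1] linearI) (auto simp: vec_eq_iff axis_def)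

lemma has_field_derivative_vupd:
  assumes "(F has_derivative F') (at (vupd z i t))" "\<And>c v. F' (c *s v) = c * F' v"
  shows "((\<lambda>t. F (vupd z i t)) has_field_derivative F' (axis i 1)) (at t)"
proof -
  have "((\<lambda>t. vupd z i 0 + axis i t) has_derivative axis i) (at t)"
    by (auto intro!: derivative_eq_intros bounded_linear_imp_has_derivative bounded_linear_axis)
  then have "((\<lambda>t. vupd z i t) has_derivative axis i) (at t)"
    by (subst vupd_eq_axis)
  from diff_chain_at[OF this assms(1)]
  have "((\<lambda>t. F (vupd z i t)) has_derivative (F' \<circ> axis i)) (at t)"
    by (simp add: o_def)
  moreover have "F' \<circ> axis i = (*) (F' (axis i 1))"
  proof
    fix t :: complex
    have "axis i t = t *s axis i 1" by (auto simp: vec_eq_iff axis_def)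
    then show "(F' \<circ> axis i) t = F' (axis i 1) * t" by (simp add: assms(2))
  qed
  ultimately show ?thesis by (simp add: has_field_derivative_def)
qed

lemma entire_wrt_imp_sep_hol:
  assumes "entire_wrt (*s) F"
  shows "sep_hol F"
  unfolding sep_hol_def
proof (intro conjI allI)
  show "continuous_on UNIV F"
    using assms unfolding entire_wrt_def
    by (auto intro!: continuous_at_imp_continuous_on dest: has_derivative_continuous)
  show "(\<lambda>t. F (vupd z i t)) holomorphic_on UNIV" for z i
    unfolding holomorphic_on_def field_differentiable_def
  proof (intro ballI)
    fix t
    obtain F' where "(F has_derivative F') (at (vupd z i t))" "\<And>c v. F' (c *s v) = c * F' v"
      using assms unfolding entire_wrt_def by blast
    from has_field_derivative_vupd[OF this]
    show "\<exists>d. ((\<lambda>t. F (vupd z i t)) has_field_derivative d) (at t within UNIV)" by blast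
  qed
qed

text \<open>Cauchy's formula on the unit circle around c, with the factor 2 pi i cancelled. The
  derivative becomes an integral over [0, 1] of values of f, so its dependence on parameters is
  governed by theorems on parameter integrals.\<close>

lemma higher_deriv_eq_circle_integral:
  fixes n :: nat
  assumes "f holomorphic_on UNIV"
  defines "e \<equiv> \<lambda>s::real. exp (2 * of_real pi * \<i> * of_real s)"
  shows "(deriv ^^ n) f c = fact n * integral {0..1} (\<lambda>s. f (c + e s) / e s ^ Suc n * e s)"
proof -
  have "((\<lambda>u. f u / (u - c) ^ Suc n) has_contour_integral (2 * pi * \<i>) / fact n * (deriv ^^ n) f c)
      (circlepath c 1)"
    by (intro Cauchy_has_contour_integral_higher_derivative_circlepath
        holomorphic_on_imp_continuous_on holomorphic_on_subset[OF assms(1)]) auto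
  from contour_integral_unique[OF this]
  have "integral {0..1} (\<lambda>s. f (c + e s) / e s ^ Suc n * (2 * of_real pi * \<i> * e s))
      = (2 * pi * \<i>) / fact n * (deriv ^^ n) f c"
    by (simp only: contour_integral_integral vector_derivative_circlepath)
      (simp add: circlepath e_def)
  also have "(\<lambda>s. f (c + e s) / e s ^ Suc n * (2 * of_real pi * \<i> * e s))
      = (\<lambda>s. (2 * of_real pi * \<i>) * (f (c + e s) / e s ^ Suc n * e s))"
    by (simp add: e_def mult_ac)
  also have "integral {0..1} \<dots> = (2 * of_real pi * \<i>) * integral {0..1} (\<lambda>s. f (c + e s) / e s ^ Suc n * e s)"
    by (rule integral_mult_right)
  finally show ?thesis by (simp add: field_simps)
qed

lemma continuous_on_circle_deriv:
  fixes \<phi> :: "'x::topological_space \<Rightarrow> complex \<Rightarrow> complex"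
  assumes cont: "continuous_on (S \<times> UNIV) (\<lambda>(x, t). \<phi> x t)"
    and hol: "\<And>x. x \<in> S \<Longrightarrow> \<phi> x holomorphic_on UNIV"
    and c: "continuous_on S c"
  shows "continuous_on S (\<lambda>x. (deriv ^^ n) (\<phi> x) (c x))"
proof -
  define e where "e s = exp (2 * of_real pi * \<i> * of_real s)" for s :: real
  have e: "continuous_on A e" "e s \<noteq> 0" for A s
    unfolding e_def by (auto intro!: continuous_intros)
  define J where "J x s = \<phi> x (c x + e s) / e s ^ Suc n * e s" for x s
  have "(deriv ^^ n) (\<phi> x) (c x) = fact n * integral (cbox 0 1) (J x)" if "x \<in> S" for x
    using higher_deriv_eq_circle_integral[OF hol[OF that]] by (simp add: J_def[abs_def] e_def)
  moreover have "continuous_on S (\<lambda>x. integral (cbox 0 1) (J x))"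
  proof (rule integral_continuous_on_param)
    have "continuous_on (S \<times> cbox 0 1) (\<lambda>x. (\<lambda>(x, t). \<phi> x t) (fst x, c (fst x) + e (snd x)))"
      by (rule continuous_on_compose2[OF cont])
        (auto intro!: continuous_intros continuous_on_compose2[OF c] continuous_on_compose2[OF e(1)])
    then show "continuous_on (S \<times> cbox 0 1) (\<lambda>(x, s). J x s)"
      unfolding J_def split_beta' using e(2)
      by (auto simp: split_beta' intro!: continuous_intros continuous_on_compose2[OF e(1)])
  qed
  ultimately show ?thesis
    by (simp add: continuous_on_mult_left cong: continuous_on_cong)
qed

text \<open>Leibniz' rule asks for a t-derivative that is jointly continuous in t and s; Cauchy's
  formula for the first derivative supplies it.\<close>

lemma holomorphic_on_param_integral:
  fixes \<phi> :: "complex \<Rightarrow> real \<Rightarrow> complex"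
  assumes cont: "continuous_on (UNIV \<times> {0..1}) (\<lambda>(t, s). \<phi> t s)"
    and hol: "\<And>s. s \<in> {0..1} \<Longrightarrow> (\<lambda>t. \<phi> t s) holomorphic_on UNIV"
  shows "(\<lambda>t. integral {0..1} (\<phi> t)) holomorphic_on UNIV"
  unfolding cbox_interval[symmetric]
proof (rule leibniz_rule_holomorphic)
  show "((\<lambda>t. \<phi> t s) has_field_derivative deriv (\<lambda>t. \<phi> t s) t) (at t within UNIV)"
    if "s \<in> cbox 0 1" for t s
    using holomorphic_derivI[OF hol] that by auto
  show "\<phi> t integrable_on cbox 0 1" for t
  proof (rule integrable_continuous)
    have "continuous_on (cbox 0 1) (\<lambda>s. (\<lambda>(t, s). \<phi> t s) (t, s))"
      by (rule continuous_on_compose2[OF cont]) (auto intro!: continuous_intros)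
    then show "continuous_on (cbox 0 1) (\<phi> t)" by simp
  qed
  have "continuous_on (UNIV \<times> {0..1}) (\<lambda>x. (deriv ^^ 1) (\<lambda>t. \<phi> t (snd x)) (fst x))"
  proof (rule continuous_on_circle_deriv)
    have "continuous_on ((UNIV \<times> {0..1}) \<times> UNIV)
        (\<lambda>y :: (complex \<times> real) \<times> complex. (\<lambda>(t, s). \<phi> t s) (snd y, snd (fst y)))"
      by (rule continuous_on_compose2[OF cont]) (auto intro!: continuous_intros)
    then show "continuous_on ((UNIV \<times> {0..1}) \<times> UNIV)
        (\<lambda>(x :: complex \<times> real, t). \<phi> t (snd x))"
      by (simp add: split_beta')
  qed (auto intro!: hol continuous_intros)
  then show "continuous_on (UNIV \<times> cbox 0 1) (\<lambda>(t, s). deriv (\<lambda>t. \<phi> t s) t)"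
    by (simp add: split_beta')
qed auto

text \<open>Kept as a function on all of C^d that does not depend on coordinate i, so that the
  induction over the variables stays within one type.\<close>

definition taylor_coeff :: "(complex^'d \<Rightarrow> complex) \<Rightarrow> 'd \<Rightarrow> nat \<Rightarrow> complex^'d \<Rightarrow> complex" where
  "taylor_coeff F i n z = (deriv ^^ n) (\<lambda>t. F (vupd z i t)) 0 / fact n"

lemma sep_hol_taylor_coeff:
  assumes F: "sep_hol F"
  shows "sep_hol (taylor_coeff F i n)"
proof -
  define e where "e s = exp (2 * of_real pi * \<i> * of_real s)" for s :: real
  have e: "continuous_on A e" "e s \<noteq> 0" for A s
    unfolding e_def by (auto intro!: continuous_intros)
  define J where "J z s = F (vupd z i (e s)) / e s ^ Suc n * e s" for z s
  have eq: "taylor_coeff F i n z = integral {0..1} (J z)" for z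
    using higher_deriv_eq_circle_integral[OF sep_hol_holomorphic[OF F], of n z i 0]
    by (simp add: taylor_coeff_def J_def[abs_def] e_def)
  have contJ: "continuous_on (UNIV \<times> {0..1}) (\<lambda>(z, s). J z s)"
    unfolding J_def split_beta' using e(2)
    by (auto intro!: continuous_intros continuous_on_compose2[OF e(1)]
        continuous_on_compose2[OF sep_hol_continuous[OF F, of UNIV]])
  show ?thesis unfolding sep_hol_def
  proof (intro conjI allI)
    show "continuous_on UNIV (taylor_coeff F i n)"
      using integral_continuous_on_param[of UNIV 0 1 J] contJ by (simp add: eq[abs_def])
    fix z j
    show "(\<lambda>t. taylor_coeff F i n (vupd z j t)) holomorphic_on UNIV"
    proof (cases "j = i")
      case True
      then show ?thesis by (simp add: taylor_coeff_def)
    next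
      case False
      have "(\<lambda>t. integral {0..1} (J (vupd z j t))) holomorphic_on UNIV"
      proof (rule holomorphic_on_param_integral)
        have "continuous_on (UNIV \<times> {0..1}) (\<lambda>x. (\<lambda>(z, s). J z s) (vupd z j (fst x), snd x))"
          by (rule continuous_on_compose2[OF contJ]) (auto intro!: continuous_intros)
        then show "continuous_on (UNIV \<times> {0..1}) (\<lambda>(t, s). J (vupd z j t) s)"
          by (simp add: split_beta')
        show "(\<lambda>t. J (vupd z j t) s) holomorphic_on UNIV" for s
          unfolding J_def using False e(2)
          by (simp add: vupd_commute[of j i]) (intro holomorphic_intros sep_hol_holomorphic[OF F], auto)
      qed
      then show ?thesis by (simp add: eq)
    qed
  qed
qed

section \<open>Multiple power series\<close>

text \<open>A finite set of multi-indices lies in a box, over which the sum factors into geometric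
  sums, each at most 2.\<close>

lemma summable_on_prod_half_power:
  "(\<lambda>\<alpha> :: 'd::finite \<Rightarrow> nat. \<Prod>i\<in>UNIV. (1 / 2 :: real) ^ \<alpha> i) summable_on UNIV"
proof (rule nonneg_bdd_above_summable_on)
  show "bdd_above (sum (\<lambda>\<alpha> :: 'd \<Rightarrow> nat. \<Prod>i\<in>UNIV. (1 / 2 :: real) ^ \<alpha> i) ` {F. F \<subseteq> UNIV \<and> finite F})"
  proof (rule bdd_aboveI2)
    fix X :: "('d \<Rightarrow> nat) set" assume "X \<in> {F. F \<subseteq> UNIV \<and> finite F}"
    then have "finite X" by simp
    define N where "N = Suc (Max (\<Union>\<alpha>\<in>X. range \<alpha>))"
    have "\<alpha> i < N" if "\<alpha> \<in> X" for \<alpha> i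
      using that \<open>finite X\<close> unfolding N_def by (intro le_imp_less_Suc Max_ge) auto
    then have X: "X \<subseteq> Pi\<^sub>E (UNIV :: 'd set) (\<lambda>_. {..<N})" by auto
    have "(\<Sum>\<alpha>\<in>X. \<Prod>i\<in>UNIV. (1 / 2 :: real) ^ \<alpha> i)
        \<le> (\<Sum>\<alpha>\<in>Pi\<^sub>E (UNIV :: 'd set) (\<lambda>_. {..<N}). \<Prod>i\<in>UNIV. (1 / 2) ^ \<alpha> i)"
      by (intro sum_mono2 X finite_PiE prod_nonneg) auto
    also have "\<dots> = (\<Prod>i\<in>(UNIV :: 'd set). \<Sum>n<N. (1 / 2) ^ n)"
      by (rule prod_sum_PiE[symmetric]) auto
    also have "\<dots> \<le> (\<Prod>i\<in>(UNIV :: 'd set). 2)"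
      by (intro prod_mono conjI sum_nonneg) (auto simp: sum_gp_strict)
    finally show "(\<Sum>\<alpha>\<in>X. \<Prod>i\<in>UNIV. (1 / 2 :: real) ^ \<alpha> i) \<le> (\<Prod>i\<in>(UNIV :: 'd set). 2)" .
  qed
qed (auto intro: prod_nonneg)

lemma bounded_on_polydisc:
  fixes F :: "complex^'d \<Rightarrow> complex"
  assumes "continuous_on UNIV F"
  shows "\<exists>M\<ge>0. \<forall>z. (\<forall>i. norm (z $ i) \<le> R) \<longrightarrow> norm (F z) \<le> M"
proof -
  let ?r = "R * real CARD('d)"
  have "compact (F ` cball 0 ?r)"
    by (intro compact_continuous_image continuous_on_subset[OF assms]) auto
  then have "bounded (F ` cball 0 ?r)" by (rule compact_imp_bounded)
  then obtain M where M: "\<forall>x\<in>F ` cball 0 ?r. norm x \<le> M" using bounded_iff by blast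
  have "norm (F z) \<le> max 0 M" if "\<forall>i. norm (z $ i) \<le> R" for z
  proof -
    have "norm z \<le> (\<Sum>i\<in>UNIV. norm (z $ i))" unfolding norm_vec_def by (rule L2_set_le_sum) auto
    also have "\<dots> \<le> (\<Sum>i\<in>(UNIV :: 'd set). R)" by (intro sum_mono) (use that in auto)
    finally have "norm z \<le> ?r" by (simp add: mult.commute)
    then show ?thesis using M by (auto simp: le_max_iff_disj)
  qed
  then show ?thesis by (intro exI[of _ "max 0 M"]) auto
qed

text \<open>Induction on the set S of variables allowed to be nonzero: F is expanded in one new
  variable, and each Taylor coefficient, again of class \<open>sep_hol\<close>, in the variables of
  S. The Cauchy estimate is carried along because it gives the absolute summability needed to merge
  the two iterated sums.\<close>

lemma sep_hol_expansion_aux: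
  fixes F :: "complex^'d \<Rightarrow> complex"
  assumes "finite S" "sep_hol F"
  shows "\<exists>c. (\<forall>R>0. \<forall>M. (\<forall>z. (\<forall>i. norm (z $ i) \<le> R) \<longrightarrow> norm (F z) \<le> M)
        \<longrightarrow> (\<forall>\<alpha>. norm (c \<alpha>) * R ^ (\<Sum>i\<in>S. \<alpha> i) \<le> M))
     \<and> (\<forall>z. (\<forall>i. i \<notin> S \<longrightarrow> z $ i = 0) \<longrightarrow>
        ((\<lambda>\<alpha>. c \<alpha> * (\<Prod>i\<in>S. (z $ i) ^ \<alpha> i)) has_sum F z) {\<alpha>. \<forall>i. i \<notin> S \<longrightarrow> \<alpha> i = 0})"
  using assms
proof (induction S arbitrary: F rule: finite_induct)
  case empty
  have "((\<lambda>\<alpha> :: 'd \<Rightarrow> nat. F 0) has_sum F z) {\<lambda>_. 0}" if "\<forall>i. z $ i = 0" for z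
  proof -
    have "z = 0" using that by (simp add: vec_eq_iff)
    then show ?thesis using has_sum_finite[of "{\<lambda>_. 0}" "\<lambda>_. F 0"] by simp
  qed
  moreover have "{\<alpha> :: 'd \<Rightarrow> nat. \<forall>i. \<alpha> i = 0} = {\<lambda>_. 0}" by auto
  moreover have "norm (F 0) \<le> M"
    if "0 < R" "\<forall>z. (\<forall>i. norm (z $ i) \<le> R) \<longrightarrow> norm (F z) \<le> M" for R M
    using that(2)[rule_format, of 0] that(1) by simp
  ultimately show ?case
    by (intro exI[of _ "\<lambda>_. F 0"]) simp
next
  case (insert i S)
  define A where "A = {\<alpha> :: 'd \<Rightarrow> nat. \<forall>i. i \<notin> S \<longrightarrow> \<alpha> i = 0}"
  define A' where "A' = {\<alpha> :: 'd \<Rightarrow> nat. \<forall>j. j \<notin> insert i S \<longrightarrow> \<alpha> j = 0}"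
  define P where "P n c \<longleftrightarrow>
      (\<forall>R>0. \<forall>M. (\<forall>z. (\<forall>i. norm (z $ i) \<le> R) \<longrightarrow> norm (taylor_coeff F i n z) \<le> M)
        \<longrightarrow> (\<forall>\<alpha>. norm (c \<alpha>) * R ^ (\<Sum>i\<in>S. \<alpha> i) \<le> M))
     \<and> (\<forall>z. (\<forall>i. i \<notin> S \<longrightarrow> z $ i = 0) \<longrightarrow>
        ((\<lambda>\<alpha>. c \<alpha> * (\<Prod>i\<in>S. (z $ i) ^ \<alpha> i)) has_sum taylor_coeff F i n z) A)"
    for n and c :: "('d \<Rightarrow> nat) \<Rightarrow> complex"
  have "\<forall>n. \<exists>c. P n c"
    unfolding A_def P_def using insert.IH[OF sep_hol_taylor_coeff[OF insert.prems]] by blast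
  then obtain c where c: "\<And>n. P n (c n)" by metis
  have bd: "norm (c n \<alpha>) * R ^ (\<Sum>i\<in>S. \<alpha> i) \<le> M"
    if "0 < R" "\<And>z. (\<forall>i. norm (z $ i) \<le> R) \<Longrightarrow> norm (taylor_coeff F i n z) \<le> M" for n R M \<alpha>
    using c[of n] that unfolding P_def by blast
  have sm: "((\<lambda>\<alpha>. c n \<alpha> * (\<Prod>i\<in>S. (z $ i) ^ \<alpha> i)) has_sum taylor_coeff F i n z) A"
    if "\<And>i. i \<notin> S \<Longrightarrow> z $ i = 0" for n z
    using c[of n] that unfolding P_def by blast
  define c' where "c' \<alpha> = c (\<alpha> i) (\<alpha>(i := 0))" for \<alpha>
  have bound: "norm (c' \<alpha>) * R ^ (\<Sum>j\<in>insert i S. \<alpha> j) \<le> M"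
    if R: "0 < R" and M: "\<And>z. (\<forall>i. norm (z $ i) \<le> R) \<Longrightarrow> norm (F z) \<le> M" for R M \<alpha>
  proof -
    have "norm (taylor_coeff F i (\<alpha> i) z) \<le> M / R ^ \<alpha> i" if "\<forall>i. norm (z $ i) \<le> R" for z
    proof -
      have "norm ((deriv ^^ \<alpha> i) (\<lambda>t. F (vupd z i t)) 0) \<le> fact (\<alpha> i) * M / R ^ \<alpha> i"
        by (intro Cauchy_inequality holomorphic_on_imp_continuous_on
            sep_hol_holomorphic[OF insert.prems] R M) (use that in auto)
      then show ?thesis by (simp add: taylor_coeff_def norm_divide field_simps)
    qed
    from bd[OF R this, of "\<alpha>(i := 0)"]
    have "norm (c' \<alpha>) * R ^ (\<Sum>j\<in>S. (\<alpha>(i := 0)) j) \<le> M / R ^ \<alpha> i"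
      by (simp add: c'_def)
    also have "(\<Sum>j\<in>S. (\<alpha>(i := 0)) j) = (\<Sum>j\<in>S. \<alpha> j)"
      using insert.hyps by (intro sum.cong) auto
    finally show ?thesis
      using R insert.hyps by (simp add: field_simps power_add)
  qed
  have hs: "((\<lambda>\<alpha>. c' \<alpha> * (\<Prod>j\<in>insert i S. (z $ j) ^ \<alpha> j)) has_sum F z) A'"
    if z: "\<And>j. j \<notin> insert i S \<Longrightarrow> z $ j = 0" for z
  proof -
    \<comment> \<open>R is at least twice the modulus of every coordinate of z, so the Cauchy
      estimate bounds the term of index \<alpha> by M times 2 to the power -|\<alpha>|.\<close>
    define R where "R = 2 * (1 + norm z)"
    have R: "0 < R" by (simp add: R_def add_pos_nonneg)
    have zR: "2 * norm (z $ j) \<le> R" for j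
      using Finite_Cartesian_Product.norm_nth_le[of z j] by (simp add: R_def)
    obtain M where M: "\<forall>z. (\<forall>i. norm (z $ i) \<le> R) \<longrightarrow> norm (F z) \<le> M" "0 \<le> M"
      using bounded_on_polydisc[OF sep_hol_continuous[OF insert.prems]] by blast
    have "norm (c' \<alpha> * (\<Prod>j\<in>insert i S. (z $ j) ^ \<alpha> j)) \<le> norm (M * (\<Prod>j\<in>UNIV. (1 / 2) ^ \<alpha> j))"
      if "\<alpha> \<in> A'" for \<alpha>
    proof -
      have "norm (c' \<alpha> * (\<Prod>j\<in>insert i S. (z $ j) ^ \<alpha> j))
          = norm (c' \<alpha>) * (\<Prod>j\<in>insert i S. norm (z $ j) ^ \<alpha> j)"
        by (simp add: norm_mult norm_power flip: prod_norm)
      also have "\<dots> \<le> norm (c' \<alpha>) * (\<Prod>j\<in>insert i S. (R / 2) ^ \<alpha> j)"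
        by (intro mult_left_mono prod_mono conjI power_mono) (use zR in \<open>auto simp: field_simps\<close>)
      also have "\<dots> = norm (c' \<alpha>) * R ^ (\<Sum>j\<in>insert i S. \<alpha> j) * (\<Prod>j\<in>insert i S. (1 / 2) ^ \<alpha> j)"
        by (simp add: power_sum power_divide prod_dividef)
      also have "\<dots> \<le> M * (\<Prod>j\<in>insert i S. (1 / 2) ^ \<alpha> j)"
        using bound[OF R] M by (intro mult_right_mono prod_nonneg) auto
      also have "(\<Prod>j\<in>insert i S. (1 / 2 :: real) ^ \<alpha> j) = (\<Prod>j\<in>UNIV. (1 / 2) ^ \<alpha> j)"
        using that by (intro prod.mono_neutral_left) (auto simp: A'_def)
      finally show ?thesis using M(2) by (simp add: prod_nonneg)
    qed
    moreover have "(\<lambda>\<alpha>. norm (M * (\<Prod>j\<in>UNIV. (1 / 2) ^ \<alpha> j))) summable_on A'"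
    proof (rule summable_on_subset_banach[OF _ subset_UNIV])
      have "(\<lambda>\<alpha>. M * (\<Prod>j\<in>(UNIV :: 'd set). (1 / 2 :: real) ^ \<alpha> j)) summable_on UNIV"
        by (intro summable_on_cmult_right summable_on_prod_half_power)
      moreover have "norm (M * (\<Prod>j\<in>UNIV. (1 / 2) ^ \<alpha> j)) = M * (\<Prod>j\<in>UNIV. (1 / 2) ^ \<alpha> j)"
        for \<alpha> :: "'d \<Rightarrow> nat"
        using M(2) by (simp add: prod_nonneg)
      ultimately show "(\<lambda>\<alpha> :: 'd \<Rightarrow> nat. norm (M * (\<Prod>j\<in>UNIV. (1 / 2) ^ \<alpha> j))) summable_on UNIV"
        by simp
    qed
    ultimately have "(\<lambda>\<alpha>. norm (c' \<alpha> * (\<Prod>j\<in>insert i S. (z $ j) ^ \<alpha> j))) summable_on A'"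
      by (rule_tac Infinite_Sum.abs_summable_on_comparison_test)
    then have summ: "(\<lambda>\<alpha>. c' \<alpha> * (\<Prod>j\<in>insert i S. (z $ j) ^ \<alpha> j)) summable_on A'"
      by (rule abs_summable_summable)
    have bij: "bij_betw (\<lambda>(n, \<alpha>). \<alpha>(i := n)) (UNIV \<times> A) A'"
      by (rule bij_betw_byWitness[where f'="\<lambda>\<alpha>. (\<alpha> i, \<alpha>(i := 0))"])
        (use insert.hyps in \<open>auto simp: A_def A'_def fun_upd_idem_iff\<close>)
    define g where "g \<alpha> = c' \<alpha> * (\<Prod>j\<in>insert i S. (z $ j) ^ \<alpha> j)" for \<alpha>
    define f where "f = (\<lambda>(n, \<alpha>). c n \<alpha> * (\<Prod>j\<in>S. (z $ j) ^ \<alpha> j) * (z $ i) ^ n)"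
    have f_eq: "f x = g ((\<lambda>(n, \<alpha>). \<alpha>(i := n)) x)"
      if xA: "x \<in> UNIV \<times> A" for x
    proof -
      obtain n \<alpha> where x: "x = (n, \<alpha>)" and "\<alpha> \<in> A" using xA by auto
      have "\<alpha>(i := 0) = \<alpha>" using \<open>\<alpha> \<in> A\<close> insert.hyps by (auto simp: A_def)
      moreover have "(\<Prod>j\<in>S. (z $ j) ^ (\<alpha>(i := n)) j) = (\<Prod>j\<in>S. (z $ j) ^ \<alpha> j)"
        using insert.hyps by (intro prod.cong) auto
      ultimately show ?thesis using insert.hyps by (simp add: x f_def g_def c'_def mult_ac)
    qed
    have summf: "f summable_on (UNIV \<times> A)"
      using summ summable_on_reindex_bij_betw[OF bij, of g]
        summable_on_cong[of "UNIV \<times> A" f "\<lambda>x. g ((\<lambda>(n, \<alpha>). \<alpha>(i := n)) x)", OF f_eq]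
      unfolding g_def[symmetric] by simp
    \<comment> \<open>The expansion from the induction hypothesis holds at points vanishing off S.
      Setting coordinate i to 0 achieves this and leaves the Taylor coefficients in that coordinate
      unchanged.\<close>
    define z0 where "z0 = vupd z i 0"
    have t0: "taylor_coeff F i n z0 = taylor_coeff F i n z" for n
      by (simp add: taylor_coeff_def z0_def)
    have "((\<lambda>\<alpha>. f (n, \<alpha>)) has_sum taylor_coeff F i n z * (z $ i) ^ n) A" for n
    proof -
      have "((\<lambda>\<alpha>. c n \<alpha> * (\<Prod>j\<in>S. (z0 $ j) ^ \<alpha> j) * (z $ i) ^ n) has_sum
          taylor_coeff F i n z0 * (z $ i) ^ n) A"
        by (intro has_sum_cmult_left sm) (use z in \<open>auto simp: z0_def\<close>)
      moreover have "(\<Prod>j\<in>S. (z0 $ j) ^ \<alpha> j) = (\<Prod>j\<in>S. (z $ j) ^ \<alpha> j)" for \<alpha>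
        using insert.hyps by (intro prod.cong) (auto simp: z0_def)
      ultimately show ?thesis by (simp add: f_def t0)
    qed
    moreover have "((\<lambda>n. taylor_coeff F i n z * (z $ i) ^ n) has_sum F z) UNIV"
    proof (rule norm_summable_imp_has_sum)
      have ps: "(\<lambda>n. taylor_coeff F i n z * t ^ n) sums F (vupd z i t)" for t
        using holomorphic_power_series[OF sep_hol_holomorphic[OF insert.prems, where z=z and i=i], of t 0 "norm t + 1"]
        by (simp add: taylor_coeff_def)
      then show "(\<lambda>n. taylor_coeff F i n z * (z $ i) ^ n) sums F z"
        by (metis vupd_same)
      \<comment> \<open>Convergence at the larger radius given by the norm of z $ i plus 1 yields
        absolute convergence at z $ i.\<close>
      show "summable (\<lambda>n. norm (taylor_coeff F i n z * (z $ i) ^ n))"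
        by (rule powser_insidea[OF sums_summable[OF ps[of "of_real (norm (z $ i) + 1)"]]])
          (simp del: of_real_add)
    qed
    ultimately have "(f has_sum F z) (UNIV \<times> A)"
      using summf by (intro has_sum_SigmaI)
    then show ?thesis
      using has_sum_reindex_bij_betw[OF bij, of g "F z"]
        has_sum_cong[of "UNIV \<times> A" f "\<lambda>x. g ((\<lambda>(n, \<alpha>). \<alpha>(i := n)) x)", OF f_eq]
      unfolding g_def[symmetric] by simp
  qed
  show ?case
    by (intro exI[of _ c'] conjI allI impI) (use bound hs in \<open>auto simp: A'_def\<close>)
qed

lemma sep_hol_expansion:
  fixes F :: "complex^'d \<Rightarrow> complex"
  assumes "sep_hol F"
  shows "\<exists>c. \<forall>z. ((\<lambda>\<alpha>. c \<alpha> * (\<Prod>i\<in>UNIV. (z $ i) ^ \<alpha> i)) has_sum F z) UNIV"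
  using sep_hol_expansion_aux[OF finite assms, of UNIV] by auto

section \<open>Monomials on polydiscs\<close>

definition mpow :: "('d::finite \<Rightarrow> nat) \<Rightarrow> complex^'d \<Rightarrow> complex" where
  "mpow \<alpha> z = (\<Prod>i\<in>UNIV. (z $ i) ^ \<alpha> i)"

definition polydisc :: "real \<Rightarrow> (complex^'d) set" where
  "polydisc R = {z. \<forall>i. norm (z $ i) < R}"

lemma norm_mpow: "norm (mpow \<alpha> z) = (\<Prod>i\<in>UNIV. norm (z $ i) ^ \<alpha> i)"
  by (simp add: mpow_def norm_power flip: prod_norm)

lemma measurable_mpow [measurable]: "mpow \<alpha> \<in> borel_measurable borel"
  unfolding mpow_def[abs_def] by measurable

lemma polydisc_sets [measurable]: "polydisc R \<in> sets borel"
  unfolding polydisc_def by measurable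

lemma bounded_polydisc: "bounded (polydisc R :: (complex^'d) set)"
proof (rule boundedI)
  fix z :: "complex^'d" assume "z \<in> polydisc R"
  then have "(\<Sum>i\<in>UNIV. norm (z $ i)) \<le> (\<Sum>i\<in>(UNIV :: 'd set). R)"
    by (intro sum_mono) (auto simp: polydisc_def less_imp_le)
  moreover have "norm z \<le> (\<Sum>i\<in>UNIV. norm (z $ i))"
    unfolding norm_vec_def by (rule L2_set_le_sum) auto
  ultimately show "norm z \<le> (\<Sum>i\<in>(UNIV :: 'd set). R)" by linarith
qed

lemma emeasure_polydisc_finite: "emeasure lborel (polydisc R :: (complex^'d) set) < \<infinity>"
  by (rule emeasure_bounded_finite[OF bounded_polydisc])

lemma integrable_polydisc:
  fixes f :: "complex^'d \<Rightarrow> complex"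
  assumes [measurable]: "f \<in> borel_measurable borel" and B: "\<And>z. norm (f z) \<le> B * indicator (polydisc R) z"
  shows "integrable lborel f"
    and "(\<integral>z. norm (f z) \<partial>lborel) \<le> B * measure lborel (polydisc R :: (complex^'d) set)"
proof -
  have i: "integrable lborel (\<lambda>z :: complex^'d. B * indicator (polydisc R) z)"
    using emeasure_polydisc_finite by (intro integrable_mult_right integrable_real_indicator) auto
  show int: "integrable lborel f"
    by (rule Bochner_Integration.integrable_bound[OF i]) (use B in \<open>auto intro: order_trans abs_ge_self\<close>)
  have "(\<integral>z. norm (f z) \<partial>lborel) \<le> (\<integral>z. B * indicator (polydisc R :: (complex^'d) set) z \<partial>lborel)"
    by (intro integral_mono integrable_norm int i B)
  also have "\<dots> = B * measure lborel (polydisc R :: (complex^'d) set)" by simp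
  finally show "(\<integral>z. norm (f z) \<partial>lborel) \<le> B * measure lborel (polydisc R :: (complex^'d) set)" .
qed

lemma multi_index_enum: "\<exists>e. bij_betw e (UNIV :: nat set) (UNIV :: ('d::finite \<Rightarrow> nat) set)"
proof -
  have "inj (\<lambda>n (i::'d). n :: nat)" by (auto simp: inj_def fun_eq_iff)
  then have "infinite (UNIV :: ('d \<Rightarrow> nat) set)"
    using finite_subset[OF subset_UNIV] range_inj_infinite by blast
  then show ?thesis using bij_betw_from_nat_into[of "UNIV :: ('d \<Rightarrow> nat) set"] by blast
qed

text \<open>On the polydisc every monomial is bounded by its value at the corner (R, ..., R), where
  the series converges absolutely. This is the summable majorant for integration term by
  term.\<close>

lemma has_sum_integral_polydisc:
  fixes G H :: "complex^'d \<Rightarrow> complex"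
  assumes G: "\<And>z. ((\<lambda>\<alpha>. c \<alpha> * mpow \<alpha> z) has_sum G z) UNIV" and R: "0 \<le> R"
    and [measurable]: "H \<in> borel_measurable borel" and B: "\<And>z. norm (H z) \<le> B * indicator (polydisc R) z"
  shows "((\<lambda>\<alpha>. c \<alpha> * (\<integral>z. mpow \<alpha> z * H z \<partial>lborel)) has_sum (\<integral>z. G z * H z \<partial>lborel)) UNIV"
proof -
  obtain e :: "nat \<Rightarrow> 'd \<Rightarrow> nat" where e: "bij_betw e UNIV UNIV" using multi_index_enum by blast
  have B0: "0 \<le> B * indicator (polydisc R) z" for z :: "complex^'d"
    using B[of z] norm_ge_zero order_trans by blast
  define a where "a n z = c (e n) * (mpow (e n) z * H z)" for n z
  define r where "r = (\<chi> i. complex_of_real R :: complex^'d)"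
  define b where "b n = norm (c (e n) * mpow (e n) r) * B" for n
  have "(\<lambda>\<alpha>. norm (c \<alpha> * mpow \<alpha> r)) summable_on UNIV"
    using has_sum_imp_summable[OF G[of r]] unfolding summable_on_iff_abs_summable_on_complex .
  then have "(\<lambda>n. norm (c (e n) * mpow (e n) r)) summable_on UNIV"
    using summable_on_reindex_bij_betw[OF e, of "\<lambda>\<alpha>. norm (c \<alpha> * mpow \<alpha> r)"] by simp
  then have bsum: "summable b"
    unfolding b_def by (intro summable_mult2 summable_on_imp_summable)
  have ab: "norm (a n z) \<le> b n * indicator (polydisc R) z" for n z
  proof (cases "z \<in> polydisc R")
    case True
    have "norm (mpow (e n) z) \<le> norm (mpow (e n) r)"
      unfolding norm_mpow using True R
      by (intro prod_mono conjI power_mono) (auto simp: r_def polydisc_def less_imp_le)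
    then have "norm (c (e n)) * (norm (mpow (e n) z) * norm (H z))
        \<le> norm (c (e n)) * (norm (mpow (e n) r) * B)"
      using B[of z] True by (intro mult_left_mono mult_mono) auto
    then show ?thesis using True by (simp add: a_def b_def norm_mult mult_ac)
  next
    case False
    then show ?thesis using B[of z] by (simp add: a_def)
  qed
  have [measurable]: "a n \<in> borel_measurable borel" for n
    unfolding a_def by measurable
  note I = integrable_polydisc[of "a n" "b n" R for n, OF _ ab]
  let ?V = "measure lborel (polydisc R :: (complex^'d) set)"
  have sumI: "summable (\<lambda>n. \<integral>z. norm (a n z) \<partial>lborel)"
    using I(2) by (intro summable_comparison_test'[OF summable_mult2[OF bsum, of ?V], of 0])
      (auto simp: integral_nonneg)
  have "(\<lambda>n. a n z) sums (G z * H z)" for z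
  proof -
    have "((\<lambda>n. c (e n) * mpow (e n) z) has_sum G z) UNIV"
      using has_sum_reindex_bij_betw[OF e, of "\<lambda>\<alpha>. c \<alpha> * mpow \<alpha> z"] G by simp
    from sums_mult2[OF has_sum_imp_sums[OF this], of "H z"]
    show ?thesis by (simp add: a_def mult_ac)
  qed
  then have suminf: "(\<Sum>n. a n z) = G z * H z" for z by (simp add: sums_iff)
  have summ: "summable (\<lambda>n. norm (a n z))" for z
    by (rule summable_comparison_test'[OF summable_mult2[OF bsum, of "indicator (polydisc R) z"], of 0])
      (use ab in auto)
  have "(\<lambda>n. \<integral>z. a n z \<partial>lborel) sums (\<integral>z. (\<Sum>n. a n z) \<partial>lborel)"
    by (rule sums_integral) (use I(1) summ sumI in auto)
  moreover have "summable (\<lambda>n. norm (\<integral>z. a n z \<partial>lborel))"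
    by (rule summable_comparison_test'[OF sumI, of 0]) auto
  ultimately have "((\<lambda>n. \<integral>z. a n z \<partial>lborel) has_sum (\<integral>z. G z * H z \<partial>lborel)) UNIV"
    unfolding suminf by (intro norm_summable_imp_has_sum)
  moreover have "(\<integral>z. a n z \<partial>lborel) = c (e n) * (\<integral>z. mpow (e n) z * H z \<partial>lborel)" for n
    by (simp add: a_def)
  ultimately show ?thesis
    using has_sum_reindex_bij_betw[OF e, of "\<lambda>\<alpha>. c \<alpha> * (\<integral>z. mpow \<alpha> z * H z \<partial>lborel)"] by simp
qed

section \<open>Orthogonality of monomials under radial cutoffs\<close>

text \<open>Two instances occur: the indicator of a disc, which gives the mean value property, and
  the Gaussian cut off to a disc, which approximates \<mu>. Bounded support makes integration of a
  power series term by term legitimate, whatever the growth of the function.\<close>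

locale radial_cutoff =
  fixes \<kappa> :: "complex \<Rightarrow> real" and R :: real
  assumes rot: "\<And>c t. norm c = 1 \<Longrightarrow> \<kappa> (c * t) = \<kappa> t"
    and meas [measurable]: "\<kappa> \<in> borel_measurable borel"
    and nonneg: "\<And>t. 0 \<le> \<kappa> t" and le_1: "\<And>t. \<kappa> t \<le> 1"
    and support: "\<And>t. R \<le> norm t \<Longrightarrow> \<kappa> t = 0"
    and R_nonneg: "0 \<le> R"
begin

definition weight_prod :: "complex^'d \<Rightarrow> complex" where
  "weight_prod z = (\<Prod>i\<in>UNIV. of_real (\<kappa> (z $ i)))"

definition moment :: "nat \<Rightarrow> real" where
  "moment n = (\<integral>t. norm t ^ (2 * n) * \<kappa> t \<partial>lborel)"

lemma measurable_weight_prod [measurable]: "weight_prod \<in> borel_measurable borel"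
  unfolding weight_prod_def[abs_def] by measurable

lemma norm_weight_prod: "norm (weight_prod z) \<le> indicator (polydisc R) z"
proof (cases "z \<in> polydisc R")
  case True
  have "(\<Prod>i\<in>UNIV. \<kappa> (z $ i)) \<le> (\<Prod>i\<in>(UNIV :: 'a set). 1)"
    by (intro prod_mono conjI nonneg le_1)
  then show ?thesis using True by (simp add: weight_prod_def nonneg flip: prod_norm)
next
  case False
  then obtain i where "R \<le> norm (z $ i)" by (auto simp: polydisc_def not_less)
  then have "weight_prod z = 0" by (auto simp: weight_prod_def intro!: exI[of _ i] support)
  then show ?thesis by simp
qed

lemma norm_weight_prod_mult:
  fixes F :: "complex^'d \<Rightarrow> complex"
  assumes "continuous_on UNIV F"
  shows "\<exists>B. \<forall>z. norm (F z * weight_prod z) \<le> B * indicator (polydisc R) z"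
proof -
  obtain M where M: "\<forall>z. (\<forall>i. norm (z $ i) \<le> R) \<longrightarrow> norm (F z) \<le> M"
    using bounded_on_polydisc[OF assms] by blast
  have "norm (F z * weight_prod z) \<le> M * indicator (polydisc R) z" for z
  proof (cases "z \<in> polydisc R")
    case True
    then have "norm (F z) \<le> M" using M by (auto simp: polydisc_def less_imp_le)
    moreover have "0 \<le> M" using \<open>norm (F z) \<le> M\<close> norm_ge_zero order_trans by blast
    ultimately have "norm (F z) * norm (weight_prod z) \<le> M * 1"
      using norm_weight_prod[of z] True by (intro mult_mono) auto
    then show ?thesis using True by (simp add: norm_mult)
  next
    case False
    then show ?thesis using norm_weight_prod[of z] by simp
  qed
  then show ?thesis by blast
qed

lemma integrable_radial: "integrable lborel (\<lambda>t. t ^ m * cnj t ^ n * of_real (\<kappa> t))"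
proof -
  have [measurable]: "cnj \<in> borel_measurable borel"
    by (intro borel_measurable_continuous_onI continuous_intros)
  have "integrable lborel (\<lambda>t. R ^ (m + n) * indicator (ball 0 R :: complex set) t)"
    using emeasure_bounded_finite[of "ball 0 R :: complex set"]
    by (intro integrable_mult_right integrable_real_indicator) auto
  then show ?thesis
  proof (rule Bochner_Integration.integrable_bound)
    show "AE t in lborel. norm (t ^ m * cnj t ^ n * of_real (\<kappa> t)) \<le> norm (R ^ (m + n) * indicator (ball 0 R) t)"
    proof (rule AE_I2)
      fix t :: complex
      show "norm (t ^ m * cnj t ^ n * of_real (\<kappa> t)) \<le> norm (R ^ (m + n) * indicator (ball 0 R) t)"
      proof (cases "norm t < R")
        case True
        then have "norm t ^ (m + n) * \<kappa> t \<le> R ^ (m + n) * 1"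
          using R_nonneg by (intro mult_mono power_mono nonneg le_1) auto
        then show ?thesis using True R_nonneg nonneg[of t] by (simp add: norm_mult norm_power power_add)
      qed (simp add: support)
    qed
  qed measurable
qed

text \<open>The integral factors over the coordinates, and a coordinate with two different exponents
  contributes 0 by rotation invariance.\<close>

lemma integral_mpow_mpow:
  "(\<integral>z. mpow \<alpha> z * (cnj (mpow \<beta> z) * weight_prod z) \<partial>lborel)
    = (if \<alpha> = \<beta> then of_real (\<Prod>i\<in>UNIV. moment (\<beta> i)) else 0)"
proof -
  have "(\<integral>z. mpow \<alpha> z * (cnj (mpow \<beta> z) * weight_prod z) \<partial>lborel)
      = (\<integral>z. (\<Prod>i\<in>UNIV. (z $ i) ^ \<alpha> i * cnj (z $ i) ^ \<beta> i * of_real (\<kappa> (z $ i))) \<partial>lborel)"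
    by (simp add: mpow_def weight_prod_def prod.distrib mult.assoc)
  also have "\<dots> = (\<Prod>i\<in>UNIV. \<integral>t. t ^ \<alpha> i * cnj t ^ \<beta> i * of_real (\<kappa> t) \<partial>lborel)"
    by (rule integral_lborel_vec_prod) (rule integrable_radial)
  also have "\<dots> = (if \<alpha> = \<beta> then of_real (\<Prod>i\<in>UNIV. moment (\<beta> i)) else 0)"
  proof (cases "\<alpha> = \<beta>")
    case True
    have "(\<integral>t. t ^ n * cnj t ^ n * of_real (\<kappa> t) \<partial>lborel) = of_real (moment n)" for n
    proof -
      have "t ^ n * cnj t ^ n * of_real (\<kappa> t) = of_real (norm t ^ (2 * n) * \<kappa> t)" for t
        by (simp add: power_mult_distrib[symmetric] complex_norm_square[symmetric] power_mult)
      then show ?thesis by (simp add: moment_def del: of_real_mult of_real_power)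
    qed
    then show ?thesis using True by simp
  next
    case False
    then obtain i where "\<alpha> i \<noteq> \<beta> i" by auto
    then have "(\<integral>t. t ^ \<alpha> i * cnj t ^ \<beta> i * of_real (\<kappa> t) \<partial>lborel) = 0"
      by (intro integral_rotation_invariant_eq_0 rot) measurable
    then show ?thesis using False by (auto intro!: prod_zero)
  qed
  finally show ?thesis .
qed

text \<open>Orthogonality keeps only the term \<beta>. The formula serves the uniqueness of
  coefficients, the mean value property (\<beta> = 0) and the pairing of F with a monomial.\<close>

lemma integral_expansion_mpow:
  fixes G :: "complex^'d \<Rightarrow> complex"
  assumes "\<And>z. ((\<lambda>\<alpha>. c \<alpha> * mpow \<alpha> z) has_sum G z) UNIV"
  shows "(\<integral>z. G z * (cnj (mpow \<beta> z) * weight_prod z) \<partial>lborel) = c \<beta> * of_real (\<Prod>i\<in>UNIV. moment (\<beta> i))"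
proof -
  have [measurable]: "cnj \<in> borel_measurable borel"
    by (intro borel_measurable_continuous_onI continuous_intros)
  have "continuous_on UNIV (\<lambda>z :: complex^'d. cnj (mpow \<beta> z))"
    unfolding mpow_def by (intro continuous_intros)
  then obtain B where B: "\<And>z. norm (cnj (mpow \<beta> z) * weight_prod z) \<le> B * indicator (polydisc R) z"
    using norm_weight_prod_mult by blast
  have "((\<lambda>\<alpha>. c \<alpha> * (\<integral>z. mpow \<alpha> z * (cnj (mpow \<beta> z) * weight_prod z) \<partial>lborel)) has_sum
      (\<integral>z. G z * (cnj (mpow \<beta> z) * weight_prod z) \<partial>lborel)) UNIV"
    by (rule has_sum_integral_polydisc[OF assms R_nonneg _ B]) measurable
  moreover have "((\<lambda>\<alpha>. c \<alpha> * (\<integral>z. mpow \<alpha> z * (cnj (mpow \<beta> z) * weight_prod z) \<partial>lborel)) has_sum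
      c \<beta> * of_real (\<Prod>i\<in>UNIV. moment (\<beta> i))) UNIV"
    by (rule has_sum_finite_neutralI[where B="{\<beta>}"]) (auto simp: integral_mpow_mpow)
  ultimately show ?thesis by (rule has_sum_unique)
qed

end

lemma radial_cutoff_indicator: "0 \<le> R \<Longrightarrow> radial_cutoff (indicator (ball 0 R)) R"
  by unfold_locales (auto simp: indicator_def norm_mult intro!: borel_measurable_indicator)

lemma radial_cutoff_gaussian:
  "0 \<le> R \<Longrightarrow> radial_cutoff (\<lambda>t. indicator (ball 0 R) t * exp (- (norm t)\<^sup>2)) R"
  by unfold_locales (auto simp: indicator_def norm_mult)

definition gauss_moment :: "nat \<Rightarrow> nat \<Rightarrow> real" where
  "gauss_moment N n = radial_cutoff.moment (\<lambda>t. indicator (ball 0 (real N)) t * exp (- (norm t)\<^sup>2)) n"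

lemma gauss_moment_limit: "(\<lambda>N. gauss_moment N n) \<longlonglongrightarrow> pi * fact n"
  and gauss_moment_bounds: "0 \<le> gauss_moment N n" "gauss_moment N n \<le> pi * fact n"
proof -
  let ?f = "\<lambda>t::complex. (norm t)\<^sup>2 ^ n * exp (- (norm t)\<^sup>2)"
  have hb: "has_bochner_integral lborel ?f (pi * fact n)"
    by (rule has_bochner_integral_nn_integral) (auto simp: nn_integral_gaussian_moment)
  then have int: "integrable lborel ?f" and val: "(\<integral>t. ?f t \<partial>lborel) = pi * fact n"
    by (auto simp: has_bochner_integral_iff)
  have eq: "gauss_moment N n = (\<integral>t. indicator (ball 0 (real N)) t * ?f t \<partial>lborel)" for N
    unfolding gauss_moment_def radial_cutoff.moment_def[OF radial_cutoff_gaussian[OF of_nat_0_le_iff]]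
    by (intro Bochner_Integration.integral_cong) (simp_all add: power_mult[symmetric] mult_ac)
  show "0 \<le> gauss_moment N n" unfolding eq by (intro Bochner_Integration.integral_nonneg) auto
  have "gauss_moment N n \<le> (\<integral>t. ?f t \<partial>lborel)" unfolding eq
  proof (rule Bochner_Integration.integral_mono[OF _ int])
    show "integrable lborel (\<lambda>t. indicator (ball 0 (real N)) t * ?f t)"
      using integrable_real_mult_indicator[OF _ int, of "ball 0 (real N)"] by (simp add: mult.commute)
  qed (simp add: indicator_def)
  then show "gauss_moment N n \<le> pi * fact n" by (simp add: val)
  have "(\<lambda>N. \<integral>t. indicator (ball 0 (real N)) t * ?f t \<partial>lborel) \<longlonglongrightarrow> (\<integral>t. ?f t \<partial>lborel)"
  proof (rule integral_dominated_convergence[where w="?f"])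
    show "AE t in lborel. (\<lambda>N. indicator (ball 0 (real N)) t * ?f t) \<longlonglongrightarrow> ?f t"
    proof (rule AE_I2)
      fix t :: complex
      obtain N0 :: nat where N0: "norm t < real N0" using reals_Archimedean2 by blast
      have "eventually (\<lambda>N. indicator (ball 0 (real N)) t * ?f t = ?f t) sequentially"
        using eventually_ge_at_top[of N0]
      proof eventually_elim
        case (elim N)
        then have "real N0 \<le> real N" by simp
        then show ?case using N0 by (simp add: indicator_def)
      qed
      then show "(\<lambda>N. indicator (ball 0 (real N)) t * ?f t) \<longlonglongrightarrow> ?f t"
        by (rule tendsto_eventually)
    qed
  qed (auto simp: int indicator_def)
  then show "(\<lambda>N. gauss_moment N n) \<longlonglongrightarrow> pi * fact n" by (simp add: eq val)
qed

text \<open>Pairing with a monomial determines each coefficient up to a product of truncated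
  moments. Letting N tend to infinity replaces that product by a positive number, which can be
  cancelled.\<close>

lemma expansion_coeff_unique:
  fixes G :: "complex^'d \<Rightarrow> complex"
  assumes "\<And>z. ((\<lambda>\<alpha>. c \<alpha> * mpow \<alpha> z) has_sum G z) UNIV" "\<And>z. ((\<lambda>\<alpha>. c' \<alpha> * mpow \<alpha> z) has_sum G z) UNIV"
  shows "c = c'"
proof
  fix \<beta> :: "'d \<Rightarrow> nat"
  have eq: "c \<beta> * of_real (\<Prod>i\<in>UNIV. gauss_moment N (\<beta> i)) = c' \<beta> * of_real (\<Prod>i\<in>UNIV. gauss_moment N (\<beta> i))" for N
    using trans[OF radial_cutoff.integral_expansion_mpow[OF radial_cutoff_gaussian[of "real N"] assms(1), of \<beta>, symmetric]
        radial_cutoff.integral_expansion_mpow[OF radial_cutoff_gaussian[of "real N"] assms(2), of \<beta>]]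
    by (simp only: gauss_moment_def of_nat_0_le_iff)
  have lim: "(\<lambda>N. d * of_real (\<Prod>i\<in>UNIV. gauss_moment N (\<beta> i))) \<longlonglongrightarrow> d * of_real (\<Prod>i\<in>UNIV. pi * fact (\<beta> i))"
    for d :: complex
    by (intro tendsto_intros gauss_moment_limit)
  have "c \<beta> * of_real (\<Prod>i\<in>UNIV. pi * fact (\<beta> i)) = c' \<beta> * of_real (\<Prod>i\<in>UNIV. pi * fact (\<beta> i))"
    using LIMSEQ_unique[OF lim[of "c \<beta>"]] lim[of "c' \<beta>"] by (simp only: eq)
  then show "c \<beta> = c' \<beta>" by simp
qed

text \<open>With the indicator of a disc as cutoff only the constant term of the expansion around z
  survives, multiplied by the volume of the polydisc. The extended-real form can be integrated over
  further variables before finiteness is known.\<close>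

lemma mean_value_polydisc:
  fixes F :: "complex^'d \<Rightarrow> complex"
  assumes F: "sep_hol F" and R: "0 < R"
  shows "ennreal ((pi * R\<^sup>2) ^ CARD('d) * norm (F z)) \<le> (\<integral>\<^sup>+ \<zeta>. indicator (polydisc R) \<zeta> * norm (F (z + \<zeta>)) \<partial>lborel)"
proof -
  define G where "G \<zeta> = F (z + \<zeta>)" for \<zeta>
  have contF: "continuous_on A F" for A using sep_hol_continuous[OF F] .
  have "sep_hol G" unfolding sep_hol_def
  proof (intro conjI allI)
    show cG: "continuous_on UNIV G"
      unfolding G_def by (intro continuous_on_compose2[OF contF[of UNIV]] continuous_intros) auto
    fix \<zeta> i
    have "z + vupd \<zeta> i t = vupd (z + \<zeta>) i (z $ i + t)" for t
      by (auto simp: vec_eq_iff)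
    moreover have "(\<lambda>t. F (vupd (z + \<zeta>) i (z $ i + t))) holomorphic_on UNIV"
      using holomorphic_on_compose_gen[of "\<lambda>t. z $ i + t" UNIV "\<lambda>t. F (vupd (z + \<zeta>) i t)" UNIV]
        sep_hol_holomorphic[OF F] holomorphic_on_add[OF holomorphic_on_const holomorphic_on_ident, of "z $ i" UNIV]
      by (auto simp: o_def)
    ultimately show "(\<lambda>t. G (vupd \<zeta> i t)) holomorphic_on UNIV" by (simp add: G_def)
  qed
  then obtain c where c: "\<And>\<zeta>. ((\<lambda>\<alpha>. c \<alpha> * mpow \<alpha> \<zeta>) has_sum G \<zeta>) UNIV"
    using sep_hol_expansion unfolding mpow_def by blast
  interpret radial_cutoff "indicator (ball 0 R)" R
    using radial_cutoff_indicator R by simp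
  have mom: "moment 0 = pi * R\<^sup>2"
    using R by (simp add: moment_def measure_def emeasure_ball unit_ball_vol_2)
  have "((\<lambda>\<alpha>. c \<alpha> * mpow \<alpha> 0) has_sum c (\<lambda>_. 0)) UNIV"
  proof (rule has_sum_finite_neutralI[where B="{\<lambda>_. 0}"])
    fix \<alpha> :: "'d \<Rightarrow> nat" assume "\<alpha> \<in> UNIV - {\<lambda>_. 0}"
    then obtain i where "\<alpha> i \<noteq> 0" by (auto simp: fun_eq_iff)
    then have "mpow \<alpha> 0 = 0" unfolding mpow_def by (intro prod_zero) (auto intro!: exI[of _ i])
    then show "c \<alpha> * mpow \<alpha> 0 = 0" by simp
  qed (auto simp: mpow_def)
  with c[of 0] have c0: "c (\<lambda>_. 0) = F z" by (auto dest: has_sum_unique simp: G_def)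
  have int: "(\<integral>\<zeta>. G \<zeta> * weight_prod \<zeta> \<partial>lborel) = F z * of_real ((pi * R\<^sup>2) ^ CARD('d))"
    using integral_expansion_mpow[OF c, of "\<lambda>_. 0"] by (simp add: mpow_def c0 mom)
  have wp: "norm (weight_prod \<zeta>) = indicator (polydisc R) \<zeta>" for \<zeta> :: "complex^'d"
    by (auto simp: weight_prod_def polydisc_def indicator_def prod_zero simp flip: prod_norm)
  have "ennreal ((pi * R\<^sup>2) ^ CARD('d) * norm (F z)) = ennreal (norm (\<integral>\<zeta>. G \<zeta> * weight_prod \<zeta> \<partial>lborel))"
    using R by (simp add: int norm_mult norm_power mult.commute)
  also have "\<dots> \<le> (\<integral>\<^sup>+ \<zeta>. norm (G \<zeta> * weight_prod \<zeta>) \<partial>lborel)"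
  proof (rule integral_norm_bound_ennreal)
    have [measurable]: "G \<in> borel_measurable borel"
      by (rule borel_measurable_continuous_onI[OF sep_hol_continuous[OF \<open>sep_hol G\<close>]])
    obtain B where "\<And>\<zeta>. norm (G \<zeta> * weight_prod \<zeta>) \<le> B * indicator (polydisc R) \<zeta>"
      using norm_weight_prod_mult[OF sep_hol_continuous[OF \<open>sep_hol G\<close>]] by blast
    then show "integrable lborel (\<lambda>\<zeta>. G \<zeta> * weight_prod \<zeta>)"
      by (rule integrable_polydisc(1)[rotated]) measurable
  qed
  also have "\<dots> = (\<integral>\<^sup>+ \<zeta>. indicator (polydisc R) \<zeta> * norm (F (z + \<zeta>)) \<partial>lborel)"
    by (intro nn_integral_cong) (simp add: norm_mult wp G_def mult.commute ennreal_mult' ennreal_indicator)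
  finally show ?thesis .
qed

section \<open>The coefficient formula for the operator\<close>

lemma mfact_pos: "0 < mfact \<alpha>"
  by (simp add: mfact_def prod_pos)

lemma mfact_nonzero [simp]: "mfact \<alpha> \<noteq> 0"
  using mfact_pos[of \<alpha>] by simp

lemma monom_e_eq: "monom_e \<alpha> z = mpow \<alpha> z / of_real (sqrt (mfact \<alpha>))"
  by (simp add: monom_e_def mpow_def)

lemma coeff_F_has_sum:
  assumes "F \<in> A_entire"
  shows "((\<lambda>\<alpha>. coeff_F F \<alpha> * monom_e \<alpha> z) has_sum F z) UNIV"
proof -
  have "sep_hol F" using assms by (auto simp: A_entire_def intro: entire_wrt_imp_sep_hol)
  then obtain c where c: "\<And>z. ((\<lambda>\<alpha>. c \<alpha> * mpow \<alpha> z) has_sum F z) UNIV"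
    using sep_hol_expansion unfolding mpow_def by blast
  have "\<exists>!c. \<forall>z. ((\<lambda>\<alpha>. c \<alpha> * monom_e \<alpha> z) has_sum F z) UNIV"
  proof (rule ex1I)
    show "\<forall>z. ((\<lambda>\<alpha>. c \<alpha> * of_real (sqrt (mfact \<alpha>)) * monom_e \<alpha> z) has_sum F z) UNIV"
      using c by (simp add: monom_e_eq)
    fix c' assume "\<forall>z. ((\<lambda>\<alpha>. c' \<alpha> * monom_e \<alpha> z) has_sum F z) UNIV"
    then have "((\<lambda>\<alpha>. (c' \<alpha> / of_real (sqrt (mfact \<alpha>))) * mpow \<alpha> z) has_sum F z) UNIV" for z
      by (simp add: monom_e_eq)
    then have "(\<lambda>\<alpha>. c' \<alpha> / of_real (sqrt (mfact \<alpha>))) = c"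
      using c by (rule expansion_coeff_unique)
    then show "c' = (\<lambda>\<alpha>. c \<alpha> * of_real (sqrt (mfact \<alpha>)))"
      by auto
  qed
  from theI'[OF this] show ?thesis unfolding coeff_F_def by blast
qed

section \<open>Kernels as functions of 2 d complex variables\<close>

text \<open>Two vector variables become one vector indexed by a sum type, so that the expansion of
  functions of one vector variable, with its uniqueness, also covers kernels.\<close>

definition join :: "(complex^'d) \<times> (complex^'d) \<Rightarrow> complex^('d + 'd)" where
  "join = (\<lambda>(z, w). \<chi> k. case k of Inl i \<Rightarrow> z $ i | Inr i \<Rightarrow> w $ i)"

definition unjoin :: "complex^('d + 'd) \<Rightarrow> (complex^'d) \<times> (complex^'d)" where
  "unjoin v = (\<chi> i. v $ Inl i, \<chi> i. v $ Inr i)"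

lemma unjoin_join [simp]: "unjoin (join p) = p"
  by (cases p) (simp add: unjoin_def join_def)

lemma join_unjoin [simp]: "join (unjoin v) = v"
  by (auto simp: unjoin_def join_def vec_eq_iff split: sum.splits)

lemma all_join: "(\<forall>v. P v) \<longleftrightarrow> (\<forall>z w. P (join (z, w)))"
proof safe
  fix v assume "\<forall>z w. P (join (z, w))"
  then have "P (join (fst (unjoin v), snd (unjoin v)))" by blast
  then show "P v" by simp
qed blast

lemma bounded_linear_unjoin: "bounded_linear unjoin"
  by (intro linear_conv_bounded_linear[THEN iffD1] linearI) (auto simp: vec_eq_iff unjoin_def)

lemma prod_UNIV_Plus:
  fixes f :: "'a::finite + 'b::finite \<Rightarrow> 'c::comm_monoid_mult"
  shows "prod f UNIV = (\<Prod>i\<in>UNIV. f (Inl i)) * (\<Prod>i\<in>UNIV. f (Inr i))"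
  by (simp add: prod.Plus flip: UNIV_Plus_UNIV)

lemma mpow_join: "mpow \<gamma> (join (z, w)) = mpow (\<gamma> \<circ> Inl) z * mpow (\<gamma> \<circ> Inr) w"
  by (simp add: mpow_def prod_UNIV_Plus join_def)

lemma bij_case_sum: "bij_betw (\<lambda>(\<alpha>, \<beta>). case_sum \<alpha> \<beta>) UNIV (UNIV :: ('d + 'd \<Rightarrow> nat) set)"
  by (rule bij_betw_byWitness[where f'="\<lambda>\<gamma>. (\<gamma> \<circ> Inl, \<gamma> \<circ> Inr)"])
    (auto simp: fun_eq_iff split: sum.splits)

lemma case_sum_comp_Inl_Inr [simp]: "case_sum \<alpha> \<beta> \<circ> Inl = \<alpha>" "case_sum \<alpha> \<beta> \<circ> Inr = \<beta>"
  by (auto simp: fun_eq_iff)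

lemma case_sum_Inl_Inr [simp]: "case_sum (\<gamma> \<circ> Inl) (\<gamma> \<circ> Inr) = \<gamma>"
  by (auto simp: fun_eq_iff split: sum.splits)

lemma cnj_vec_cnj_vec [simp]: "cnj_vec (cnj_vec z) = z"
  by (simp add: cnj_vec_def vec_eq_iff)

lemma A_tilde_entire_join:
  assumes "K \<in> A_tilde"
  shows "entire_wrt (*s) (\<lambda>v. case unjoin v of (z, w) \<Rightarrow> K (z, cnj_vec w))"
  unfolding entire_wrt_def
proof
  fix v
  obtain F' where F': "((\<lambda>(z, w). K (z, cnj_vec w)) has_derivative F') (at (unjoin v))"
      "\<And>c p. F' ((\<lambda>(z, w). (c *s z, c *s w)) p) = c * F' p"
    using assms unfolding A_tilde_def entire_wrt_def by blast
  have "(unjoin has_derivative unjoin) (at v)"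
    by (rule bounded_linear_imp_has_derivative[OF bounded_linear_unjoin])
  from diff_chain_at[OF this F'(1)]
  have "((\<lambda>v. case unjoin v of (z, w) \<Rightarrow> K (z, cnj_vec w)) has_derivative (F' \<circ> unjoin)) (at v)"
    by (simp add: o_def)
  moreover have "(F' \<circ> unjoin) (c *s u) = c * (F' \<circ> unjoin) u" for c u
    using F'(2)[of c "unjoin u"] by (simp add: unjoin_def vector_scalar_mult_def)
  ultimately show "\<exists>F'. ((\<lambda>v. case unjoin v of (z, w) \<Rightarrow> K (z, cnj_vec w)) has_derivative F') (at v) \<and>
      (\<forall>c u. F' (c *s u) = c * F' u)" by blast
qed

text \<open>K with its second argument conjugated is an entire function of 2 d variables. Splitting
  a multi-index on the sum type into its two halves turns its power series into the double series of
  K.\<close>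

lemma coeff_K_has_sum:
  fixes K :: "(complex^'d) \<times> (complex^'d) \<Rightarrow> complex"
  assumes "K \<in> A_tilde"
  shows "((\<lambda>(\<alpha>, \<beta>). coeff_K K \<alpha> \<beta> * monom_e \<alpha> z * monom_e \<beta> (cnj_vec w)) has_sum K (z, w)) UNIV"
proof -
  define E where "E v = (case unjoin v of (z, w) \<Rightarrow> K (z, cnj_vec w))" for v
  have E_join: "E (join (z, w)) = K (z, cnj_vec w)" for z w by (simp add: E_def)
  have "sep_hol E" using A_tilde_entire_join[OF assms] unfolding E_def by (rule entire_wrt_imp_sep_hol)
  then obtain c where c: "\<And>v. ((\<lambda>\<gamma>. c \<gamma> * mpow \<gamma> v) has_sum E v) UNIV"
    using sep_hol_expansion unfolding mpow_def by blast
  define s where "s \<alpha> = complex_of_real (sqrt (mfact \<alpha>))" for \<alpha> :: "'d \<Rightarrow> nat"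
  have s: "s \<alpha> \<noteq> 0" for \<alpha> using mfact_pos[of \<alpha>] by (simp add: s_def)
  \<comment> \<open>For any candidate b the two families of series are equivalent, so existence and
    uniqueness of the coefficients transfer from the power series of \<open>E\<close>.\<close>
  have *: "(\<forall>z w. ((\<lambda>(\<alpha>, \<beta>). b \<alpha> \<beta> * monom_e \<alpha> z * monom_e \<beta> (cnj_vec w)) has_sum K (z, w)) UNIV) \<longleftrightarrow>
      (\<forall>v. ((\<lambda>\<gamma>. b (\<gamma> \<circ> Inl) (\<gamma> \<circ> Inr) / (s (\<gamma> \<circ> Inl) * s (\<gamma> \<circ> Inr)) * mpow \<gamma> v) has_sum E v) UNIV)"
    (is "?L \<longleftrightarrow> ?R") for b
  proof -
    have eq: "((\<lambda>\<gamma>. b (\<gamma> \<circ> Inl) (\<gamma> \<circ> Inr) / (s (\<gamma> \<circ> Inl) * s (\<gamma> \<circ> Inr)) * mpow \<gamma> (join (z, w))) has_sum E (join (z, w))) UNIV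
      \<longleftrightarrow> ((\<lambda>(\<alpha>, \<beta>). b \<alpha> \<beta> * monom_e \<alpha> z * monom_e \<beta> w) has_sum K (z, cnj_vec w)) UNIV" for z w
      by (subst has_sum_reindex_bij_betw[OF bij_case_sum, symmetric])
        (simp add: split_beta' mpow_join monom_e_eq s_def E_join mult.assoc)
    have "?R \<longleftrightarrow> (\<forall>z w. ((\<lambda>\<gamma>. b (\<gamma> \<circ> Inl) (\<gamma> \<circ> Inr) / (s (\<gamma> \<circ> Inl) * s (\<gamma> \<circ> Inr)) * mpow \<gamma> (join (z, w))) has_sum E (join (z, w))) UNIV)"
      by (rule all_join)
    also have "\<dots> \<longleftrightarrow> ?L"
    proof -
      define P where "P z w \<longleftrightarrow>
        ((\<lambda>(\<alpha>, \<beta>). b \<alpha> \<beta> * monom_e \<alpha> z * monom_e \<beta> w) has_sum K (z, cnj_vec w)) UNIV" for z w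
      have "(\<forall>z w. P z w) \<longleftrightarrow> (\<forall>z w. P z (cnj_vec w))" by (metis cnj_vec_cnj_vec)
      then show ?thesis unfolding eq by (simp add: P_def)
    qed
    finally show ?thesis by blast
  qed
  have "\<exists>!b. \<forall>z w. ((\<lambda>(\<alpha>, \<beta>). b \<alpha> \<beta> * monom_e \<alpha> z * monom_e \<beta> (cnj_vec w)) has_sum K (z, w)) UNIV"
    unfolding *
  proof (rule ex1I)
    \<comment> \<open>The quotient stays uncancelled: in this form the unfolded equivalence displays
      the witness b, the coefficient c rescaled by the two normalizing factors.\<close>
    show "\<forall>v. ((\<lambda>\<gamma>. (c (case_sum (\<gamma> \<circ> Inl) (\<gamma> \<circ> Inr)) * (s (\<gamma> \<circ> Inl) * s (\<gamma> \<circ> Inr))) / (s (\<gamma> \<circ> Inl) * s (\<gamma> \<circ> Inr)) * mpow \<gamma> v) has_sum E v) UNIV"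
      using c s by simp
    fix b
    assume "\<forall>v. ((\<lambda>\<gamma>. b (\<gamma> \<circ> Inl) (\<gamma> \<circ> Inr) / (s (\<gamma> \<circ> Inl) * s (\<gamma> \<circ> Inr)) * mpow \<gamma> v) has_sum E v) UNIV"
    then have "(\<lambda>\<gamma>. b (\<gamma> \<circ> Inl) (\<gamma> \<circ> Inr) / (s (\<gamma> \<circ> Inl) * s (\<gamma> \<circ> Inr))) = c"
      using c by (intro expansion_coeff_unique) auto
    then have "b \<alpha> \<beta> / (s \<alpha> * s \<beta>) = c (case_sum \<alpha> \<beta>)" for \<alpha> \<beta>
      by (auto dest!: fun_cong[of _ _ "case_sum \<alpha> \<beta>"])
    then show "b = (\<lambda>\<alpha> \<beta>. c (case_sum \<alpha> \<beta>) * (s \<alpha> * s \<beta>))"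
      using s by (auto simp: fun_eq_iff field_simps)
  qed
  from theI'[OF this] show ?thesis unfolding coeff_K_def by blast
qed

section \<open>Pairing the expansions of kernel and function\<close>

lemma gauss_weight_prod:
  fixes w :: "complex^'d"
  assumes "0 \<le> R"
  shows "radial_cutoff.weight_prod (\<lambda>t. indicator (ball 0 R) t * exp (- (norm t)\<^sup>2)) w
    = of_real (indicator (polydisc R) w * exp (- (norm w)\<^sup>2))"
proof -
  have n: "(norm w)\<^sup>2 = (\<Sum>i\<in>UNIV. (norm (w $ i))\<^sup>2)"
    by (simp add: norm_vec_def L2_set_def sum_nonneg)
  have i: "(\<Prod>i\<in>UNIV. indicator (ball 0 R) (w $ i)) = (indicator (polydisc R) w :: real)"
    by (auto simp: polydisc_def indicator_def prod_zero)
  show ?thesis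
    unfolding radial_cutoff.weight_prod_def[OF radial_cutoff_gaussian[OF assms]] n
      i[symmetric] sum_negf[symmetric] exp_sum[OF finite]
    by (simp add: prod.distrib)
qed

text \<open>Each moment ratio lies between 0 and \<open>pi ^ CARD('d)\<close> and tends to that
  upper bound, while summability of u is absolute; Tannery's theorem exchanges limit and
  sum.\<close>

lemma tendsto_has_sum_gauss_moment:
  fixes u :: "('d::finite \<Rightarrow> nat) \<Rightarrow> complex"
  assumes u: "u summable_on UNIV"
    and I: "\<And>N. ((\<lambda>\<beta>. u \<beta> * of_real ((\<Prod>i\<in>UNIV. gauss_moment N (\<beta> i)) / mfact \<beta>)) has_sum I N) UNIV"
  shows "I \<longlonglongrightarrow> infsum u UNIV * of_real (pi ^ CARD('d))"
proof -
  obtain e :: "nat \<Rightarrow> 'd \<Rightarrow> nat" where e: "bij_betw e UNIV UNIV" using multi_index_enum by blast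
  define r where "r \<beta> N = (\<Prod>i\<in>UNIV. gauss_moment N (\<beta> i)) / mfact \<beta>" for \<beta> :: "'d \<Rightarrow> nat" and N
  have r_alt: "r \<beta> N = (\<Prod>i\<in>UNIV. gauss_moment N (\<beta> i) / fact (\<beta> i))" for \<beta> N
    by (simp add: r_def mfact_def prod_dividef)
  have rlim: "(\<lambda>N. r \<beta> N) \<longlonglongrightarrow> pi ^ CARD('d)" for \<beta>
  proof -
    have "(\<lambda>N. r \<beta> N) \<longlonglongrightarrow> (\<Prod>i\<in>(UNIV::'d set). pi * fact (\<beta> i) / fact (\<beta> i))"
      unfolding r_alt by (intro tendsto_intros gauss_moment_limit) auto
    then show ?thesis by simp
  qed
  have rb: "\<bar>r \<beta> N\<bar> \<le> pi ^ CARD('d)" for \<beta> N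
  proof -
    have "\<bar>r \<beta> N\<bar> = (\<Prod>i\<in>UNIV. gauss_moment N (\<beta> i) / fact (\<beta> i))"
      by (simp add: r_alt prod_nonneg gauss_moment_bounds(1))
    also have "\<dots> \<le> (\<Prod>i\<in>(UNIV::'d set). pi)"
      using gauss_moment_bounds by (intro prod_mono conjI) (auto simp: field_simps)
    finally show ?thesis by simp
  qed
  have "(\<lambda>\<beta>. norm (u \<beta>)) summable_on UNIV"
    using u unfolding summable_on_iff_abs_summable_on_complex .
  then have nsum: "summable (\<lambda>n. norm (u (e n)))"
    using summable_on_reindex_bij_betw[OF e, of "\<lambda>\<beta>. norm (u \<beta>)"] by (simp add: summable_on_imp_summable)
  have I': "(\<lambda>n. u (e n) * of_real (r (e n) N)) sums I N" for N
    using has_sum_reindex_bij_betw[OF e, of "\<lambda>\<beta>. u \<beta> * of_real (r \<beta> N)"] I[of N]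
    by (intro has_sum_imp_sums) (simp add: r_def)
  have us: "(\<lambda>n. u (e n)) sums infsum u UNIV"
    using has_sum_reindex_bij_betw[OF e, of u] has_sum_infsum[OF u] by (intro has_sum_imp_sums) simp
  have "(\<lambda>N. \<Sum>n. u (e n) * of_real (r (e n) N)) \<longlonglongrightarrow> (\<Sum>n. u (e n) * of_real (pi ^ CARD('d)))"
  proof (rule tannerys_theorem[THEN conjunct2, THEN conjunct2])
    show "(\<lambda>N. u (e n) * of_real (r (e n) N)) \<longlonglongrightarrow> u (e n) * of_real (pi ^ CARD('d))" for n
      by (intro tendsto_intros rlim)
    show "summable (\<lambda>n. norm (u (e n)) * pi ^ CARD('d))"
      by (rule summable_mult2[OF nsum])
    show "\<forall>\<^sub>F (n, N) in at_top \<times>\<^sub>F sequentially.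
        norm (u (e n) * of_real (r (e n) N)) \<le> norm (u (e n)) * pi ^ CARD('d)"
      by (rule always_eventually) (auto simp: norm_mult intro!: mult_left_mono rb)
  qed simp
  moreover have "(\<Sum>n. u (e n) * of_real (r (e n) N)) = I N" for N
    using I' by (simp add: sums_iff)
  moreover have "(\<Sum>n. u (e n) * of_real (pi ^ CARD('d))) = infsum u UNIV * of_real (pi ^ CARD('d))"
    using sums_mult2[OF us] by (simp add: sums_iff)
  ultimately show ?thesis by simp
qed

lemma integral_gauss_measure:
  fixes f :: "complex^'d \<Rightarrow> complex"
  assumes [measurable]: "f \<in> borel_measurable borel" and int: "integrable gauss_measure f"
  shows "integrable lborel (\<lambda>w. f w * of_real (exp (- (norm w)\<^sup>2)))"
    and "(\<integral>w. f w * of_real (exp (- (norm w)\<^sup>2)) \<partial>lborel) = (\<integral>w. f w \<partial>gauss_measure) * of_real (pi ^ CARD('d))"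
proof -
  have "integrable lborel (\<lambda>w. (exp (- (norm w)\<^sup>2) / pi ^ CARD('d)) *\<^sub>R f w)"
    using int unfolding gauss_measure_def by (subst (asm) integrable_density) auto
  then have i: "integrable lborel (\<lambda>w. pi ^ CARD('d) *\<^sub>R ((exp (- (norm w)\<^sup>2) / pi ^ CARD('d)) *\<^sub>R f w))"
    by (rule integrable_scaleR_right)
  have eq: "pi ^ CARD('d) *\<^sub>R ((exp (- (norm w)\<^sup>2) / pi ^ CARD('d)) *\<^sub>R f w) = f w * of_real (exp (- (norm w)\<^sup>2))" for w
    by (simp add: scaleR_conv_of_real)
  show "integrable lborel (\<lambda>w. f w * of_real (exp (- (norm w)\<^sup>2)))" using i unfolding eq .
  have "(\<integral>w. f w \<partial>gauss_measure) = (\<integral>w. (exp (- (norm w)\<^sup>2) / pi ^ CARD('d)) *\<^sub>R f w \<partial>lborel)"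
    unfolding gauss_measure_def by (subst integral_density) auto
  then have "(\<integral>w. f w \<partial>gauss_measure) * of_real (pi ^ CARD('d))
      = (\<integral>w. pi ^ CARD('d) *\<^sub>R ((exp (- (norm w)\<^sup>2) / pi ^ CARD('d)) *\<^sub>R f w) \<partial>lborel)"
    by (simp add: scaleR_conv_of_real mult.commute)
  then show "(\<integral>w. f w * of_real (exp (- (norm w)\<^sup>2)) \<partial>lborel) = (\<integral>w. f w \<partial>gauss_measure) * of_real (pi ^ CARD('d))"
    unfolding eq by simp
qed

lemma cnj_mpow: "cnj (mpow \<alpha> z) = mpow \<alpha> (cnj_vec z)"
  by (simp add: mpow_def cnj_vec_def)

lemma continuous_on_cnj_vec: "continuous_on S cnj_vec"
  unfolding cnj_vec_def by (intro continuous_intros)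

lemma A_tilde_continuous: "K \<in> A_tilde \<Longrightarrow> continuous_on S K"
proof -
  assume "K \<in> A_tilde"
  then have c: "continuous_on UNIV (\<lambda>(z, w). K (z, cnj_vec w))"
    unfolding A_tilde_def entire_wrt_def
    by (auto intro!: continuous_at_imp_continuous_on dest!: has_derivative_continuous)
  have "continuous_on S (\<lambda>p. (\<lambda>(z, w). K (z, cnj_vec w)) (fst p, cnj_vec (snd p)))"
    by (rule continuous_on_compose2[OF c])
      (auto intro!: continuous_intros continuous_on_compose2[OF continuous_on_cnj_vec[of UNIV]])
  then show ?thesis by simp
qed

text \<open>\<open>T_op\<close> sums over \<beta> inside and over \<alpha> outside. Carrying out the
  \<alpha>-sum at fixed z gives the coefficients k of K(z, .), and the operator becomes the sum of k
  \<beta> * f \<beta>. This sum and the integral, both times pi^d, are limits of the same integrals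
  over polydiscs.\<close>

lemma T_op_eq_integral:
  fixes K :: "(complex^'d) \<times> (complex^'d) \<Rightarrow> complex"
  assumes K: "K \<in> A_tilde" and F: "F \<in> A_flat1"
    and int: "integrable gauss_measure (\<lambda>w. K (z, w) * F w)"
  shows "T_op K F z = (\<integral>w. K (z, w) * F w \<partial>gauss_measure)"
proof -
  define a where "a \<alpha> \<beta> = coeff_K K \<alpha> \<beta> * monom_e \<alpha> z" for \<alpha> \<beta>
  define f where "f = coeff_F F"
  have Fe: "F \<in> A_entire" using F by (simp add: A_flat1_def)
  have contF: "continuous_on UNIV F"
    using Fe by (auto simp: A_entire_def intro!: sep_hol_continuous entire_wrt_imp_sep_hol)
  have contK: "continuous_on UNIV (\<lambda>w. K (z, w))"
    by (rule continuous_on_compose2[OF A_tilde_continuous[OF K, of UNIV]]) (auto intro!: continuous_intros)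
  have [measurable]: "F \<in> borel_measurable borel" "(\<lambda>w. K (z, w)) \<in> borel_measurable borel"
    by (intro borel_measurable_continuous_onI contF contK)+
  have [measurable]: "cnj \<in> borel_measurable borel"
    by (intro borel_measurable_continuous_onI continuous_intros)
  obtain h C where h: "0 < h" "\<And>\<beta>. norm (f \<beta>) \<le> C * h ^ (\<Sum>i\<in>UNIV. \<beta> i) / sqrt (mfact \<beta>)"
    using F unfolding A_flat1_def f_def by blast
  have hK: "((\<lambda>(\<alpha>, \<beta>). a \<alpha> \<beta> * monom_e \<beta> (cnj_vec w)) has_sum K (z, w)) (UNIV \<times> UNIV)" for w
    using coeff_K_has_sum[OF K, of z w] by (simp add: a_def)
  define k where "k \<beta> = (\<Sum>\<^sub>\<infinity>\<alpha>. a \<alpha> \<beta>)" for \<beta>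
  have hk1: "((\<lambda>\<alpha>. a \<alpha> \<beta>) has_sum k \<beta>) UNIV" for \<beta>
  proof -
    \<comment> \<open>No monomial vanishes at (1, ..., 1), so summability of the double series there
      gives that of the \<alpha>-sum for each \<beta>.\<close>
    define w where "w = (\<chi> i. 1 :: complex^'d)"
    have mw: "monom_e \<beta> (cnj_vec w) \<noteq> 0"
      using mfact_pos[of \<beta>] by (simp add: monom_e_def w_def cnj_vec_def)
    have "(\<lambda>(\<beta>, \<alpha>). a \<alpha> \<beta> * monom_e \<beta> (cnj_vec w)) summable_on (UNIV \<times> UNIV)"
      using hK[of w] by (subst (asm) has_sum_swap) (auto dest: has_sum_imp_summable)
    from summable_on_SigmaD1[OF this UNIV_I, of \<beta>]
    have "(\<lambda>\<alpha>. a \<alpha> \<beta>) summable_on UNIV"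
      using mw by (simp add: summable_on_cmult_left')
    then show ?thesis unfolding k_def by simp
  qed
  have hk: "((\<lambda>\<beta>. k \<beta> * monom_e \<beta> (cnj_vec w)) has_sum K (z, w)) UNIV" for w
  proof -
    have "((\<lambda>(\<beta>, \<alpha>). a \<alpha> \<beta> * monom_e \<beta> (cnj_vec w)) has_sum K (z, w)) (UNIV \<times> UNIV)"
      using hK[of w] by (subst (asm) has_sum_swap) simp
    then show ?thesis
      by (rule has_sum_SigmaD) (auto intro!: has_sum_cmult_left hk1)
  qed
  have sum2: "(\<lambda>(\<alpha>, \<beta>). a \<alpha> \<beta> * f \<beta>) summable_on (UNIV \<times> UNIV)"
    unfolding summable_on_iff_abs_summable_on_complex
  proof (rule Infinite_Sum.abs_summable_on_comparison_test)
    \<comment> \<open>The growth condition bounds the coefficient f \<beta> by C times the modulus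
      of \<open>monom_e \<beta>\<close> at (h, ..., h), so the double series of K at this point is
      the majorant.\<close>
    define w where "w = (\<chi> i. complex_of_real h :: complex^'d)"
    have mw: "norm (monom_e \<beta> (cnj_vec w)) = h ^ (\<Sum>i\<in>UNIV. \<beta> i) / sqrt (mfact \<beta>)" for \<beta>
      using h(1) mfact_pos[of \<beta>]
      by (simp add: monom_e_def w_def cnj_vec_def norm_divide norm_power power_sum flip: prod_norm)
    have "(\<lambda>(\<alpha>, \<beta>). a \<alpha> \<beta> * monom_e \<beta> (cnj_vec w)) summable_on (UNIV \<times> UNIV)"
      using hK[of w] by (rule has_sum_imp_summable)
    from summable_on_cmult_right[OF this, of "of_real C"]
    show "(\<lambda>x. norm (of_real C * (case x of (\<alpha>, \<beta>) \<Rightarrow> a \<alpha> \<beta> * monom_e \<beta> (cnj_vec w)))) summable_on (UNIV \<times> UNIV)"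
      unfolding summable_on_iff_abs_summable_on_complex .
    fix x :: "('d \<Rightarrow> nat) \<times> ('d \<Rightarrow> nat)"
    obtain \<alpha> \<beta> where x: "x = (\<alpha>, \<beta>)" by fastforce
    have "norm (f \<beta>) \<le> \<bar>C\<bar> * norm (monom_e \<beta> (cnj_vec w))"
    proof -
      have "norm (f \<beta>) \<le> C * norm (monom_e \<beta> (cnj_vec w))"
        using h(2)[of \<beta>] by (simp add: mw)
      also have "\<dots> \<le> \<bar>C\<bar> * norm (monom_e \<beta> (cnj_vec w))"
        by (intro mult_right_mono) auto
      finally show ?thesis .
    qed
    then have "norm (a \<alpha> \<beta>) * norm (f \<beta>) \<le> norm (a \<alpha> \<beta>) * (\<bar>C\<bar> * norm (monom_e \<beta> (cnj_vec w)))"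
      by (intro mult_left_mono) auto
    then show "norm (case x of (\<alpha>, \<beta>) \<Rightarrow> a \<alpha> \<beta> * f \<beta>)
        \<le> norm (of_real C * (case x of (\<alpha>, \<beta>) \<Rightarrow> a \<alpha> \<beta> * monom_e \<beta> (cnj_vec w)))"
      by (simp add: x norm_mult mult_ac)
  qed
  have "T_op K F z = (\<Sum>\<^sub>\<infinity>\<alpha>. \<Sum>\<^sub>\<infinity>\<beta>. a \<alpha> \<beta> * f \<beta>)"
    unfolding T_op_def a_def f_def infsum_cmult_left'[symmetric] by (simp add: mult_ac)
  also have "\<dots> = (\<Sum>\<^sub>\<infinity>\<beta>. \<Sum>\<^sub>\<infinity>\<alpha>. a \<alpha> \<beta> * f \<beta>)"
    by (rule infsum_swap_banach[OF sum2])
  also have "\<dots> = (\<Sum>\<^sub>\<infinity>\<beta>. k \<beta> * f \<beta>)"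
    by (simp add: infsum_cmult_left' k_def)
  finally have T: "T_op K F z = (\<Sum>\<^sub>\<infinity>\<beta>. k \<beta> * f \<beta>)" .
  have kf: "(\<lambda>\<beta>. k \<beta> * f \<beta>) summable_on UNIV"
  proof -
    obtain S where "((\<lambda>(\<alpha>, \<beta>). a \<alpha> \<beta> * f \<beta>) has_sum S) (UNIV \<times> UNIV)"
      using sum2 by (auto simp: summable_on_def)
    then have "((\<lambda>(\<beta>, \<alpha>). a \<alpha> \<beta> * f \<beta>) has_sum S) (UNIV \<times> UNIV)"
      by (subst (asm) has_sum_swap) simp
    then have "((\<lambda>\<beta>. k \<beta> * f \<beta>) has_sum S) UNIV"
      by (rule has_sum_SigmaD) (auto intro!: has_sum_cmult_left hk1)
    then show ?thesis by (rule has_sum_imp_summable)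
  qed
  define wp where "wp N w = complex_of_real (indicator (polydisc (real N)) w * exp (- (norm w)\<^sup>2))"
    for N and w :: "complex^'d"
  have I: "((\<lambda>\<beta>. (k \<beta> * f \<beta>) * of_real ((\<Prod>i\<in>UNIV. gauss_moment N (\<beta> i)) / mfact \<beta>)) has_sum
      (\<integral>w. K (z, w) * F w * wp N w \<partial>lborel)) UNIV" for N
  proof -
    interpret radial_cutoff "\<lambda>t. indicator (ball 0 (real N)) t * exp (- (norm t)\<^sup>2)" "real N"
      by (rule radial_cutoff_gaussian) simp
    have wp: "weight_prod = wp N" by (simp add: fun_eq_iff wp_def gauss_weight_prod)
    have cnj_wp: "cnj (weight_prod w) = weight_prod w" for w :: "complex^'d"
      by (simp add: wp wp_def)
    define s where "s \<beta> = complex_of_real (sqrt (mfact \<beta>))" for \<beta> :: "'d \<Rightarrow> nat"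
    have s: "s \<beta> \<noteq> 0" "cnj (s \<beta>) = s \<beta>" "s \<beta> * s \<beta> = of_real (mfact \<beta>)" for \<beta>
      using mfact_pos[of \<beta>] by (simp_all add: s_def flip: of_real_mult)
    \<comment> \<open>K(z, .) is antiholomorphic, so it is its complex conjugate that has a power
      series in w.\<close>
    have G: "((\<lambda>\<beta>. (cnj (k \<beta>) / s \<beta>) * mpow \<beta> w) has_sum cnj (K (z, w))) UNIV" for w
      using has_sum_cnj_iff[THEN iffD2, OF hk[of w]]
      by (simp del: has_sum_cnj_iff add: cnj_mpow monom_e_eq s_def)
    obtain B where B: "\<And>w. norm (cnj (F w) * weight_prod w) \<le> B * indicator (polydisc (real N)) w"
      using norm_weight_prod_mult[of "\<lambda>w. cnj (F w)"] contF by (auto intro: continuous_intros)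
    have F': "((\<lambda>\<beta>. (f \<beta> / s \<beta>) * mpow \<beta> w) has_sum F w) UNIV" for w
      using coeff_F_has_sum[OF Fe, of w] by (simp add: f_def monom_e_eq s_def)
    \<comment> \<open>Only the series of the conjugated kernel is integrated term by term here; each
      remaining integral, of a monomial against the conjugate of F, yields one coefficient of
      F.\<close>
    have "((\<lambda>\<beta>. (cnj (k \<beta>) / s \<beta>) * (\<integral>w. mpow \<beta> w * (cnj (F w) * weight_prod w) \<partial>lborel)) has_sum
        (\<integral>w. cnj (K (z, w)) * (cnj (F w) * weight_prod w) \<partial>lborel)) UNIV"
      by (rule has_sum_integral_polydisc[OF G _ _ B]) (simp, measurable)
    also have "(\<integral>w. cnj (K (z, w)) * (cnj (F w) * weight_prod w) \<partial>lborel)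
        = cnj (\<integral>w. K (z, w) * F w * weight_prod w \<partial>lborel)"
      by (simp add: cnj_wp mult_ac flip: Bochner_Integration.integral_cnj)
    also have "(\<lambda>\<beta>. (cnj (k \<beta>) / s \<beta>) * (\<integral>w. mpow \<beta> w * (cnj (F w) * weight_prod w) \<partial>lborel))
        = (\<lambda>\<beta>. cnj ((k \<beta> * f \<beta>) * of_real ((\<Prod>i\<in>UNIV. gauss_moment N (\<beta> i)) / mfact \<beta>)))"
    proof
      fix \<beta>
      have "(\<integral>w. mpow \<beta> w * (cnj (F w) * weight_prod w) \<partial>lborel)
          = cnj (\<integral>w. F w * (cnj (mpow \<beta> w) * weight_prod w) \<partial>lborel)"
        by (simp add: cnj_wp mult_ac flip: Bochner_Integration.integral_cnj)
      also have "\<dots> = cnj ((f \<beta> / s \<beta>) * of_real (\<Prod>i\<in>UNIV. gauss_moment N (\<beta> i)))"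
        by (simp add: integral_expansion_mpow[OF F'] gauss_moment_def)
      finally show "(cnj (k \<beta>) / s \<beta>) * (\<integral>w. mpow \<beta> w * (cnj (F w) * weight_prod w) \<partial>lborel)
          = cnj ((k \<beta> * f \<beta>) * of_real ((\<Prod>i\<in>UNIV. gauss_moment N (\<beta> i)) / mfact \<beta>))"
        using s by (simp add: of_real_divide flip: s(3))
    qed
    finally show ?thesis unfolding has_sum_cnj_iff wp .
  qed
  note lim1 = tendsto_has_sum_gauss_moment[OF kf I]
  note intl = integral_gauss_measure[OF _ int]
  have "(\<lambda>N. \<integral>w. K (z, w) * F w * wp N w \<partial>lborel) \<longlonglongrightarrow> (\<integral>w. K (z, w) * F w * of_real (exp (- (norm w)\<^sup>2)) \<partial>lborel)"
  proof (rule integral_dominated_convergence[where w="\<lambda>w. norm (K (z, w) * F w * of_real (exp (- (norm w)\<^sup>2)))"])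
    show "integrable lborel (\<lambda>w. norm (K (z, w) * F w * of_real (exp (- (norm w)\<^sup>2))))"
      by (intro integrable_norm intl) measurable
    show "AE w in lborel. (\<lambda>N. K (z, w) * F w * wp N w) \<longlonglongrightarrow> K (z, w) * F w * of_real (exp (- (norm w)\<^sup>2))"
    proof (rule AE_I2)
      fix w :: "complex^'d"
      obtain N0 :: nat where N0: "norm w < real N0" using reals_Archimedean2 by blast
      have "eventually (\<lambda>N. K (z, w) * F w * wp N w = K (z, w) * F w * of_real (exp (- (norm w)\<^sup>2))) sequentially"
        using eventually_ge_at_top[of N0]
      proof eventually_elim
        case (elim N)
        then have "real N0 \<le> real N" by simp
        then have "norm (w $ i) < real N" for i
          using N0 Finite_Cartesian_Product.norm_nth_le[of w i] by linarith
        then have "w \<in> polydisc (real N)" by (simp add: polydisc_def)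
        then show ?case by (simp add: wp_def)
      qed
      then show "(\<lambda>N. K (z, w) * F w * wp N w) \<longlonglongrightarrow> K (z, w) * F w * of_real (exp (- (norm w)\<^sup>2))"
        by (rule tendsto_eventually)
    qed
    show "AE w in lborel. norm (K (z, w) * F w * wp N w) \<le> norm (K (z, w) * F w * of_real (exp (- (norm w)\<^sup>2)))" for N
      by (auto simp: wp_def indicator_def norm_mult)
  qed (auto simp: wp_def)
  from LIMSEQ_unique[OF lim1 this]
  have "(\<Sum>\<^sub>\<infinity>\<beta>. k \<beta> * f \<beta>) * of_real (pi ^ CARD('d)) = (\<integral>w. K (z, w) * F w \<partial>gauss_measure) * of_real (pi ^ CARD('d))"
    by (simp add: intl(2))
  then show ?thesis by (simp add: T)
qed

section \<open>The kernel estimate\<close>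

text \<open>Tested against v(\<xi>), the kernel meets v(\<xi>) g(\<eta>, y), a tensor in (\<xi>, y)
  whose L^q' norm factors. The norm of v comes out as duality requires, and the norm of g(\<eta>, .)
  is left for Hoelder's inequality in \<eta>.\<close>

lemma mixed_norm_integral_operator_le:
  fixes H :: "'x::euclidean_space \<Rightarrow> 'e::euclidean_space \<Rightarrow> 's::euclidean_space \<Rightarrow> 'y::euclidean_space \<Rightarrow> ennreal"
    and g :: "'e \<Rightarrow> 'y \<Rightarrow> ennreal"
  assumes pq: "1 \<le> p" "1 / p + 1 / p' = 1" "1 / q + 1 / q' = 1"
    and H [measurable]: "(\<lambda>(x, \<eta>, \<xi>, y). H x \<eta> \<xi> y) \<in> borel_measurable (lborel \<Otimes>\<^sub>M lborel \<Otimes>\<^sub>M lborel \<Otimes>\<^sub>M lborel)"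
    and g [measurable]: "(\<lambda>(\<eta>, y). g \<eta> y) \<in> borel_measurable (lborel \<Otimes>\<^sub>M lborel)"
  shows "Lnorm lborel p (\<lambda>x. Lnorm lborel q (\<lambda>\<xi>. \<integral>\<^sup>+\<eta>. \<integral>\<^sup>+y. H x \<eta> \<xi> y * g \<eta> y \<partial>lborel \<partial>lborel))
    \<le> Lnorm lborel p (\<lambda>x. Lnorm lborel p (\<lambda>\<eta>. Lnorm (lborel \<Otimes>\<^sub>M lborel) q (\<lambda>(\<xi>, y). H x \<eta> \<xi> y)))
      * Lnorm lborel p' (\<lambda>\<eta>. Lnorm lborel q' (g \<eta>))"
proof -
  define N where "N x \<eta> = Lnorm (lborel \<Otimes>\<^sub>M lborel) q (\<lambda>(\<xi>, y). H x \<eta> \<xi> y)" for x \<eta>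
  define \<gamma> where "\<gamma> \<eta> = Lnorm lborel q' (g \<eta>)" for \<eta>
  have q': "1 \<le> q'" by (rule conjugate_ge_1[OF pq(3)])
  have \<gamma>_meas [measurable]: "\<gamma> \<in> borel_measurable lborel"
    unfolding \<gamma>_def using g by (intro lborel.measurable_Lnorm) (simp add: case_prod_eta)
  have sf: "sigma_finite_measure (lborel \<Otimes>\<^sub>M lborel :: ('s \<times> 'y) measure)"
    unfolding lborel_prod by (rule sigma_finite_lborel)
  have N_meas: "case_prod N \<in> borel_measurable (lborel \<Otimes>\<^sub>M lborel)"
  proof -
    have "(\<lambda>z. Lnorm (lborel \<Otimes>\<^sub>M lborel) q (\<lambda>w. H (fst z) (snd z) (fst w) (snd w))) \<in> borel_measurable (lborel \<Otimes>\<^sub>M lborel)"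
    proof (rule sigma_finite_measure.measurable_Lnorm[OF sf])
      show "(\<lambda>(z, w). H (fst z) (snd z) (fst w) (snd w)) \<in> borel_measurable ((lborel \<Otimes>\<^sub>M lborel) \<Otimes>\<^sub>M lborel \<Otimes>\<^sub>M lborel)"
        using measurable_compose[OF _ H, of "\<lambda>(z, w). (fst z, snd z, fst w, snd w)" "(lborel \<Otimes>\<^sub>M lborel) \<Otimes>\<^sub>M lborel \<Otimes>\<^sub>M lborel"]
        by (simp add: split_beta')
    qed
    then show ?thesis by (simp add: N_def[abs_def] split_beta')
  qed
  have [measurable]: "N x \<in> borel_measurable lborel" for x
    using measurable_compose[OF measurable_Pair1'[of x] N_meas] by simp
  have "Lnorm lborel q (\<lambda>\<xi>. \<integral>\<^sup>+\<eta>. \<integral>\<^sup>+y. H x \<eta> \<xi> y * g \<eta> y \<partial>lborel \<partial>lborel)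
      \<le> Lnorm lborel p (N x) * Lnorm lborel p' \<gamma>" for x
  proof -
    have Hx: "(\<lambda>(\<eta>, \<xi>, y). H x \<eta> \<xi> y) \<in> borel_measurable (lborel \<Otimes>\<^sub>M lborel \<Otimes>\<^sub>M lborel)"
      using measurable_compose[OF measurable_Pair1'[of x] H] by simp
    have [measurable (raw)]: "(\<lambda>w. H x (a w) (b w) (c w)) \<in> borel_measurable M"
      if "a \<in> borel_measurable M" "b \<in> borel_measurable M" "c \<in> borel_measurable M" for a b c and M :: "'m measure"
      using measurable_compose[OF _ Hx, of "\<lambda>w. (a w, b w, c w)" M] that by simp
    have [measurable (raw)]: "(\<lambda>w. g (a w) (c w)) \<in> borel_measurable M"
      if "a \<in> borel_measurable M" "c \<in> borel_measurable M" for a c and M :: "'m measure"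
      using measurable_compose[OF _ g, of "\<lambda>w. (a w, c w)" M] that by simp
    have "Lnorm lborel q (\<lambda>\<xi>. \<integral>\<^sup>+\<eta>. \<integral>\<^sup>+y. H x \<eta> \<xi> y * g \<eta> y \<partial>lborel \<partial>lborel) \<le> (\<integral>\<^sup>+\<eta>. N x \<eta> * \<gamma> \<eta> \<partial>lborel)"
    proof (rule lborel.Lnorm_leI_dual[OF pq(3)])
      show "(\<lambda>\<xi>. \<integral>\<^sup>+\<eta>. \<integral>\<^sup>+y. H x \<eta> \<xi> y * g \<eta> y \<partial>lborel \<partial>lborel) \<in> borel_measurable lborel"
        by measurable
      fix v :: "'s \<Rightarrow> ennreal" assume [measurable]: "v \<in> borel_measurable lborel"
      have "(\<integral>\<^sup>+\<xi>. (\<integral>\<^sup>+\<eta>. \<integral>\<^sup>+y. H x \<eta> \<xi> y * g \<eta> y \<partial>lborel \<partial>lborel) * v \<xi> \<partial>lborel)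
          = (\<integral>\<^sup>+\<xi>. \<integral>\<^sup>+\<eta>. (\<integral>\<^sup>+y. H x \<eta> \<xi> y * (v \<xi> * g \<eta> y) \<partial>lborel) \<partial>lborel \<partial>lborel)"
      proof (rule nn_integral_cong)
        fix \<xi>
        have "(\<integral>\<^sup>+\<eta>. \<integral>\<^sup>+y. H x \<eta> \<xi> y * g \<eta> y \<partial>lborel \<partial>lborel) * v \<xi>
            = (\<integral>\<^sup>+\<eta>. (\<integral>\<^sup>+y. H x \<eta> \<xi> y * g \<eta> y \<partial>lborel) * v \<xi> \<partial>lborel)"
          by (rule nn_integral_multc[symmetric]) measurable
        also have "\<dots> = (\<integral>\<^sup>+\<eta>. (\<integral>\<^sup>+y. H x \<eta> \<xi> y * g \<eta> y * v \<xi> \<partial>lborel) \<partial>lborel)"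
          by (intro nn_integral_cong nn_integral_multc[symmetric]) measurable
        finally show "(\<integral>\<^sup>+\<eta>. \<integral>\<^sup>+y. H x \<eta> \<xi> y * g \<eta> y \<partial>lborel \<partial>lborel) * v \<xi>
            = (\<integral>\<^sup>+\<eta>. (\<integral>\<^sup>+y. H x \<eta> \<xi> y * (v \<xi> * g \<eta> y) \<partial>lborel) \<partial>lborel)"
          by (simp add: mult_ac)
      qed
      also have "\<dots> = (\<integral>\<^sup>+\<eta>. \<integral>\<^sup>+\<xi>. (\<integral>\<^sup>+y. H x \<eta> \<xi> y * (v \<xi> * g \<eta> y) \<partial>lborel) \<partial>lborel \<partial>lborel)"
        by (rule lborel_pair.Fubini') measurable
      also have "\<dots> \<le> (\<integral>\<^sup>+\<eta>. (N x \<eta> * \<gamma> \<eta>) * Lnorm lborel q' v \<partial>lborel)"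
      proof (rule nn_integral_mono)
        fix \<eta>
        have "(\<integral>\<^sup>+\<xi>. (\<integral>\<^sup>+y. H x \<eta> \<xi> y * (v \<xi> * g \<eta> y) \<partial>lborel) \<partial>lborel)
            = (\<integral>\<^sup>+z. (\<lambda>(\<xi>, y). H x \<eta> \<xi> y) z * (\<lambda>(\<xi>, y). v \<xi> * g \<eta> y) z \<partial>(lborel \<Otimes>\<^sub>M lborel))"
          by (subst lborel.nn_integral_fst[symmetric]) (auto simp: split_beta')
        also have "\<dots> \<le> N x \<eta> * Lnorm (lborel \<Otimes>\<^sub>M lborel) q' (\<lambda>(\<xi>, y). v \<xi> * g \<eta> y)"
          unfolding N_def by (rule Hoelder[OF pq(3)]) measurable
        also have "\<dots> \<le> N x \<eta> * (Lnorm lborel q' v * Lnorm lborel q' (g \<eta>))"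
        proof (rule mult_left_mono)
          show "Lnorm (lborel \<Otimes>\<^sub>M lborel) q' (\<lambda>(\<xi>, y). v \<xi> * g \<eta> y) \<le> Lnorm lborel q' v * Lnorm lborel q' (g \<eta>)"
            by (rule lborel_pair.Lnorm_tensor_le[OF q']) measurable
        qed simp
        finally show "(\<integral>\<^sup>+\<xi>. (\<integral>\<^sup>+y. H x \<eta> \<xi> y * (v \<xi> * g \<eta> y) \<partial>lborel) \<partial>lborel)
            \<le> (N x \<eta> * \<gamma> \<eta>) * Lnorm lborel q' v"
          by (simp add: \<gamma>_def mult_ac)
      qed
      also have "\<dots> = (\<integral>\<^sup>+\<eta>. N x \<eta> * \<gamma> \<eta> \<partial>lborel) * Lnorm lborel q' v"
        by (rule nn_integral_multc) measurable
      finally show "(\<integral>\<^sup>+\<xi>. (\<integral>\<^sup>+\<eta>. \<integral>\<^sup>+y. H x \<eta> \<xi> y * g \<eta> y \<partial>lborel \<partial>lborel) * v \<xi> \<partial>lborel)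
          \<le> (\<integral>\<^sup>+\<eta>. N x \<eta> * \<gamma> \<eta> \<partial>lborel) * Lnorm lborel q' v" .
    qed
    also have "\<dots> \<le> Lnorm lborel p (N x) * Lnorm lborel p' \<gamma>"
      by (rule Hoelder[OF pq(2)]) measurable
    finally show ?thesis .
  qed
  then have "Lnorm lborel p (\<lambda>x. Lnorm lborel q (\<lambda>\<xi>. \<integral>\<^sup>+\<eta>. \<integral>\<^sup>+y. H x \<eta> \<xi> y * g \<eta> y \<partial>lborel \<partial>lborel))
      \<le> Lnorm lborel p (\<lambda>x. Lnorm lborel p' \<gamma> * Lnorm lborel p (N x))"
    by (intro Lnorm_mono) (simp add: mult.commute)
  also have "\<dots> \<le> Lnorm lborel p' \<gamma> * Lnorm lborel p (\<lambda>x. Lnorm lborel p (N x))"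
    by (intro Lnorm_cmult_le pq(1) lborel.measurable_Lnorm N_meas)
  finally show ?thesis by (simp add: N_def[abs_def] \<gamma>_def[abs_def] mult.commute)
qed

section \<open>Changes of variables between real pairs and C^d\<close>

lemma nn_integral_lborel_reflect:
  fixes c :: "'a::euclidean_space"
  assumes [measurable]: "f \<in> borel_measurable borel"
  shows "(\<integral>\<^sup>+ x. f (c - x) \<partial>lborel) = (\<integral>\<^sup>+ x. f x \<partial>lborel)"
  by (subst (2) lborel_affine[of "-1" c]) (simp_all add: nn_integral_density nn_integral_distr)

text \<open>C^d has real dimension 2 d, so division by sqrt 2 has the Jacobian (1 / sqrt 2)^(2 d) =
  2^(-d).\<close>

lemma nn_integral_lborel_scale:
  fixes f :: "complex^'d \<Rightarrow> ennreal"
  assumes [measurable]: "f \<in> borel_measurable borel"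
  shows "(\<integral>\<^sup>+ w. f ((1 / sqrt 2) *\<^sub>R w) \<partial>lborel) = ennreal (2 ^ CARD('d)) * (\<integral>\<^sup>+ w. f w \<partial>lborel)"
proof -
  have "(1 / sqrt 2) ^ DIM(complex^'d) = ((1 / sqrt 2)\<^sup>2) ^ CARD('d)"
    by (simp add: power_mult[symmetric] mult.commute)
  also have "\<dots> = 1 / 2 ^ CARD('d)" by (simp add: power_divide)
  finally have p: "(1 / sqrt 2) ^ DIM(complex^'d) = 1 / 2 ^ CARD('d)" .
  have "(\<integral>\<^sup>+ w. f w \<partial>lborel) = ennreal (1 / 2 ^ CARD('d)) * (\<integral>\<^sup>+ w. f ((1 / sqrt 2) *\<^sub>R w) \<partial>lborel)"
    by (subst lborel_affine[of "1 / sqrt 2" 0])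
      (simp_all add: nn_integral_density nn_integral_distr nn_integral_cmult p del: DIM_cart)
  then have e: "(\<integral>\<^sup>+ w. f w \<partial>lborel) = ennreal (1 / 2 ^ CARD('d)) * (\<integral>\<^sup>+ w. f ((1 / sqrt 2) *\<^sub>R w) \<partial>lborel)" .
  have c: "ennreal (2 ^ CARD('d)) * ennreal (1 / 2 ^ CARD('d)) = 1"
    by (simp flip: ennreal_mult')
  show ?thesis unfolding e mult.assoc[symmetric] c by simp
qed

lemma nn_integral_cvec:
  fixes f :: "complex^'d \<Rightarrow> ennreal"
  assumes [measurable]: "f \<in> borel_measurable borel"
  shows "(\<integral>\<^sup>+ x. \<integral>\<^sup>+ y. f (cvec x y) \<partial>lborel \<partial>lborel) = (\<integral>\<^sup>+ z. f z \<partial>lborel)"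
proof -
  have "(\<integral>\<^sup>+ z. f z \<partial>lborel) = (\<integral>\<^sup>+ p. f (cvec (fst p) (snd p)) \<partial>(lborel \<Otimes>\<^sub>M lborel))"
    by (subst lborel_cvec[symmetric], subst nn_integral_distr) (auto simp: split_beta')
  also have "\<dots> = (\<integral>\<^sup>+ x. \<integral>\<^sup>+ y. f (cvec x y) \<partial>lborel \<partial>lborel)"
    by (subst lborel.nn_integral_fst[symmetric]) auto
  finally show ?thesis ..
qed

lemma nn_integral_cvec_reflect:
  fixes f :: "complex^'d \<Rightarrow> ennreal"
  assumes [measurable]: "f \<in> borel_measurable borel"
  shows "(\<integral>\<^sup>+ x. \<integral>\<^sup>+ y. f ((1 / sqrt 2) *\<^sub>R cvec x (- y)) \<partial>lborel \<partial>lborel)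
    = ennreal (2 ^ CARD('d)) * (\<integral>\<^sup>+ z. f z \<partial>lborel)"
proof -
  have "(\<integral>\<^sup>+ x. \<integral>\<^sup>+ y. f ((1 / sqrt 2) *\<^sub>R cvec x (- y)) \<partial>lborel \<partial>lborel)
      = (\<integral>\<^sup>+ x. \<integral>\<^sup>+ y. f ((1 / sqrt 2) *\<^sub>R cvec x y) \<partial>lborel \<partial>lborel)"
    using nn_integral_lborel_reflect[of "\<lambda>y. f ((1 / sqrt 2) *\<^sub>R cvec x y)" 0 for x]
    by (rule_tac nn_integral_cong) simp
  also have "\<dots> = (\<integral>\<^sup>+ z. f ((1 / sqrt 2) *\<^sub>R z) \<partial>lborel)"
    by (rule nn_integral_cvec[of "\<lambda>z. f ((1 / sqrt 2) *\<^sub>R z)"]) measurable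
  finally show ?thesis by (simp add: nn_integral_lborel_scale)
qed

lemma nn_integral_cvec_shift:
  fixes f :: "complex^'d \<Rightarrow> ennreal"
  assumes [measurable]: "f \<in> borel_measurable borel"
  shows "(\<integral>\<^sup>+ \<xi>. \<integral>\<^sup>+ y. f ((1 / sqrt 2) *\<^sub>R cvec (y - x) (\<eta> - \<xi>)) \<partial>lborel \<partial>lborel)
    = ennreal (2 ^ CARD('d)) * (\<integral>\<^sup>+ z. f z \<partial>lborel)"
proof -
  have "(\<integral>\<^sup>+ \<xi>. \<integral>\<^sup>+ y. f ((1 / sqrt 2) *\<^sub>R cvec (y - x) (\<eta> - \<xi>)) \<partial>lborel \<partial>lborel)
      = (\<integral>\<^sup>+ \<xi>. \<integral>\<^sup>+ y. f ((1 / sqrt 2) *\<^sub>R cvec y (\<eta> - \<xi>)) \<partial>lborel \<partial>lborel)"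
    using nn_integral_lborel_translate[of "\<lambda>y. f ((1 / sqrt 2) *\<^sub>R cvec y (\<eta> - \<xi>))" "- x" for \<xi>]
    by (rule_tac nn_integral_cong) simp
  also have "\<dots> = (\<integral>\<^sup>+ \<xi>. \<integral>\<^sup>+ y. f ((1 / sqrt 2) *\<^sub>R cvec y \<xi>) \<partial>lborel \<partial>lborel)"
    by (rule nn_integral_lborel_reflect[of "\<lambda>\<xi>. \<integral>\<^sup>+ y. f ((1 / sqrt 2) *\<^sub>R cvec y \<xi>) \<partial>lborel"]) measurable
  also have "\<dots> = (\<integral>\<^sup>+ y. \<integral>\<^sup>+ \<xi>. f ((1 / sqrt 2) *\<^sub>R cvec y \<xi>) \<partial>lborel \<partial>lborel)"
    by (rule lborel_pair.Fubini') measurable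
  also have "\<dots> = (\<integral>\<^sup>+ z. f ((1 / sqrt 2) *\<^sub>R z) \<partial>lborel)"
    by (rule nn_integral_cvec[of "\<lambda>z. f ((1 / sqrt 2) *\<^sub>R z)"]) measurable
  finally show ?thesis by (simp add: nn_integral_lborel_scale)
qed

text \<open>The integral identity for all Borel f says that T carries the product measure to c times
  Lebesgue measure.\<close>

lemma Lnorm_pair_subst_le:
  fixes T :: "'a::euclidean_space \<times> 'b::euclidean_space \<Rightarrow> 'c::euclidean_space"
  assumes "1 \<le> p" "1 \<le> c" and [measurable]: "T \<in> borel_measurable (lborel \<Otimes>\<^sub>M lborel)" "f \<in> borel_measurable borel"
    and T: "\<And>f. f \<in> borel_measurable borel \<Longrightarrow>
      (\<integral>\<^sup>+ x. \<integral>\<^sup>+ y. f (T (x, y)) \<partial>lborel \<partial>lborel) = ennreal c * (\<integral>\<^sup>+ z. f z \<partial>lborel)"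
  shows "Lnorm (lborel \<Otimes>\<^sub>M lborel) p (\<lambda>z. f (T z)) \<le> ennreal c * Lnorm lborel p f"
proof (rule Lnorm_density_const_le[OF assms(1), of c c])
  show "distr (lborel \<Otimes>\<^sub>M lborel) lborel T = density lborel (\<lambda>_. ennreal c)"
  proof (rule measure_eqI)
    fix A assume "A \<in> sets (distr (lborel \<Otimes>\<^sub>M lborel) lborel T)"
    then have [measurable]: "A \<in> sets borel" by simp
    have "emeasure (distr (lborel \<Otimes>\<^sub>M lborel) lborel T) A
        = (\<integral>\<^sup>+ z. indicator A z \<partial>distr (lborel \<Otimes>\<^sub>M lborel) lborel T)" by simp
    also have "\<dots> = (\<integral>\<^sup>+ z. indicator A (T z) \<partial>(lborel \<Otimes>\<^sub>M lborel))"
      by (rule nn_integral_distr) measurable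
    also have "\<dots> = (\<integral>\<^sup>+ x. \<integral>\<^sup>+ y. indicator A (T (x, y)) \<partial>lborel \<partial>lborel)"
      by (rule lborel.nn_integral_fst[symmetric]) measurable
    also have "\<dots> = ennreal c * emeasure lborel A"
      by (subst T) auto
    also have "\<dots> = emeasure (density lborel (\<lambda>_. ennreal c)) A"
      by (simp add: emeasure_density_const)
    finally show "emeasure (distr (lborel \<Otimes>\<^sub>M lborel) lborel T) A = emeasure (density lborel (\<lambda>_. ennreal c)) A" .
  qed simp
qed (use assms in auto)

text \<open>The factor 4^d is 2^d twice: once from (\<xi>, y) to the second argument of G at fixed x
  and \<eta>, once from (x, \<eta>) to its first argument.\<close>

lemma kernel_estimate:
  fixes G :: "(complex^'d) \<times> (complex^'d) \<Rightarrow> ennreal" and g :: "real^'d \<Rightarrow> real^'d \<Rightarrow> ennreal"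
  assumes pq: "1 \<le> p" "1 \<le> q" "1 / p + 1 / p' = 1" "1 / q + 1 / q' = 1"
    and G [measurable]: "G \<in> borel_measurable (lborel \<Otimes>\<^sub>M lborel)"
    and g [measurable]: "(\<lambda>(\<eta>, y). g \<eta> y) \<in> borel_measurable (lborel \<Otimes>\<^sub>M lborel)"
  shows "Lnorm lborel p (\<lambda>x. Lnorm lborel q (\<lambda>\<xi>. \<integral>\<^sup>+\<eta>. \<integral>\<^sup>+y.
        G ((1 / sqrt 2) *\<^sub>R cvec x (- \<eta>), (1 / sqrt 2) *\<^sub>R cvec (y - x) (\<eta> - \<xi>)) * g \<eta> y \<partial>lborel \<partial>lborel))
    \<le> ennreal (4 ^ CARD('d)) * Lnorm lborel p (\<lambda>z. Lnorm lborel q (\<lambda>w. G (z, w)))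
      * Lnorm lborel p' (\<lambda>\<eta>. Lnorm lborel q' (g \<eta>))"
proof -
  define H where "H x \<eta> \<xi> y = G ((1 / sqrt 2) *\<^sub>R cvec x (- \<eta>), (1 / sqrt 2) *\<^sub>R cvec (y - x) (\<eta> - \<xi>))"
    for x \<eta> \<xi> y :: "real^'d"
  define M where "M z = Lnorm lborel q (\<lambda>w. G (z, w))" for z
  have M_meas [measurable]: "M \<in> borel_measurable borel"
    using lborel.measurable_Lnorm[of "\<lambda>z w. G (z, w)" lborel q] by (simp add: M_def[abs_def])
  have two: "(1::real) \<le> 2 ^ CARD('d)" by simp
  have "Lnorm (lborel \<Otimes>\<^sub>M lborel) q (\<lambda>(\<xi>, y). H x \<eta> \<xi> y)
      \<le> ennreal (2 ^ CARD('d)) * M ((1 / sqrt 2) *\<^sub>R cvec x (- \<eta>))" for x \<eta>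
    using Lnorm_pair_subst_le[OF pq(2) two, of "\<lambda>(\<xi>, y). (1 / sqrt 2) *\<^sub>R cvec (y - x) (\<eta> - \<xi>)"
        "\<lambda>w. G ((1 / sqrt 2) *\<^sub>R cvec x (- \<eta>), w)"]
    by (simp add: H_def M_def split_beta' nn_integral_cvec_shift)
  then have "Lnorm lborel p (\<lambda>x. Lnorm lborel p (\<lambda>\<eta>. Lnorm (lborel \<Otimes>\<^sub>M lborel) q (\<lambda>(\<xi>, y). H x \<eta> \<xi> y)))
      \<le> Lnorm lborel p (\<lambda>x. Lnorm lborel p (\<lambda>\<eta>. ennreal (2 ^ CARD('d)) * M ((1 / sqrt 2) *\<^sub>R cvec x (- \<eta>))))"
    by (intro Lnorm_mono)
  also have "\<dots> \<le> Lnorm (lborel \<Otimes>\<^sub>M lborel) p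
      (\<lambda>z. ennreal (2 ^ CARD('d)) * M ((1 / sqrt 2) *\<^sub>R cvec (fst z) (- snd z)))"
    using lborel_pair.Lnorm_iterated_le[OF pq(1),
        of "\<lambda>z. ennreal (2 ^ CARD('d)) * M ((1 / sqrt 2) *\<^sub>R cvec (fst z) (- snd z))"] by simp
  also have "\<dots> \<le> ennreal (2 ^ CARD('d)) * Lnorm (lborel \<Otimes>\<^sub>M lborel) p
      (\<lambda>z. M ((1 / sqrt 2) *\<^sub>R cvec (fst z) (- snd z)))"
    by (rule Lnorm_cmult_le[OF pq(1)]) measurable
  also have "\<dots> \<le> ennreal (2 ^ CARD('d)) * (ennreal (2 ^ CARD('d)) * Lnorm lborel p M)"
    using Lnorm_pair_subst_le[OF pq(1) two, of "\<lambda>z. (1 / sqrt 2) *\<^sub>R cvec (fst z) (- snd z)" M]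
    by (intro mult_left_mono) (simp_all add: nn_integral_cvec_reflect)
  also have "\<dots> = ennreal (4 ^ CARD('d)) * Lnorm lborel p M"
    by (simp add: mult.assoc[symmetric] ennreal_mult'[symmetric] power_mult_distrib[symmetric])
  finally have *: "Lnorm lborel p (\<lambda>x. Lnorm lborel p (\<lambda>\<eta>. Lnorm (lborel \<Otimes>\<^sub>M lborel) q (\<lambda>(\<xi>, y). H x \<eta> \<xi> y)))
      \<le> ennreal (4 ^ CARD('d)) * Lnorm lborel p M" .
  have "(\<lambda>(x, \<eta>, \<xi>, y). H x \<eta> \<xi> y) \<in> borel_measurable (lborel \<Otimes>\<^sub>M lborel \<Otimes>\<^sub>M lborel \<Otimes>\<^sub>M lborel)"
    unfolding H_def split_beta' by (rule measurable_compose[OF _ G]) measurable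
  from mixed_norm_integral_operator_le[OF pq(1,3,4) this g]
  have "Lnorm lborel p (\<lambda>x. Lnorm lborel q (\<lambda>\<xi>. \<integral>\<^sup>+\<eta>. \<integral>\<^sup>+y. H x \<eta> \<xi> y * g \<eta> y \<partial>lborel \<partial>lborel))
    \<le> Lnorm lborel p (\<lambda>x. Lnorm lborel p (\<lambda>\<eta>. Lnorm (lborel \<Otimes>\<^sub>M lborel) q (\<lambda>(\<xi>, y). H x \<eta> \<xi> y)))
      * Lnorm lborel p' (\<lambda>\<eta>. Lnorm lborel q' (g \<eta>))" .
  also have "\<dots> \<le> (ennreal (4 ^ CARD('d)) * Lnorm lborel p M) * Lnorm lborel p' (\<lambda>\<eta>. Lnorm lborel q' (g \<eta>))"
    by (rule mult_right_mono[OF *]) simp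
  finally show ?thesis by (simp add: H_def M_def[abs_def])
qed

section \<open>Entire functions given by integrals\<close>

text \<open>Cauchy's estimates on the unit disc bound every Taylor coefficient at 0 by M. For |t|
  \<le> 1/2 the terms of order at least 2 sum to at most M |t|^2 (1 + 1/2 + 1/4 + ...) = 2 M
  |t|^2.\<close>

lemma holomorphic_quadratic_remainder:
  fixes \<phi> :: "complex \<Rightarrow> complex"
  assumes hol: "\<phi> holomorphic_on UNIV" and M: "\<And>t. norm t \<le> 1 \<Longrightarrow> norm (\<phi> t) \<le> M"
  shows "norm (deriv \<phi> 0) \<le> M"
    and "norm t \<le> 1 / 2 \<Longrightarrow> norm (\<phi> t - \<phi> 0 - deriv \<phi> 0 * t) \<le> 2 * M * (norm t)\<^sup>2"
proof -
  define a where "a n = (deriv ^^ n) \<phi> 0 / fact n" for n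
  have a: "norm (a n) \<le> M" for n
  proof -
    have "norm ((deriv ^^ n) \<phi> 0) \<le> fact n * M / 1 ^ n"
      by (intro Cauchy_inequality holomorphic_on_imp_continuous_on holomorphic_on_subset[OF hol] M) auto
    then show ?thesis by (simp add: a_def norm_divide field_simps)
  qed
  from a[of 1] show "norm (deriv \<phi> 0) \<le> M" by (simp add: a_def)
  assume t: "norm t \<le> 1 / 2"
  have "(\<lambda>n. a n * t ^ n) sums \<phi> t"
    using holomorphic_power_series[OF holomorphic_on_subset[OF hol subset_UNIV], of t 0 "norm t + 1"]
    by (simp add: a_def)
  then have "(\<lambda>n. a (n + 2) * t ^ (n + 2)) sums (\<phi> t - (\<Sum>i<2. a i * t ^ i))"
    using sums_split_initial_segment by blast
  then have s: "(\<lambda>n. a (n + 2) * t ^ (n + 2)) sums (\<phi> t - \<phi> 0 - deriv \<phi> 0 * t)"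
    by (simp add: numeral_2_eq_2 a_def algebra_simps)
  have M0: "0 \<le> M" using a[of 0] norm_ge_zero order_trans by blast
  have g: "(\<lambda>n. (M * (norm t)\<^sup>2) * (1 / 2) ^ n) sums ((M * (norm t)\<^sup>2) * 2)"
    using sums_mult[OF geometric_sums[of "1 / 2 :: real"], of "M * (norm t)\<^sup>2"] by simp
  have le: "norm (a (n + 2) * t ^ (n + 2)) \<le> (M * (norm t)\<^sup>2) * (1 / 2) ^ n" for n
  proof -
    have "norm (a (n + 2) * t ^ (n + 2)) = norm (a (n + 2)) * (norm t)\<^sup>2 * norm t ^ n"
      by (simp add: norm_mult norm_power power_add mult_ac power2_eq_square)
    also have "\<dots> \<le> M * (norm t)\<^sup>2 * (1 / 2) ^ n"
      using t M0 by (intro mult_mono a power_mono) auto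
    finally show ?thesis .
  qed
  have "norm (\<Sum>n. a (n + 2) * t ^ (n + 2)) \<le> (\<Sum>n. (M * (norm t)\<^sup>2) * (1 / 2) ^ n)"
    by (rule norm_suminf_le) (use le sums_summable[OF g] in auto)
  then show "norm (\<phi> t - \<phi> 0 - deriv \<phi> 0 * t) \<le> 2 * M * (norm t)\<^sup>2"
    using s g by (simp add: sums_iff mult_ac)
qed

text \<open>f is restricted to the complex line through z in the direction of h. The direction is
  normalized to a unit vector, so the unit disc of the line stays in the polydisc on which M is a
  bound.\<close>

lemma entire_wrt_quadratic_remainder:
  fixes f :: "complex^'d \<Rightarrow> complex"
  assumes f: "entire_wrt (*s) f" and D: "(f has_derivative D) (at z)" "\<And>c v. D (c *s v) = c * D v"
    and M: "\<And>h. (\<forall>i. norm (h $ i) \<le> 1) \<Longrightarrow> norm (f (z + h)) \<le> M"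
  shows "norm (D h) \<le> M * norm h"
    and "norm h \<le> 1 / 2 \<Longrightarrow> norm (f (z + h) - f z - D h) \<le> 2 * M * (norm h)\<^sup>2"
proof -
  have "norm (D h) \<le> M * norm h \<and> (norm h \<le> 1 / 2 \<longrightarrow> norm (f (z + h) - f z - D h) \<le> 2 * M * (norm h)\<^sup>2)"
  proof (cases "h = 0")
    case True
    have "D 0 = 0" using D(2)[of 0 0] by simp
    then show ?thesis using True by simp
  next
    case False
    define u where "u = (1 / norm h) *\<^sub>R h"
    have u: "norm u = 1" using False by (simp add: u_def)
    have hu: "h = complex_of_real (norm h) *s u"
    proof -
      have "complex_of_real (norm h) * ((1 / norm h) *\<^sub>R x) = x" for x
        using False by (simp add: scaleR_conv_of_real)
      then show ?thesis by (simp add: u_def vec_eq_iff del: scaleR_eq_iff)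
    qed
    define \<phi> where "\<phi> t = f (z + t *s u)" for t
    have der: "(\<phi> has_field_derivative F' u) (at t)"
      if "(f has_derivative F') (at (z + t *s u))" "\<And>c v. F' (c *s v) = c * F' v" for F' t
    proof -
      have bl: "bounded_linear (\<lambda>t :: complex. t *s u)"
        by (intro linear_conv_bounded_linear[THEN iffD1] linearI)
          (auto simp: vec_eq_iff distrib_right)
      have "((\<lambda>t. z + t *s u) has_derivative (\<lambda>t. t *s u)) (at t)"
        by (auto intro!: derivative_eq_intros bounded_linear_imp_has_derivative bl)
      from diff_chain_at[OF this that(1)]
      have "(\<phi> has_derivative (\<lambda>t. F' (t *s u))) (at t)" by (simp add: o_def \<phi>_def[abs_def])
      moreover have "(\<lambda>t. F' (t *s u)) = (*) (F' u)" by (simp add: that(2) fun_eq_iff mult.commute)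
      ultimately show ?thesis by (simp add: has_field_derivative_def)
    qed
    have hol: "\<phi> holomorphic_on UNIV"
      unfolding holomorphic_on_def field_differentiable_def
    proof
      fix t
      obtain F' where "(f has_derivative F') (at (z + t *s u))" "\<And>c v. F' (c *s v) = c * F' v"
        using f unfolding entire_wrt_def by blast
      from der[OF this] show "\<exists>d. (\<phi> has_field_derivative d) (at t within UNIV)" by blast
    qed
    have "(\<phi> has_field_derivative D u) (at 0)" by (rule der) (simp_all add: D)
    then have d0: "deriv \<phi> 0 = D u" by (rule DERIV_imp_deriv)
    have bd: "norm (\<phi> t) \<le> M" if "norm t \<le> 1" for t
      unfolding \<phi>_def
    proof (intro M allI)
      fix i
      have "norm t * norm (u $ i) \<le> 1 * 1"
        using that Finite_Cartesian_Product.norm_nth_le[of u i] u by (intro mult_mono) auto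
      then show "norm ((t *s u) $ i) \<le> 1" by (simp add: norm_mult)
    qed
    have Dh: "D h = deriv \<phi> 0 * of_real (norm h)"
      by (subst hu) (simp add: D(2) d0 mult.commute)
    have "norm (D h) \<le> M * norm h"
      unfolding Dh using holomorphic_quadratic_remainder(1)[OF hol bd] by (simp add: norm_mult mult_right_mono)
    moreover have "norm (f (z + h) - f z - D h) \<le> 2 * M * (norm h)\<^sup>2" if "norm h \<le> 1 / 2"
    proof -
      have "\<phi> (of_real (norm h)) = f (z + h)" "\<phi> 0 = f z"
        using hu by (simp_all add: \<phi>_def)
      then show ?thesis
        using holomorphic_quadratic_remainder(2)[OF hol bd, of "of_real (norm h)"] that by (simp add: Dh)
    qed
    ultimately show ?thesis by blast
  qed
  then show "norm (D h) \<le> M * norm h"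
    and "norm h \<le> 1 / 2 \<Longrightarrow> norm (f (z + h) - f z - D h) \<le> 2 * M * (norm h)\<^sup>2"
    by auto
qed

lemma norm_integral_le:
  fixes f :: "'w \<Rightarrow> complex"
  assumes "integrable \<mu> f" "integrable \<mu> g" "\<And>w. norm (f w) \<le> g w"
  shows "norm (\<integral>w. f w \<partial>\<mu>) \<le> (\<integral>w. g w \<partial>\<mu>)"
proof -
  have "norm (\<integral>w. f w \<partial>\<mu>) \<le> (\<integral>w. norm (f w) \<partial>\<mu>)" by (rule Bochner_Integration.integral_norm_bound)
  also have "\<dots> \<le> (\<integral>w. g w \<partial>\<mu>)"
    using assms by (intro Bochner_Integration.integral_mono integrable_norm)
  finally show ?thesis .
qed

text \<open>A majorant on the unit polydisc around z bounds the derivative of k(., w) by M(w) |h|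
  and its remainder by 2 M(w) |h|^2. Both are integrable against |g|, so differentiation passes
  under the integral.\<close>

lemma entire_wrt_integral:
  fixes k :: "complex^'d \<Rightarrow> 'w \<Rightarrow> complex"
  assumes entire: "\<And>w. entire_wrt (*s) (\<lambda>z. k z w)"
    and [measurable]: "\<And>z. k z \<in> borel_measurable \<mu>" "g \<in> borel_measurable \<mu>"
    and dom: "\<And>z. \<exists>M. M \<in> borel_measurable \<mu> \<and> integrable \<mu> (\<lambda>w. M w * norm (g w)) \<and>
      (\<forall>w h. (\<forall>i. norm (h $ i) \<le> 1) \<longrightarrow> norm (k (z + h) w) \<le> M w)"
  shows "entire_wrt (*s) (\<lambda>z. \<integral>w. k z w * g w \<partial>\<mu>)"
  unfolding entire_wrt_def
proof
  fix z
  obtain M where [measurable]: "M \<in> borel_measurable \<mu>"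
    and Mint: "integrable \<mu> (\<lambda>w. M w * norm (g w))"
    and M: "\<And>w h. (\<forall>i. norm (h $ i) \<le> 1) \<Longrightarrow> norm (k (z + h) w) \<le> M w"
    using dom[of z] by blast
  have "\<forall>w. \<exists>D. ((\<lambda>z. k z w) has_derivative D) (at z) \<and> (\<forall>c v. D (c *s v) = c * D v)"
    using entire unfolding entire_wrt_def by blast
  from choice[OF this] obtain D
    where D': "\<forall>w. ((\<lambda>z. k z w) has_derivative D w) (at z) \<and> (\<forall>c v. D w (c *s v) = c * D w v)" by (elim exE)
  then have D: "((\<lambda>z. k z w) has_derivative D w) (at z)" "D w (c *s v) = c * D w v" for w c v
    by blast+
  have bound: "norm (D w h) \<le> M w * norm h" for w h
    by (rule entire_wrt_quadratic_remainder(1)[OF entire D M])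
  have rem: "norm (k (z + h) w - k z w - D w h) \<le> 2 * M w * (norm h)\<^sup>2" if "norm h \<le> 1 / 2" for w h
    using that by (intro entire_wrt_quadratic_remainder(2)[OF entire D M])
  have M0: "0 \<le> M w" for w using order_trans[OF norm_ge_zero M[of 0 w]] by simp
  have lin: "linear (D w)" for w using D(1) by (rule has_derivative_linear)
  \<comment> \<open>The derivative was chosen separately for each w. Measurability in w is recovered
    by writing \<open>D w h\<close> as the limit of difference quotients with step 1 / (n +
    1).\<close>
  have [measurable]: "(\<lambda>w. D w h) \<in> borel_measurable \<mu>" for h
  proof (rule borel_measurable_LIMSEQ_metric)
    fix w
    let ?q = "\<lambda>n. of_real (Suc n) * (k (z + (1 / Suc n) *\<^sub>R h) w - k z w)"
    have "(\<lambda>n. ?q n - D w h) \<longlonglongrightarrow> 0"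
    proof (rule Lim_null_comparison)
      obtain N :: nat where N: "2 * norm h \<le> real N" using real_arch_simple by blast
      show "\<forall>\<^sub>F n in sequentially. norm (?q n - D w h) \<le> 2 * M w * (norm h)\<^sup>2 * (1 / Suc n)"
        using eventually_ge_at_top[of N]
      proof eventually_elim
        case (elim n)
        let ?h = "(1 / Suc n) *\<^sub>R h"
        have "norm ?h \<le> 1 / 2" using elim N by (simp add: field_simps)
        from rem[OF this] have "norm (k (z + ?h) w - k z w - D w ?h) \<le> 2 * M w * (norm ?h)\<^sup>2" .
        then have "real (Suc n) * norm (k (z + ?h) w - k z w - D w ?h) \<le> real (Suc n) * (2 * M w * (norm ?h)\<^sup>2)"
          by (intro mult_left_mono) auto
        also have "\<dots> = 2 * M w * (norm h)\<^sup>2 * (1 / Suc n)"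
          by (simp add: power_divide power2_eq_square)
        also have "D w ?h = of_real (1 / Suc n) * D w h"
          by (subst linear_scale[OF lin]) (rule scaleR_conv_of_real)
        also have "real (Suc n) * norm (k (z + ?h) w - k z w - of_real (1 / Suc n) * D w h)
            = norm (of_real (Suc n) * (k (z + ?h) w - k z w - of_real (1 / Suc n) * D w h))"
          by (simp only: norm_mult norm_of_real abs_of_nat)
        also have "of_real (Suc n) * (k (z + ?h) w - k z w - of_real (1 / Suc n) * D w h) = ?q n - D w h"
          by (simp add: right_diff_distrib del: of_nat_Suc)
        finally show ?case .
      qed
      show "(\<lambda>n. 2 * M w * (norm h)\<^sup>2 * (1 / Suc n)) \<longlonglongrightarrow> 0"
        by (rule tendsto_mult_right_zero) (rule LIMSEQ_inverse_real_of_nat[unfolded inverse_eq_divide])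
    qed
    then show "?q \<longlonglongrightarrow> D w h" by (simp add: LIM_zero_iff)
  qed measurable
  have dint: "integrable \<mu> (\<lambda>w. D w h * g w)" for h
  proof (rule Bochner_Integration.integrable_bound[OF integrable_mult_left[OF Mint, of "norm h"]])
    show "AE w in \<mu>. norm (D w h * g w) \<le> norm (M w * norm (g w) * norm h)"
    proof (rule AE_I2)
      fix w show "norm (D w h * g w) \<le> norm (M w * norm (g w) * norm h)"
        using mult_right_mono[OF bound[of w h] norm_ge_zero[of "g w"]] M0[of w]
        by (simp add: norm_mult mult_ac abs_mult)
    qed
  qed measurable
  have kint: "integrable \<mu> (\<lambda>w. k (z + h) w * g w)" if "\<forall>i. norm (h $ i) \<le> 1" for h
  proof (rule Bochner_Integration.integrable_bound[OF Mint])
    show "AE w in \<mu>. norm (k (z + h) w * g w) \<le> norm (M w * norm (g w))"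
      using M[OF that] M0 by (intro AE_I2) (simp add: norm_mult abs_mult mult_right_mono)
  qed measurable
  define L where "L h = (\<integral>w. D w h * g w \<partial>\<mu>)" for h
  define C where "C = (\<integral>w. M w * norm (g w) \<partial>\<mu>)"
  have L_le: "norm (L h) \<le> norm h * C" for h
  proof -
    have "norm (L h) \<le> (\<integral>w. norm h * (M w * norm (g w)) \<partial>\<mu>)"
      unfolding L_def
    proof (rule norm_integral_le[OF dint])
      show "norm (D w h * g w) \<le> norm h * (M w * norm (g w))" for w
        using mult_right_mono[OF bound[of w h] norm_ge_zero[of "g w"]] by (simp add: norm_mult mult_ac)
    qed (intro integrable_mult_right Mint)
    then show ?thesis by (simp add: C_def)
  qed
  have "((\<lambda>z. \<integral>w. k z w * g w \<partial>\<mu>) has_derivative L) (at z)"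
  proof (rule has_derivativeI_sandwich[of "1 / 2"])
    show "bounded_linear L"
    proof (rule bounded_linear_intro[OF _ _ L_le])
      show "L (x + y) = L x + L y" for x y
        by (simp add: L_def linear_add[OF lin] distrib_right Bochner_Integration.integral_add[OF dint dint])
      show "L (r *\<^sub>R x) = r *\<^sub>R L x" for r x
        by (simp add: L_def linear_scale[OF lin])
    qed
    show "((\<lambda>y. 2 * C * norm (y - z)) \<longlongrightarrow> 0) (at z)"
    proof -
      have "((\<lambda>y. 2 * C * norm (y - z)) \<longlongrightarrow> 2 * C * norm (z - z)) (at z)"
        by (intro tendsto_intros)
      then show ?thesis by simp
    qed
    fix y assume y: "y \<noteq> z" "dist y z < 1 / 2"
    define h where "h = y - z"
    have h: "y = z + h" "norm h \<le> 1 / 2" "h \<noteq> 0" using y by (auto simp: h_def dist_norm)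
    have h1: "\<forall>i. norm (h $ i) \<le> 1"
    proof
      fix i show "norm (h $ i) \<le> 1"
        using h(2) Finite_Cartesian_Product.norm_nth_le[of h i] by linarith
    qed
    have k0: "integrable \<mu> (\<lambda>w. k z w * g w)" using kint[of 0] by simp
    have "(\<integral>w. k y w * g w \<partial>\<mu>) - (\<integral>w. k z w * g w \<partial>\<mu>) - L (y - z)
        = (\<integral>w. (k (z + h) w - k z w - D w h) * g w \<partial>\<mu>)"
      unfolding h(1) L_def using kint[OF h1] k0 dint[of h]
      by (simp add: left_diff_distrib Bochner_Integration.integral_diff integrable_diff)
    also have "norm \<dots> \<le> (\<integral>w. (2 * (norm h)\<^sup>2) * (M w * norm (g w)) \<partial>\<mu>)"
    proof (rule norm_integral_le)
      show "integrable \<mu> (\<lambda>w. (k (z + h) w - k z w - D w h) * g w)"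
        using kint[OF h1] k0 dint[of h] by (simp add: left_diff_distrib)
      show "norm ((k (z + h) w - k z w - D w h) * g w) \<le> (2 * (norm h)\<^sup>2) * (M w * norm (g w))" for w
        using mult_right_mono[OF rem[OF h(2), of w] norm_ge_zero[of "g w"]] by (simp add: norm_mult mult_ac)
    qed (intro integrable_mult_right Mint)
    also have "\<dots> = (2 * C * norm h) * norm h" by (simp add: C_def power2_eq_square)
    finally have n: "norm ((\<integral>w. k y w * g w \<partial>\<mu>) - (\<integral>w. k z w * g w \<partial>\<mu>) - L (y - z)) \<le> 2 * C * norm h * norm h" .
    have yz: "norm (y - z) = norm h" "norm h \<noteq> 0" using h(3) by (simp_all add: h_def)
    show "norm ((\<integral>w. k y w * g w \<partial>\<mu>) - (\<integral>w. k z w * g w \<partial>\<mu>) - L (y - z)) / norm (y - z) \<le> 2 * C * norm (y - z)"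
      unfolding yz(1) using divide_right_mono[OF n norm_ge_zero[of h]] yz(2) by simp
  qed simp
  moreover have "L (c *s v) = c * L v" for c v
    by (simp add: L_def D(2) mult.assoc)
  ultimately show "\<exists>F'. ((\<lambda>z. \<integral>w. k z w * g w \<partial>\<mu>) has_derivative F') (at z) \<and> (\<forall>c v. F' (c *s v) = c * F' v)"
    by blast
qed

section \<open>Kernels with \<open>G\<^sub>K\<close> in the mixed norm space\<close>

text \<open>The preimage of a Lebesgue null set under a Borel map need not be measurable; for a map
  preserving Lebesgue measure it is again null.\<close>

lemma lebesgue_measurable_compose:
  fixes f :: "'b::euclidean_space \<Rightarrow> real" and T :: "'a::euclidean_space \<Rightarrow> 'b"
  assumes f: "f \<in> borel_measurable lebesgue" and [measurable]: "T \<in> borel_measurable borel"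
    and T: "distr lborel borel T = lborel"
  shows "(\<lambda>x. f (T x)) \<in> borel_measurable lebesgue"
proof -
  obtain g where [measurable]: "g \<in> borel_measurable lborel" and eq: "AE x in lborel. f x = g x"
    using completion_ex_borel_measurable_real[OF f] by blast
  have "AE x in distr lborel borel T. f x = g x" unfolding T by (rule eq)
  from AE_distrD[OF _ this] have "AE x in lborel. f (T x) = g (T x)" by simp
  then show ?thesis by (intro measurable_completion_cong_AE[of "\<lambda>x. g (T x)"]) measurable
qed

lemma continuous_on_cvec [continuous_intros]:
  "continuous_on S f \<Longrightarrow> continuous_on S g \<Longrightarrow> continuous_on S (\<lambda>x. cvec (f x) (g x))"
  unfolding cvec_def Complex_eq by (intro continuous_intros)

lemma distr_cvec: "distr lborel borel (\<lambda>z. cvec (fst z) (snd z)) = (lborel :: (complex^'d) measure)"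
  using lborel_cvec[where 'd='d] by (simp add: lborel_prod split_beta')

lemma distr_cvec_swap: "distr lborel borel (\<lambda>z. cvec (snd z) (fst z)) = (lborel :: (complex^'d) measure)"
proof -
  let ?M = "lborel \<Otimes>\<^sub>M lborel :: ((real^'d) \<times> (real^'d)) measure"
  have "(lborel :: (complex^'d) measure) = distr ?M borel (\<lambda>(x, y). cvec x y)"
    by (rule lborel_cvec[symmetric])
  also have "?M = distr ?M ?M (\<lambda>(x, y). (y, x))"
    by (rule lborel_pair.distr_pair_swap)
  also have "distr \<dots> borel (\<lambda>(x, y). cvec x y) = distr ?M borel ((\<lambda>(x, y). cvec x y) \<circ> (\<lambda>(x, y). (y, x)))"
    by (rule distr_distr) measurable
  finally show ?thesis by (simp add: o_def split_beta' lborel_prod)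
qed

lemma norm_cvec: "(norm (cvec x y))\<^sup>2 = (norm x)\<^sup>2 + (norm y)\<^sup>2"
  by (simp add: norm_vec_def L2_set_def sum_nonneg cvec_def cmod_power2 sum.distrib)

lemma norm_scaled_cvec: "(norm ((1 / sqrt 2) *\<^sub>R cvec x y))\<^sup>2 = ((norm x)\<^sup>2 + (norm y)\<^sup>2) / 2"
  by (simp add: power_mult_distrib power_divide norm_cvec)

lemma A_entire_sep_hol: "F \<in> A_entire \<Longrightarrow> sep_hol F"
  by (auto simp: A_entire_def intro: entire_wrt_imp_sep_hol)

lemma A_entire_continuous: "F \<in> A_entire \<Longrightarrow> continuous_on S F"
  by (rule sep_hol_continuous[OF A_entire_sep_hol])

text \<open>Both orders of the arguments occur: \<open>A_norm\<close> takes its inner norm in the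
  first one, \<open>A_star_norm\<close> in the second.\<close>

lemma g_fun_measurable:
  fixes F :: "complex^'d \<Rightarrow> complex"
  assumes F: "F \<in> A_entire" and \<omega>: "weight \<omega>"
  shows "(\<lambda>z. g_fun F \<omega> (fst z) (snd z)) \<in> borel_measurable lebesgue"
    and "(\<lambda>z. g_fun F \<omega> (snd z) (fst z)) \<in> borel_measurable lebesgue"
proof -
  have \<omega>': "\<omega> \<in> borel_measurable lebesgue" using \<omega> by (simp add: weight_def L_inf_loc_def)
  have w1: "(\<lambda>z. \<omega> (cvec (fst z) (snd z))) \<in> borel_measurable lebesgue"
    by (rule lebesgue_measurable_compose[OF \<omega>' _ distr_cvec])
      (intro borel_measurable_continuous_onI continuous_intros)
  have w2: "(\<lambda>z. \<omega> (cvec (snd z) (fst z))) \<in> borel_measurable lebesgue"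
    by (rule lebesgue_measurable_compose[OF \<omega>' _ distr_cvec_swap])
      (intro borel_measurable_continuous_onI continuous_intros)
  have "(\<lambda>z. (2 * pi) powr (- real CARD('d) / 2)
     * exp (- ((norm (a z))\<^sup>2 + (norm (b z))\<^sup>2) / 4)
     * cmod (F ((1 / sqrt 2) *\<^sub>R cvec (a z) (- b z)))) \<in> borel_measurable lebesgue"
    if [continuous_intros]: "continuous_on UNIV a" "continuous_on UNIV b" for a b :: "(real^'d) \<times> (real^'d) \<Rightarrow> real^'d"
  proof (rule measurable_completion)
    have "continuous_on UNIV (\<lambda>z. (2 * pi) powr (- real CARD('d) / 2)
     * exp (- ((norm (a z))\<^sup>2 + (norm (b z))\<^sup>2) / 4)
     * cmod (F ((1 / sqrt 2) *\<^sub>R cvec (a z) (- b z))))"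
      by (intro continuous_intros continuous_on_compose2[OF A_entire_continuous[OF F, of UNIV]] subset_UNIV)
        simp_all
    from borel_measurable_continuous_onI[OF this]
    show "(\<lambda>z. (2 * pi) powr (- real CARD('d) / 2)
     * exp (- ((norm (a z))\<^sup>2 + (norm (b z))\<^sup>2) / 4)
     * cmod (F ((1 / sqrt 2) *\<^sub>R cvec (a z) (- b z)))) \<in> borel_measurable lborel"
      unfolding measurable_lborel2 .
  qed
  note m = this
  show "(\<lambda>z. g_fun F \<omega> (fst z) (snd z)) \<in> borel_measurable lebesgue"
    unfolding g_fun_def by (intro borel_measurable_times m w1 continuous_intros)
  show "(\<lambda>z. g_fun F \<omega> (snd z) (fst z)) \<in> borel_measurable lebesgue"
    unfolding g_fun_def by (intro borel_measurable_times m w2 continuous_intros)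
qed

lemma Lnorm_indicator_finite:
  assumes "1 \<le> p" "A \<in> sets M" "emeasure M A < \<infinity>"
  shows "Lnorm M p (indicator A) < \<infinity>"
  using assms(1)
proof (cases rule: exponent_cases)
  case 1
  have "Lnorm M top (indicator A) \<le> 1"
    by (rule Lnorm_top_le) (auto simp: indicator_def)
  then show ?thesis using 1 by (auto intro: le_less_trans)
next
  case (2 r)
  have "epowr (indicator A x) r = indicator A x" for x by (simp add: indicator_def)
  then show ?thesis using 2 assms by (simp add: Lnorm_ennreal less_top[symmetric])
qed

lemma cvec_cnj: "cnj_vec (cvec x y) = cvec x (- y)"
  by (simp add: cnj_vec_def cvec_def vec_eq_iff complex_eq_iff)

lemma scaleR_cvec: "r *\<^sub>R cvec x y = cvec (r *\<^sub>R x) (r *\<^sub>R y)"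
  by (simp add: cvec_def vec_eq_iff complex_eq_iff)

section \<open>Estimates for a fixed kernel\<close>

text \<open>The constant \<open>c0\<close> is a parameter of the locale, so that the estimates
  proved inside have a constant depending on \<open>c0\<close> and the dimension but not on
  K.\<close>

locale kernel =
  fixes \<omega>1 \<omega>2 :: "complex^'d \<Rightarrow> real" and \<omega> :: "(complex^'d) \<times> (complex^'d) \<Rightarrow> real"
    and c0 :: real and p q p' q' :: ennreal
    and K :: "(complex^'d) \<times> (complex^'d) \<Rightarrow> complex"
  assumes w1: "weight \<omega>1" and w2: "weight \<omega>2"
    and ratio: "\<And>z w. \<omega>2 z / \<omega>1 w \<le> c0 * \<omega> (z, cnj_vec w)" and c0: "0 < c0"
    and p: "1 \<le> p" and q: "1 \<le> q"
    and pp': "1 / p + 1 / p' = 1" and qq': "1 / q + 1 / q' = 1"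
    and K: "K \<in> A_tilde" and G: "G_KC K \<omega> \<in> Lpq_star p q"
begin

text \<open>Extended-real valued, hence meaningful before the integral defining the operator is
  known to converge at any point.\<close>

definition total :: "(complex^'d \<Rightarrow> complex) \<Rightarrow> complex^'d \<Rightarrow> ennreal" where
  "total F z = (\<integral>\<^sup>+ w. norm (K (z, w) * F w) \<partial>gauss_measure)"

text \<open>The factor that multiplies the modulus of F at (x - i \<xi>) / sqrt 2 in
  \<open>g_fun F \<omega>2 x \<xi>\<close>.\<close>

definition pref :: "real^'d \<Rightarrow> real^'d \<Rightarrow> real" where
  "pref x \<xi> = (2 * pi) powr (- real CARD('d) / 2) * exp (- ((norm x)\<^sup>2 + (norm \<xi>)\<^sup>2) / 4) * \<omega>2 (cvec x \<xi>)"

text \<open>The factor \<open>c0\<close> comes from the weights, 4^d from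
  \<open>kernel_estimate\<close>, and (2 pi)^(-d) is the normalization pi^(-d) of \<mu> times the
  Jacobian 2^(-d) of w = (y - i \<eta>) / sqrt 2.\<close>

definition const :: real where
  "const = c0 * (2 * pi) powr (- real CARD('d)) * 4 ^ CARD('d)"

lemma w1_pos: "0 < \<omega>1 z" and w2_pos: "0 < \<omega>2 z"
  using w1 w2 by (auto simp: weight_def)

lemma p': "1 \<le> p'" and q': "1 \<le> q'"
  using conjugate_ge_1 pp' qq' by auto

lemma measurable_K [measurable]: "K \<in> borel_measurable (borel \<Otimes>\<^sub>M borel)"
  unfolding borel_prod by (rule borel_measurable_continuous_onI[OF A_tilde_continuous[OF K]])

lemma measurable_K_slice [measurable]: "(\<lambda>w. K (z, w)) \<in> borel_measurable borel"
  by (rule measurable_compose[OF _ measurable_K]) measurable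

lemma total_eq:
  assumes [measurable]: "F \<in> borel_measurable borel"
  shows "total F z = (\<integral>\<^sup>+ w. ennreal (exp (- (norm w)\<^sup>2) / pi ^ CARD('d)) * norm (K (z, w) * F w) \<partial>lborel)"
  unfolding total_def gauss_measure_def by (rule nn_integral_density) measurable

lemma measurable_total [measurable]:
  assumes [measurable]: "F \<in> borel_measurable borel"
  shows "total F \<in> borel_measurable borel"
proof -
  have "(\<lambda>z. \<integral>\<^sup>+ w. ennreal (exp (- (norm w)\<^sup>2) / pi ^ CARD('d)) * norm (K (z, w) * F w) \<partial>lborel) \<in> borel_measurable borel"
    by measurable
  moreover have "total F = (\<lambda>z. \<integral>\<^sup>+ w. ennreal (exp (- (norm w)\<^sup>2) / pi ^ CARD('d)) * norm (K (z, w) * F w) \<partial>lborel)"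
    by (rule ext) (rule total_eq[OF assms])
  ultimately show ?thesis by simp
qed

text \<open>The Gaussian exp(-|w|^2) is the square of exp(-|w|^2 / 2): one factor completes the
  weighted kernel, the other the weighted F. The constants (2 pi)^(-d/2) in \<open>pref\<close> and
  \<open>g_fun\<close> match each other.\<close>

lemma K_weighted_pointwise:
  fixes x \<xi> y \<eta> :: "real^'d"
  defines "w \<equiv> (1 / sqrt 2) *\<^sub>R cvec y (- \<eta>)" and "z \<equiv> (1 / sqrt 2) *\<^sub>R cvec x (- \<xi>)"
  shows "pref x \<xi> * (exp (- (norm w)\<^sup>2) / (2 * pi) ^ CARD('d) * norm (K (z, w) * F w))
    \<le> c0 * (2 * pi) powr (- real CARD('d)) *
      (G_KC K \<omega> ((1 / sqrt 2) *\<^sub>R cvec x (- \<eta>), (1 / sqrt 2) *\<^sub>R cvec (y - x) (\<eta> - \<xi>)) * g_fun F \<omega>1 y \<eta>)"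
proof -
  let ?e = "exp (- ((norm x)\<^sup>2 + (norm \<xi>)\<^sup>2) / 4)" and ?f = "exp (- ((norm y)\<^sup>2 + (norm \<eta>)\<^sup>2) / 4)"
  let ?a = "(2 * pi) powr (- real CARD('d) / 2)" and ?b = "(2 * pi) powr (- real CARD('d))"
  have nz: "(norm z)\<^sup>2 = ((norm x)\<^sup>2 + (norm \<xi>)\<^sup>2) / 2" and nw: "(norm w)\<^sup>2 = ((norm y)\<^sup>2 + (norm \<eta>)\<^sup>2) / 2"
    unfolding z_def w_def norm_scaled_cvec by simp_all
  \<comment> \<open>The argument of \<open>G_KC\<close> is the point that C sends to (z, w): the
    imaginary parts add up to -\<eta> + (\<eta> - \<xi>) = -\<xi>, the real parts to x + (y - x) =
    y, all divided by sqrt 2.\<close>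
  have Gz: "G_KC K \<omega> ((1 / sqrt 2) *\<^sub>R cvec x (- \<eta>), (1 / sqrt 2) *\<^sub>R cvec (y - x) (\<eta> - \<xi>)) = K_weighted K \<omega> (z, w)"
    unfolding scaleR_cvec G_KC_eq z_def w_def
    by (simp add: scaleR_right_diff_distrib)
  \<comment> \<open>The arguments of \<omega> are therefore x + i \<xi> and the conjugate of y + i
    \<eta>, as in the inequality between the weights.\<close>
  have s: "sqrt 2 *\<^sub>R cnj_vec z = cvec x \<xi>" "sqrt 2 *\<^sub>R w = cnj_vec (cvec y \<eta>)"
    by (simp_all add: z_def w_def scaleR_cvec cvec_cnj)
  have e: "exp (- ((norm z)\<^sup>2 + (norm w)\<^sup>2) / 2) = ?e * ?f"
    unfolding nz nw exp_add[symmetric] by (simp add: field_simps)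
  have f2: "exp (- (norm w)\<^sup>2) = ?f * ?f"
    unfolding nw exp_add[symmetric] by (simp add: field_simps)
  have b: "1 / (2 * pi) ^ CARD('d) = ?b"
    by (simp add: powr_minus powr_realpow divide_inverse)
  have r: "\<omega>2 (cvec x \<xi>) \<le> c0 * \<omega> (cvec x \<xi>, cnj_vec (cvec y \<eta>)) * \<omega>1 (cvec y \<eta>)"
    using ratio[of "cvec x \<xi>" "cvec y \<eta>"] w1_pos[of "cvec y \<eta>"] by (simp add: pos_divide_le_eq)
  have "pref x \<xi> * (exp (- (norm w)\<^sup>2) / (2 * pi) ^ CARD('d) * norm (K (z, w) * F w))
      = (?a * ?e * ?f * ?f * norm (K (z, w)) * norm (F w)) * (1 / (2 * pi) ^ CARD('d)) * \<omega>2 (cvec x \<xi>)"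
    by (simp add: pref_def f2 norm_mult)
  also have "\<dots> = (?a * ?e * ?f * ?f * norm (K (z, w)) * norm (F w) * ?b) * \<omega>2 (cvec x \<xi>)"
    by (simp only: b)
  also have "\<dots> \<le> (?a * ?e * ?f * ?f * norm (K (z, w)) * norm (F w) * ?b)
      * (c0 * \<omega> (cvec x \<xi>, cnj_vec (cvec y \<eta>)) * \<omega>1 (cvec y \<eta>))"
    by (rule mult_left_mono[OF r]) simp
  also have "\<dots> = c0 * ?b * (K_weighted K \<omega> (z, w) * g_fun F \<omega>1 y \<eta>)"
    unfolding K_weighted_def case_prod_conv e s g_fun_def w_def[symmetric] by (simp only: mult_ac)
  finally show ?thesis unfolding Gz .
qed

text \<open>Formulated for the integral of absolute values and with a Borel bound at every point, so
  that it yields both the local integrability of \<open>total F\<close> and the norm estimate for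
  the operator.\<close>

lemma dominating_function:
  assumes F: "F \<in> A_space q' p' \<omega>1"
  obtains B where "B \<in> borel_measurable (lborel \<Otimes>\<^sub>M lborel)"
    "\<And>x \<xi>. ennreal (pref x \<xi>) * total F ((1 / sqrt 2) *\<^sub>R cvec x (- \<xi>)) \<le> B (x, \<xi>)"
    "Lnorm lborel p (\<lambda>x. Lnorm lborel q (\<lambda>\<xi>. B (x, \<xi>)))
      \<le> ennreal const * Lpq_star_norm p q (G_KC K \<omega>) * A_norm q' p' \<omega>1 F"
proof -
  have Fe: "F \<in> A_entire" using F by (simp add: A_space_def)
  have F_meas [measurable]: "F \<in> borel_measurable borel"
    by (rule borel_measurable_continuous_onI[OF A_entire_continuous[OF Fe]])
  have Gm: "(\<lambda>z. ennreal \<bar>G_KC K \<omega> z\<bar>) \<in> borel_measurable lebesgue"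
  proof -
    have [measurable]: "G_KC K \<omega> \<in> borel_measurable lebesgue" using G by (simp add: Lpq_star_def)
    show ?thesis by measurable
  qed
  obtain G' where G'_meas [measurable]: "G' \<in> borel_measurable (lborel \<Otimes>\<^sub>M lborel)"
    and G': "\<And>z. ennreal \<bar>G_KC K \<omega> z\<bar> \<le> G' z"
    and "Lp_norm p (\<lambda>z. Lp_norm q (\<lambda>w. ennreal \<bar>G_KC K \<omega> (z, w)\<bar>)) = Lnorm lborel p (\<lambda>z. Lnorm lborel q (\<lambda>w. G' (z, w)))"
    by (rule Lp_norm_iterated_Borel_majorant[OF Gm, where p=p and q=q]) (rule that)
  then have G'_norm: "Lpq_star_norm p q (G_KC K \<omega>) = Lnorm lborel p (\<lambda>z. Lnorm lborel q (\<lambda>w. G' (z, w)))"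
    by (simp only: Lpq_star_norm_def)
  have gm: "(\<lambda>z. ennreal (g_fun F \<omega>1 (snd z) (fst z))) \<in> borel_measurable lebesgue"
    using g_fun_measurable(2)[OF Fe w1] by simp
  obtain g' where g'_meas [measurable]: "g' \<in> borel_measurable (lborel \<Otimes>\<^sub>M lborel)"
    and g': "\<And>z. ennreal (g_fun F \<omega>1 (snd z) (fst z)) \<le> g' z"
    and "Lp_norm p' (\<lambda>\<eta>. Lp_norm q' (\<lambda>y. ennreal (g_fun F \<omega>1 y \<eta>))) = Lnorm lborel p' (\<lambda>\<eta>. Lnorm lborel q' (\<lambda>y. g' (\<eta>, y)))"
    by (rule Lp_norm_iterated_Borel_majorant[OF gm, where p=p' and q=q', unfolded fst_conv snd_conv]) (rule that)
  then have g'_norm: "A_norm q' p' \<omega>1 F = Lnorm lborel p' (\<lambda>\<eta>. Lnorm lborel q' (\<lambda>y. g' (\<eta>, y)))"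
    by (simp only: A_norm_def)
  define I where "I x \<xi> = (\<integral>\<^sup>+\<eta>. \<integral>\<^sup>+y.
        G' ((1 / sqrt 2) *\<^sub>R cvec x (- \<eta>), (1 / sqrt 2) *\<^sub>R cvec (y - x) (\<eta> - \<xi>)) * g' (\<eta>, y) \<partial>lborel \<partial>lborel)"
    for x \<xi>
  define k where "k = c0 * (2 * pi) powr (- real CARD('d))"
  have k: "0 \<le> k" using c0 by (simp add: k_def)
  have [measurable (raw)]: "(\<lambda>u. G' (a u, b u)) \<in> borel_measurable M"
    if "a \<in> borel_measurable M" "b \<in> borel_measurable M" for a b and M :: "'m measure"
    using measurable_compose[OF _ G'_meas, of "\<lambda>u. (a u, b u)" M] that by simp
  have [measurable (raw)]: "(\<lambda>u. g' (a u, b u)) \<in> borel_measurable M"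
    if "a \<in> borel_measurable M" "b \<in> borel_measurable M" for a b and M :: "'m measure"
    using measurable_compose[OF _ g'_meas, of "\<lambda>u. (a u, b u)" M] that by simp
  have I_meas [measurable]: "(\<lambda>z. I (fst z) (snd z)) \<in> borel_measurable (lborel \<Otimes>\<^sub>M lborel)"
    unfolding I_def by measurable
  have [measurable]: "I x \<in> borel_measurable lborel" for x
    unfolding I_def[abs_def] by measurable
  show thesis
  proof (rule that[of "\<lambda>z. ennreal k * I (fst z) (snd z)"])
    show "(\<lambda>z. ennreal k * I (fst z) (snd z)) \<in> borel_measurable (lborel \<Otimes>\<^sub>M lborel)"
      by measurable
    fix x \<xi> :: "real^'d"
    let ?z = "(1 / sqrt 2) *\<^sub>R cvec x (- \<xi>)"
    define h where "h w = ennreal (exp (- (norm w)\<^sup>2) / (2 * pi) ^ CARD('d)) * norm (K (?z, w) * F w)" for w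
    have h_meas [measurable]: "h \<in> borel_measurable borel" unfolding h_def by measurable
    \<comment> \<open>Replacing pi^d by (2 pi)^d costs 2^d, exactly the factor absorbed by the
      substitution w = (y - i \<eta>) / sqrt 2.\<close>
    have "total F ?z = (\<integral>\<^sup>+ w. ennreal (2 ^ CARD('d)) * h w \<partial>lborel)"
      unfolding total_eq[OF F_meas] h_def
      by (intro nn_integral_cong) (simp add: ennreal_mult'[symmetric] power_mult_distrib field_simps)
    also have "\<dots> = ennreal (2 ^ CARD('d)) * (\<integral>\<^sup>+ w. h w \<partial>lborel)"
      by (rule nn_integral_cmult) measurable
    also have "\<dots> = (\<integral>\<^sup>+ y. \<integral>\<^sup>+ \<eta>. h ((1 / sqrt 2) *\<^sub>R cvec y (- \<eta>)) \<partial>lborel \<partial>lborel)"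
      by (rule nn_integral_cvec_reflect[symmetric]) measurable
    also have "\<dots> = (\<integral>\<^sup>+ \<eta>. \<integral>\<^sup>+ y. h ((1 / sqrt 2) *\<^sub>R cvec y (- \<eta>)) \<partial>lborel \<partial>lborel)"
      by (rule lborel_pair.Fubini') measurable
    finally have total: "total F ?z = (\<integral>\<^sup>+ \<eta>. \<integral>\<^sup>+ y. h ((1 / sqrt 2) *\<^sub>R cvec y (- \<eta>)) \<partial>lborel \<partial>lborel)" .
    have "ennreal (pref x \<xi>) * total F ?z
        = (\<integral>\<^sup>+ \<eta>. ennreal (pref x \<xi>) * (\<integral>\<^sup>+ y. h ((1 / sqrt 2) *\<^sub>R cvec y (- \<eta>)) \<partial>lborel) \<partial>lborel)"
      unfolding total by (rule nn_integral_cmult[symmetric]) measurable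
    also have "\<dots> = (\<integral>\<^sup>+ \<eta>. \<integral>\<^sup>+ y. ennreal (pref x \<xi>) * h ((1 / sqrt 2) *\<^sub>R cvec y (- \<eta>)) \<partial>lborel \<partial>lborel)"
      by (intro nn_integral_cong nn_integral_cmult[symmetric]) measurable
    also have "\<dots> \<le> (\<integral>\<^sup>+ \<eta>. \<integral>\<^sup>+ y. ennreal k *
        (G' ((1 / sqrt 2) *\<^sub>R cvec x (- \<eta>), (1 / sqrt 2) *\<^sub>R cvec (y - x) (\<eta> - \<xi>)) * g' (\<eta>, y)) \<partial>lborel \<partial>lborel)"
    proof (intro nn_integral_mono)
      fix \<eta> y :: "real^'d"
      let ?w = "(1 / sqrt 2) *\<^sub>R cvec y (- \<eta>)"
      let ?p = "((1 / sqrt 2) *\<^sub>R cvec x (- \<eta>), (1 / sqrt 2) *\<^sub>R cvec (y - x) (\<eta> - \<xi>))"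
      have pr: "0 \<le> pref x \<xi>" using w2_pos[of "cvec x \<xi>"] by (simp add: pref_def)
      have gp: "0 \<le> g_fun F \<omega>1 y \<eta>" using w1_pos[of "cvec y \<eta>"] by (simp add: g_fun_def)
      have "ennreal (pref x \<xi>) * h ?w
          = ennreal (pref x \<xi> * (exp (- (norm ?w)\<^sup>2) / (2 * pi) ^ CARD('d) * norm (K (?z, ?w) * F ?w)))"
        unfolding h_def using pr by (simp add: ennreal_mult'[symmetric] del: norm_scaleR)
      also have "\<dots> \<le> ennreal (k * (G_KC K \<omega> ?p * g_fun F \<omega>1 y \<eta>))"
        unfolding k_def by (intro ennreal_leI K_weighted_pointwise)
      also have "\<dots> \<le> ennreal (k * (\<bar>G_KC K \<omega> ?p\<bar> * g_fun F \<omega>1 y \<eta>))"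
        using k gp by (intro ennreal_leI mult_left_mono mult_right_mono) auto
      also have "\<dots> = ennreal k * (ennreal \<bar>G_KC K \<omega> ?p\<bar> * ennreal (g_fun F \<omega>1 y \<eta>))"
        using k gp by (simp add: ennreal_mult)
      also have "\<dots> \<le> ennreal k * (G' ?p * g' (\<eta>, y))"
        using G'[of ?p] g'[of "(\<eta>, y)"] by (intro mult_left_mono mult_mono) auto
      finally show "ennreal (pref x \<xi>) * h ?w \<le> ennreal k * (G' ?p * g' (\<eta>, y))" .
    qed
    also have "\<dots> = (\<integral>\<^sup>+ \<eta>. ennreal k * (\<integral>\<^sup>+ y.
        G' ((1 / sqrt 2) *\<^sub>R cvec x (- \<eta>), (1 / sqrt 2) *\<^sub>R cvec (y - x) (\<eta> - \<xi>)) * g' (\<eta>, y) \<partial>lborel) \<partial>lborel)"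
      by (intro nn_integral_cong nn_integral_cmult) measurable
    also have "\<dots> = ennreal k * I x \<xi>"
      unfolding I_def by (rule nn_integral_cmult) measurable
    finally show "ennreal (pref x \<xi>) * total F ?z \<le> ennreal k * I (fst (x, \<xi>)) (snd (x, \<xi>))" by simp
  next
    have "Lnorm lborel p (\<lambda>x. Lnorm lborel q (\<lambda>\<xi>. ennreal k * I x \<xi>))
        \<le> Lnorm lborel p (\<lambda>x. ennreal k * Lnorm lborel q (I x))"
      by (intro Lnorm_mono Lnorm_cmult_le q) measurable
    also have "\<dots> \<le> ennreal k * Lnorm lborel p (\<lambda>x. Lnorm lborel q (I x))"
      using I_meas by (intro Lnorm_cmult_le p lborel.measurable_Lnorm) (simp add: split_beta')
    also have "\<dots> \<le> ennreal k * (ennreal (4 ^ CARD('d)) * Lpq_star_norm p q (G_KC K \<omega>) * A_norm q' p' \<omega>1 F)"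
      unfolding I_def G'_norm g'_norm
      by (intro mult_left_mono kernel_estimate p q pp' qq') (auto simp: case_prod_eta)
    also have "\<dots> = ennreal const * Lpq_star_norm p q (G_KC K \<omega>) * A_norm q' p' \<omega>1 F"
    proof -
      have "ennreal const = ennreal k * ennreal (4 ^ CARD('d))"
        unfolding const_def k_def[symmetric] using k by (simp add: ennreal_mult)
      then show ?thesis by (simp add: mult.assoc)
    qed
    finally show "Lnorm lborel p (\<lambda>x. Lnorm lborel q (\<lambda>\<xi>. ennreal k * I (fst (x, \<xi>)) (snd (x, \<xi>))))
      \<le> ennreal const * Lpq_star_norm p q (G_KC K \<omega>) * A_norm q' p' \<omega>1 F" by simp
  qed
qed

text \<open>On bounded sets \<open>pref\<close> is bounded below almost everywhere, since 1 /
  \<omega>2 is locally essentially bounded. Hoelder's inequality against indicators of balls, in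
  \<xi> and in x, then turns a finite mixed norm into integrability.\<close>

lemma total_local_finite:
  assumes F: "F \<in> A_space q' p' \<omega>1"
  shows "(\<integral>\<^sup>+ \<zeta>. indicator (polydisc R) \<zeta> * total F (z0 + \<zeta>) \<partial>lborel) < \<infinity>"
proof -
  obtain B where B_meas [measurable]: "B \<in> borel_measurable (lborel \<Otimes>\<^sub>M lborel)"
    and B: "\<And>x \<xi>. ennreal (pref x \<xi>) * total F ((1 / sqrt 2) *\<^sub>R cvec x (- \<xi>)) \<le> B (x, \<xi>)"
    and B_norm: "Lnorm lborel p (\<lambda>x. Lnorm lborel q (\<lambda>\<xi>. B (x, \<xi>)))
      \<le> ennreal const * Lpq_star_norm p q (G_KC K \<omega>) * A_norm q' p' \<omega>1 F"
    by (rule dominating_function[OF F]) (rule that)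
  have "ennreal const * Lpq_star_norm p q (G_KC K \<omega>) * A_norm q' p' \<omega>1 F < \<infinity>"
    using F G by (simp add: A_space_def Lpq_star_def ennreal_mult_less_top)
  then have B_fin: "Lnorm lborel p (\<lambda>x. Lnorm lborel q (\<lambda>\<xi>. B (x, \<xi>))) < \<infinity>"
    using B_norm by (rule le_less_trans[rotated])
  have Fe: "F \<in> A_entire" using F by (simp add: A_space_def)
  have F_meas [measurable]: "F \<in> borel_measurable borel"
    by (rule borel_measurable_continuous_onI[OF A_entire_continuous[OF Fe]])
  define S where "S = {z. z - z0 \<in> polydisc R}"
  have S_meas [measurable]: "S \<in> sets borel"
  proof -
    have "S = (\<lambda>z. z - z0) -` polydisc R \<inter> space borel" by (simp add: S_def vimage_def)
    also have "\<dots> \<in> sets borel" by (rule measurable_sets[OF _ polydisc_sets]) measurable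
    finally show ?thesis .
  qed
  obtain r where r: "\<And>z. z \<in> (polydisc R :: (complex^'d) set) \<Longrightarrow> norm z \<le> r"
    using bounded_polydisc unfolding bounded_iff by blast
  \<comment> \<open>Bounds the norms of x, \<xi> and x + i \<xi> whenever (x - i \<xi>) / sqrt 2
    lies in the shifted polydisc \<open>S\<close>.\<close>
  define \<rho> where "\<rho> = sqrt 2 * (r + norm z0)"
  let ?I = "\<lambda>x :: real^'d. indicator (cball 0 \<rho>) x :: ennreal"
  have [measurable]: "(cball 0 \<rho> :: (real^'d) set) \<in> sets borel" by simp
  have in_S: "norm (cvec x \<xi>) \<le> \<rho> \<and> norm x \<le> \<rho> \<and> norm \<xi> \<le> \<rho>"
    if "(1 / sqrt 2) *\<^sub>R cvec x (- \<xi>) \<in> S" for x \<xi>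
  proof -
    have "norm ((1 / sqrt 2) *\<^sub>R cvec x (- \<xi>)) \<le> norm ((1 / sqrt 2) *\<^sub>R cvec x (- \<xi>) - z0) + norm z0"
      using norm_triangle_ineq[of "(1 / sqrt 2) *\<^sub>R cvec x (- \<xi>) - z0" z0]
      unfolding diff_add_cancel .
    also have "\<dots> \<le> r + norm z0"
      using that r by (simp add: S_def)
    finally have n: "norm (cvec x (- \<xi>)) \<le> \<rho>" by (simp add: \<rho>_def field_simps)
    have e: "(norm (cvec x \<xi>))\<^sup>2 = (norm (cvec x (- \<xi>)))\<^sup>2" by (simp add: norm_cvec)
    then have c: "norm (cvec x \<xi>) \<le> \<rho>" using n by simp
    have "(norm x)\<^sup>2 \<le> (norm (cvec x \<xi>))\<^sup>2" "(norm \<xi>)\<^sup>2 \<le> (norm (cvec x \<xi>))\<^sup>2"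
      by (simp_all add: norm_cvec)
    then have "norm x \<le> norm (cvec x \<xi>)" "norm \<xi> \<le> norm (cvec x \<xi>)"
      by (simp_all add: power2_le_iff_abs_le)
    then show ?thesis using c by auto
  qed
  have "compact (cball 0 \<rho> :: (complex^'d) set)" by simp
  then obtain b where "AE z in lebesgue. z \<in> cball 0 \<rho> \<longrightarrow> \<bar>1 / \<omega>2 z\<bar> \<le> b"
    using w2 unfolding weight_def L_inf_loc_def by blast
  then have "AE z in lborel. z \<in> cball 0 \<rho> \<longrightarrow> \<bar>1 / \<omega>2 z\<bar> \<le> b"
    by (simp only: AE_completion_iff)
  then have "AE z in distr (lborel \<Otimes>\<^sub>M lborel) borel (\<lambda>(x, y). cvec x y). z \<in> cball 0 \<rho> \<longrightarrow> \<bar>1 / \<omega>2 z\<bar> \<le> b"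
    by (simp only: lborel_cvec)
  from AE_distrD[OF _ this]
  have "AE z in lborel \<Otimes>\<^sub>M lborel. (case z of (x, y) \<Rightarrow> cvec x y) \<in> cball 0 \<rho> \<longrightarrow> \<bar>1 / \<omega>2 (case z of (x, y) \<Rightarrow> cvec x y)\<bar> \<le> b"
    by simp
  from lborel_pair.AE_pair[OF this]
  have ae: "AE x in lborel. AE \<xi> in lborel. norm (cvec x \<xi>) \<le> \<rho> \<longrightarrow> 1 / \<omega>2 (cvec x \<xi>) \<le> b"
    by (rule eventually_mono) (auto elim!: eventually_mono simp: abs_of_pos[OF w2_pos])
  \<comment> \<open>The reciprocal of a lower bound for \<open>pref\<close> where |x + i \<xi>|
    \<le> \<rho>: b controls 1 / \<omega>2, and the exponential undoes the Gaussian on that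
    ball.\<close>
  define C where "C = \<bar>b\<bar> * (2 * pi) powr (real CARD('d) / 2) * exp (\<rho>\<^sup>2 / 4)"
  have C: "1 \<le> C * pref x \<xi>" if "norm (cvec x \<xi>) \<le> \<rho>" "1 / \<omega>2 (cvec x \<xi>) \<le> b" for x \<xi>
  proof -
    have "1 \<le> \<bar>b\<bar> * \<omega>2 (cvec x \<xi>)"
    proof -
      have "1 \<le> b * \<omega>2 (cvec x \<xi>)" using that(2) w2_pos[of "cvec x \<xi>"] by (simp add: divide_le_eq)
      also have "\<dots> \<le> \<bar>b\<bar> * \<omega>2 (cvec x \<xi>)"
        using w2_pos[of "cvec x \<xi>"] by (intro mult_right_mono) auto
      finally show ?thesis .
    qed
    moreover have "(norm (cvec x \<xi>))\<^sup>2 \<le> \<rho>\<^sup>2" using that(1) by (simp add: power_mono)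
    then have "0 \<le> \<rho>\<^sup>2 / 4 + - ((norm x)\<^sup>2 + (norm \<xi>)\<^sup>2) / 4"
      by (simp add: norm_cvec field_simps)
    then have "1 \<le> exp (\<rho>\<^sup>2 / 4) * exp (- ((norm x)\<^sup>2 + (norm \<xi>)\<^sup>2) / 4)"
      unfolding exp_add[symmetric] by simp
    ultimately have "1 * 1 \<le> (\<bar>b\<bar> * \<omega>2 (cvec x \<xi>)) * (exp (\<rho>\<^sup>2 / 4) * exp (- ((norm x)\<^sup>2 + (norm \<xi>)\<^sup>2) / 4))"
      by (intro mult_mono) auto
    also have "\<dots> = C * pref x \<xi>"
    proof -
      have "(2 * pi) powr (real CARD('d) / 2) * (2 * pi) powr (- real CARD('d) / 2) = 1"
        by (simp add: powr_add[symmetric])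
      then show ?thesis by (simp add: C_def pref_def mult_ac)
    qed
    finally show ?thesis by simp
  qed
  have C0: "0 \<le> C" by (simp add: C_def)
  define f where "f z = indicator S z * total F z" for z
  have f_meas [measurable]: "f \<in> borel_measurable borel" unfolding f_def by measurable
  have "(\<integral>\<^sup>+ \<zeta>. indicator (polydisc R) \<zeta> * total F (z0 + \<zeta>) \<partial>lborel) = (\<integral>\<^sup>+ \<zeta>. f (\<zeta> + z0) \<partial>lborel)"
    by (intro nn_integral_cong) (simp add: f_def S_def add.commute indicator_def)
  also have "\<dots> = (\<integral>\<^sup>+ z. f z \<partial>lborel)"
    by (rule nn_integral_lborel_translate) measurable
  \<comment> \<open>The factor 2^d is at least 1 and is the one that the substitution z = (x - i
    \<xi>) / sqrt 2 absorbs.\<close>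
  also have "\<dots> \<le> ennreal (2 ^ CARD('d)) * (\<integral>\<^sup>+ z. f z \<partial>lborel)"
    using mult_right_mono[of 1 "ennreal (2 ^ CARD('d))" "\<integral>\<^sup>+ z. f z \<partial>lborel"] by simp
  also have "\<dots> = (\<integral>\<^sup>+ x. \<integral>\<^sup>+ \<xi>. f ((1 / sqrt 2) *\<^sub>R cvec x (- \<xi>)) \<partial>lborel \<partial>lborel)"
    by (rule nn_integral_cvec_reflect[symmetric]) measurable
  also have "\<dots> \<le> (\<integral>\<^sup>+ x. \<integral>\<^sup>+ \<xi>. ennreal C * ?I x * (B (x, \<xi>) * ?I \<xi>) \<partial>lborel \<partial>lborel)"
  proof (rule nn_integral_mono_AE, use ae in eventually_elim)
    case (elim x)
    show ?case
    proof (rule nn_integral_mono_AE, use elim in eventually_elim)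
      case (elim \<xi>)
      show ?case
      proof (cases "(1 / sqrt 2) *\<^sub>R cvec x (- \<xi>) \<in> S")
        case True
        note n = in_S[OF True]
        have "1 \<le> ennreal C * ennreal (pref x \<xi>)"
          using C[of x \<xi>] n elim C0 by (simp add: ennreal_mult'[symmetric] ennreal_ge_1)
        from mult_right_mono[OF this, of "total F ((1 / sqrt 2) *\<^sub>R cvec x (- \<xi>))"]
        have "total F ((1 / sqrt 2) *\<^sub>R cvec x (- \<xi>))
            \<le> ennreal C * (ennreal (pref x \<xi>) * total F ((1 / sqrt 2) *\<^sub>R cvec x (- \<xi>)))"
          by (simp add: mult.assoc)
        also have "\<dots> \<le> ennreal C * B (x, \<xi>)"
          by (intro mult_left_mono B) simp
        finally show ?thesis using n by (simp add: f_def True)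
      next
        case False
        then show ?thesis by (simp add: f_def)
      qed
    qed
  qed
  also have "\<dots> \<le> (\<integral>\<^sup>+ x. ennreal C * ?I x * (Lnorm lborel q (\<lambda>\<xi>. B (x, \<xi>)) * Lnorm lborel q' ?I) \<partial>lborel)"
  proof (rule nn_integral_mono)
    fix x :: "real^'d"
    have [measurable]: "(\<lambda>\<xi>. B (x, \<xi>)) \<in> borel_measurable lborel"
      by (rule measurable_compose[OF _ B_meas]) measurable
    have "(\<integral>\<^sup>+ \<xi>. ennreal C * ?I x * (B (x, \<xi>) * ?I \<xi>) \<partial>lborel) = ennreal C * ?I x * (\<integral>\<^sup>+ \<xi>. B (x, \<xi>) * ?I \<xi> \<partial>lborel)"
      by (rule nn_integral_cmult) measurable
    also have "\<dots> \<le> ennreal C * ?I x * (Lnorm lborel q (\<lambda>\<xi>. B (x, \<xi>)) * Lnorm lborel q' ?I)"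
      by (intro mult_left_mono Hoelder[OF qq']) auto
    finally show "(\<integral>\<^sup>+ \<xi>. ennreal C * ?I x * (B (x, \<xi>) * ?I \<xi>) \<partial>lborel)
        \<le> ennreal C * ?I x * (Lnorm lborel q (\<lambda>\<xi>. B (x, \<xi>)) * Lnorm lborel q' ?I)" .
  qed
  also have "\<dots> = (\<integral>\<^sup>+ x. (ennreal C * Lnorm lborel q' ?I) * (Lnorm lborel q (\<lambda>\<xi>. B (x, \<xi>)) * ?I x) \<partial>lborel)"
    by (intro nn_integral_cong) (simp add: mult_ac)
  also have "\<dots> = (ennreal C * Lnorm lborel q' ?I) * (\<integral>\<^sup>+ x. Lnorm lborel q (\<lambda>\<xi>. B (x, \<xi>)) * ?I x \<partial>lborel)"
    by (rule nn_integral_cmult) measurable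
  also have "\<dots> \<le> (ennreal C * Lnorm lborel q' ?I) * (Lnorm lborel p (\<lambda>x. Lnorm lborel q (\<lambda>\<xi>. B (x, \<xi>))) * Lnorm lborel p' ?I)"
    by (intro mult_left_mono Hoelder[OF pp']) auto
  also have "\<dots> < \<infinity>"
    using B_fin Lnorm_indicator_finite[OF p', of "cball 0 \<rho> :: (real^'d) set" lborel]
      Lnorm_indicator_finite[OF q', of "cball 0 \<rho> :: (real^'d) set" lborel]
      emeasure_bounded_finite[of "cball 0 \<rho> :: (real^'d) set"]
    by (simp add: ennreal_mult_less_top)
  finally show ?thesis .
qed

lemma K_slice_entire: "entire_wrt (*s) (\<lambda>z. K (z, w))"
  unfolding entire_wrt_def
proof
  fix z
  obtain F' where F': "((\<lambda>(z, w). K (z, cnj_vec w)) has_derivative F') (at (z, cnj_vec w))"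
      "\<And>c p. F' ((\<lambda>(z, w). (c *s z, c *s w)) p) = c * F' p"
    using K unfolding A_tilde_def entire_wrt_def by blast
  have "((\<lambda>z. (z, cnj_vec w)) has_derivative (\<lambda>v. (v, 0))) (at z)"
    by (auto intro!: derivative_eq_intros)
  from diff_chain_at[OF this F'(1)]
  have "((\<lambda>z. K (z, w)) has_derivative (\<lambda>v. F' (v, 0))) (at z)"
    by (simp add: o_def)
  moreover have "F' (c *s v, 0) = c * F' (v, 0)" for c v
    using F'(2)[of c "(v, 0)"] by simp
  ultimately show "\<exists>F'. ((\<lambda>z. K (z, w)) has_derivative F') (at z) \<and> (\<forall>c v. F' (c *s v) = c * F' v)"
    by blast
qed

text \<open>The majorant integrates |K(., w)| over the polydisc of radius 2 around z0, which
  contains the unit polydisc around every admissible z0 + h, so the mean value property applies. By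
  Tonelli its integral against |F| is a local integral of \<open>total F\<close>.\<close>

lemma K_majorant:
  assumes F: "F \<in> A_space q' p' \<omega>1"
  shows "\<exists>M. M \<in> borel_measurable gauss_measure \<and> integrable gauss_measure (\<lambda>w. M w * norm (F w)) \<and>
    (\<forall>w h. (\<forall>i. norm (h $ i) \<le> 1) \<longrightarrow> norm (K (z0 + h, w)) \<le> M w)"
proof -
  have Fe: "F \<in> A_entire" using F by (simp add: A_space_def)
  have F_meas [measurable]: "F \<in> borel_measurable borel"
    by (rule borel_measurable_continuous_onI[OF A_entire_continuous[OF Fe]])
  define f where "f w \<zeta> = indicator (polydisc 2) \<zeta> * ennreal (norm (K (z0 + \<zeta>, w)))" for w \<zeta>
  define m where "m w = (\<integral>\<^sup>+ \<zeta>. f w \<zeta> \<partial>lborel)" for w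
  have [measurable]: "m \<in> borel_measurable borel"
    unfolding m_def[abs_def] f_def by measurable
  have f_meas [measurable]: "f w \<in> borel_measurable borel" for w
    unfolding f_def[abs_def] by measurable
  have m_fin: "m w < \<infinity>" for w
  proof -
    have "continuous_on UNIV (\<lambda>\<zeta>. K (z0 + \<zeta>, w))"
      by (rule continuous_on_compose2[OF A_tilde_continuous[OF K, of UNIV]]) (auto intro!: continuous_intros)
    then obtain b where b: "\<forall>\<zeta>. (\<forall>i. norm (\<zeta> $ i) \<le> 2) \<longrightarrow> norm (K (z0 + \<zeta>, w)) \<le> b"
      using bounded_on_polydisc[of "\<lambda>\<zeta>. K (z0 + \<zeta>, w)" 2] by blast
    have "m w \<le> (\<integral>\<^sup>+ \<zeta>. ennreal b * indicator (polydisc 2) (\<zeta> :: complex^'d) \<partial>lborel)"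
      unfolding m_def f_def
    proof (rule nn_integral_mono)
      fix \<zeta> :: "complex^'d"
      show "indicator (polydisc 2) \<zeta> * ennreal (norm (K (z0 + \<zeta>, w))) \<le> ennreal b * indicator (polydisc 2) \<zeta>"
      proof (cases "\<zeta> \<in> polydisc 2")
        case True
        then have "\<forall>i. norm (\<zeta> $ i) \<le> 2" by (simp add: polydisc_def less_imp_le)
        then have "norm (K (z0 + \<zeta>, w)) \<le> b" using b by blast
        then show ?thesis using True by (simp add: ennreal_leI)
      qed simp
    qed
    also have "\<dots> = ennreal b * emeasure lborel (polydisc 2 :: (complex^'d) set)"
      by (rule nn_integral_cmult_indicator) simp
    also have "\<dots> < \<infinity>"
      using emeasure_polydisc_finite[where 'd='d, of 2] by (simp add: ennreal_mult_less_top)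
    finally show ?thesis .
  qed
  have bound: "norm (K (z0 + h, w)) \<le> enn2real (m w)" if h: "\<forall>i. norm (h $ i) \<le> 1" for w h
  proof -
    have "ennreal (norm (K (z0 + h, w))) \<le> ennreal ((pi * 1\<^sup>2) ^ CARD('d) * norm (K (z0 + h, w)))"
    proof (rule ennreal_leI)
      have "(1::real) \<le> pi ^ CARD('d)" using pi_ge_two by (intro one_le_power) simp
      from mult_right_mono[OF this norm_ge_zero[of "K (z0 + h, w)"]]
      show "norm (K (z0 + h, w)) \<le> (pi * 1\<^sup>2) ^ CARD('d) * norm (K (z0 + h, w))" by simp
    qed
    also have "\<dots> \<le> (\<integral>\<^sup>+ \<zeta>. indicator (polydisc 1) \<zeta> * norm (K (z0 + h + \<zeta>, w)) \<partial>lborel)"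
      by (rule mean_value_polydisc[OF entire_wrt_imp_sep_hol[OF K_slice_entire]]) simp
    also have "\<dots> \<le> (\<integral>\<^sup>+ \<zeta>. f w (\<zeta> + h) \<partial>lborel)"
    proof (rule nn_integral_mono)
      fix \<zeta> :: "complex^'d"
      show "indicator (polydisc 1) \<zeta> * norm (K (z0 + h + \<zeta>, w)) \<le> f w (\<zeta> + h)"
      proof (cases "\<zeta> \<in> polydisc 1")
        case True
        have "norm ((\<zeta> + h) $ i) < 2" for i
        proof -
          have "norm (\<zeta> $ i) < 1" "norm (h $ i) \<le> 1" using True h by (auto simp: polydisc_def)
          then show ?thesis using norm_triangle_ineq[of "\<zeta> $ i" "h $ i"] by simp
        qed
        then have "\<zeta> + h \<in> polydisc 2" by (simp add: polydisc_def)
        then show ?thesis using True by (simp add: f_def add_ac)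
      qed simp
    qed
    also have "\<dots> = m w" unfolding m_def by (rule nn_integral_lborel_translate) measurable
    finally have "ennreal (norm (K (z0 + h, w))) \<le> m w" .
    from enn2real_mono[OF this] show ?thesis using m_fin[of w] by simp
  qed
  have "(\<integral>\<^sup>+ w. ennreal (norm (enn2real (m w) * norm (F w))) \<partial>gauss_measure)
      = (\<integral>\<^sup>+ w. m w * ennreal (norm (F w)) \<partial>gauss_measure)"
    using m_fin by (intro nn_integral_cong) (simp add: ennreal_mult)
  also have "\<dots> = (\<integral>\<^sup>+ w. ennreal (exp (- (norm w)\<^sup>2) / pi ^ CARD('d)) * (m w * ennreal (norm (F w))) \<partial>lborel)"
    unfolding gauss_measure_def by (rule nn_integral_density) measurable
  also have "\<dots> = (\<integral>\<^sup>+ w. \<integral>\<^sup>+ \<zeta>. ennreal (exp (- (norm w)\<^sup>2) / pi ^ CARD('d)) * (f w \<zeta> * ennreal (norm (F w))) \<partial>lborel \<partial>lborel)"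
  proof (rule nn_integral_cong)
    fix w :: "complex^'d"
    show "ennreal (exp (- (norm w)\<^sup>2) / pi ^ CARD('d)) * (m w * ennreal (norm (F w)))
      = (\<integral>\<^sup>+ \<zeta>. ennreal (exp (- (norm w)\<^sup>2) / pi ^ CARD('d)) * (f w \<zeta> * ennreal (norm (F w))) \<partial>lborel)"
      unfolding m_def by (subst nn_integral_multc[symmetric], measurable, rule nn_integral_cmult[symmetric]) measurable
  qed
  also have "\<dots> = (\<integral>\<^sup>+ \<zeta>. \<integral>\<^sup>+ w. ennreal (exp (- (norm w)\<^sup>2) / pi ^ CARD('d)) * (f w \<zeta> * ennreal (norm (F w))) \<partial>lborel \<partial>lborel)"
    by (rule lborel_pair.Fubini') (unfold f_def, measurable)
  also have "\<dots> = (\<integral>\<^sup>+ \<zeta>. indicator (polydisc 2) \<zeta> * total F (z0 + \<zeta>) \<partial>lborel)"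
  proof (rule nn_integral_cong)
    fix \<zeta> :: "complex^'d"
    have "(\<integral>\<^sup>+ w. ennreal (exp (- (norm w)\<^sup>2) / pi ^ CARD('d)) * (f w \<zeta> * ennreal (norm (F w))) \<partial>lborel)
        = (\<integral>\<^sup>+ w. indicator (polydisc 2) \<zeta> *
            (ennreal (exp (- (norm w)\<^sup>2) / pi ^ CARD('d)) * ennreal (norm (K (z0 + \<zeta>, w) * F w))) \<partial>lborel)"
      unfolding f_def by (intro nn_integral_cong) (simp add: norm_mult ennreal_mult mult_ac)
    also have "\<dots> = indicator (polydisc 2) \<zeta> * total F (z0 + \<zeta>)"
      unfolding total_eq[OF F_meas] by (rule nn_integral_cmult) measurable
    finally show "(\<integral>\<^sup>+ w. ennreal (exp (- (norm w)\<^sup>2) / pi ^ CARD('d)) * (f w \<zeta> * ennreal (norm (F w))) \<partial>lborel)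
        = indicator (polydisc 2) \<zeta> * total F (z0 + \<zeta>)" .
  qed
  also have "\<dots> < \<infinity>" by (rule total_local_finite[OF F])
  finally have fin: "(\<integral>\<^sup>+ w. ennreal (norm (enn2real (m w) * norm (F w))) \<partial>gauss_measure) < \<infinity>" .
  have meas: "g \<in> borel_measurable gauss_measure" if "g \<in> borel_measurable borel" for g :: "complex^'d \<Rightarrow> real"
    using that by (simp add: gauss_measure_def)
  have "integrable gauss_measure (\<lambda>w. enn2real (m w) * norm (F w))"
    by (rule integrableI_bounded[OF meas fin]) measurable
  moreover have "(\<lambda>w. enn2real (m w)) \<in> borel_measurable gauss_measure"
    by (rule meas) measurable
  ultimately show ?thesis using bound by (intro exI[of _ "\<lambda>w. enn2real (m w)"]) blast
qed

definition T :: "(complex^'d \<Rightarrow> complex) \<Rightarrow> complex^'d \<Rightarrow> complex" where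
  "T F z = (\<integral>w. K (z, w) * F w \<partial>gauss_measure)"

lemma measurable_gauss: "g \<in> borel_measurable borel \<Longrightarrow> g \<in> borel_measurable gauss_measure"
  by (simp add: gauss_measure_def)

lemma measurable_A_entire: "F \<in> A_entire \<Longrightarrow> F \<in> borel_measurable borel"
  by (rule borel_measurable_continuous_onI[OF A_entire_continuous])

lemma T_integrable:
  assumes F: "F \<in> A_space q' p' \<omega>1"
  shows "integrable gauss_measure (\<lambda>w. K (z, w) * F w)"
proof -
  have [measurable]: "F \<in> borel_measurable borel"
    using F by (intro measurable_A_entire) (simp add: A_space_def)
  obtain M where i: "integrable gauss_measure (\<lambda>w. M w * norm (F w))"
    and M: "\<And>w h. (\<forall>i. norm (h $ i) \<le> 1) \<Longrightarrow> norm (K (z + h, w)) \<le> M w"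
    using K_majorant[OF F, of z] by blast
  show ?thesis
  proof (rule Bochner_Integration.integrable_bound[OF i])
    show "(\<lambda>w. K (z, w) * F w) \<in> borel_measurable gauss_measure"
      by (rule measurable_gauss) measurable
    show "AE w in gauss_measure. norm (K (z, w) * F w) \<le> norm (M w * norm (F w))"
    proof (rule AE_I2)
      fix w
      have "norm (K (z, w)) \<le> M w" using M[of 0 w] by simp
      moreover from this have "0 \<le> M w" using norm_ge_zero order_trans by blast
      ultimately show "norm (K (z, w) * F w) \<le> norm (M w * norm (F w))"
        by (simp add: norm_mult abs_mult mult_right_mono)
    qed
  qed
qed

lemma T_entire:
  assumes F: "F \<in> A_space q' p' \<omega>1"
  shows "T F \<in> A_entire"
  unfolding A_entire_def T_def[abs_def] mem_Collect_eq
proof (rule entire_wrt_integral)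
  show "F \<in> borel_measurable gauss_measure"
    using F by (intro measurable_gauss measurable_A_entire) (simp add: A_space_def)
qed (auto intro!: K_slice_entire measurable_gauss K_majorant[OF F])

lemma T_le_total:
  assumes F: "F \<in> A_space q' p' \<omega>1"
  shows "ennreal (norm (T F z)) \<le> total F z"
  unfolding T_def total_def by (rule integral_norm_bound_ennreal[OF T_integrable[OF F]])

lemma T_norm_le:
  assumes F: "F \<in> A_space q' p' \<omega>1"
  shows "A_star_norm p q \<omega>2 (T F)
    \<le> ennreal const * Lpq_star_norm p q (G_KC K \<omega>) * A_norm q' p' \<omega>1 F"
proof -
  obtain B where B_meas [measurable]: "B \<in> borel_measurable (lborel \<Otimes>\<^sub>M lborel)"
    and B: "\<And>x \<xi>. ennreal (pref x \<xi>) * total F ((1 / sqrt 2) *\<^sub>R cvec x (- \<xi>)) \<le> B (x, \<xi>)"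
    and B_norm: "Lnorm lborel p (\<lambda>x. Lnorm lborel q (\<lambda>\<xi>. B (x, \<xi>)))
      \<le> ennreal const * Lpq_star_norm p q (G_KC K \<omega>) * A_norm q' p' \<omega>1 F"
    by (rule dominating_function[OF F]) (rule that)
  have "ennreal (g_fun (T F) \<omega>2 x \<xi>) \<le> B (x, \<xi>)" for x \<xi>
  proof -
    let ?z = "(1 / sqrt 2) *\<^sub>R cvec x (- \<xi>)"
    have pr: "0 \<le> pref x \<xi>" using w2_pos[of "cvec x \<xi>"] by (simp add: pref_def)
    have "g_fun (T F) \<omega>2 x \<xi> = pref x \<xi> * norm (T F ?z)" by (simp add: g_fun_def pref_def)
    then have "ennreal (g_fun (T F) \<omega>2 x \<xi>) = ennreal (pref x \<xi>) * ennreal (norm (T F ?z))"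
      using pr by (simp add: ennreal_mult)
    also have "\<dots> \<le> ennreal (pref x \<xi>) * total F ?z"
      by (intro mult_left_mono T_le_total[OF F]) simp
    also have "\<dots> \<le> B (x, \<xi>)" by (rule B)
    finally show ?thesis .
  qed
  moreover have "(\<lambda>z. ennreal (g_fun (T F) \<omega>2 (fst z) (snd z))) \<in> borel_measurable lebesgue"
    using g_fun_measurable(1)[OF T_entire[OF F] w2] by simp
  ultimately have "A_star_norm p q \<omega>2 (T F) \<le> Lnorm lborel p (\<lambda>x. Lnorm lborel q (\<lambda>\<xi>. B (x, \<xi>)))"
    unfolding A_star_norm_def
    using Lp_norm_iterated_le[of "\<lambda>z. ennreal (g_fun (T F) \<omega>2 (fst z) (snd z))" B p q] by auto
  also note B_norm
  finally show ?thesis .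
qed

lemma T_in_A_star_space:
  assumes F: "F \<in> A_space q' p' \<omega>1"
  shows "T F \<in> A_star_space p q \<omega>2"
proof -
  have "ennreal const * Lpq_star_norm p q (G_KC K \<omega>) * A_norm q' p' \<omega>1 F < \<infinity>"
    using F G by (simp add: A_space_def Lpq_star_def ennreal_mult_less_top)
  from le_less_trans[OF T_norm_le[OF F] this] show ?thesis
    using T_entire[OF F] by (simp add: A_star_space_def)
qed

end

section \<open>The norm topologies\<close>

lemma entire_wrt_diff:
  assumes "entire_wrt s F" "entire_wrt s H"
  shows "entire_wrt s (\<lambda>z. F z - H z)"
  unfolding entire_wrt_def
proof
  fix z
  obtain F' H' where "(F has_derivative F') (at z)" "\<And>c v. F' (s c v) = c * F' v"
    "(H has_derivative H') (at z)" "\<And>c v. H' (s c v) = c * H' v"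
    using assms unfolding entire_wrt_def by metis
  then show "\<exists>D. ((\<lambda>z. F z - H z) has_derivative D) (at z) \<and> (\<forall>c v. D (s c v) = c * D v)"
    by (intro exI[of _ "\<lambda>v. F' v - H' v"] conjI has_derivative_diff) (auto simp: algebra_simps)
qed

lemma A_entire_diff: "F \<in> A_entire \<Longrightarrow> H \<in> A_entire \<Longrightarrow> (\<lambda>z. F z - H z) \<in> A_entire"
  by (simp add: A_entire_def entire_wrt_diff)

text \<open>Collects what the metric axioms require of a norm finite on V, so that the domain and
  the target of the operator are instances of one construction.\<close>

locale entire_norm =
  fixes n :: "(complex^'d \<Rightarrow> complex) \<Rightarrow> ennreal" and V :: "(complex^'d \<Rightarrow> complex) set"
  assumes V: "V = {F \<in> A_entire. n F < \<infinity>}"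
    and diff_le: "\<And>F H. F \<in> A_entire \<Longrightarrow> H \<in> A_entire \<Longrightarrow> n (\<lambda>z. F z - H z) \<le> n F + n H"
    and uminus: "\<And>F. n (\<lambda>z. - F z) = n F"
    and zero: "n (\<lambda>z. 0) = 0"
    and eq_0: "\<And>F. F \<in> A_entire \<Longrightarrow> n F = 0 \<Longrightarrow> F = (\<lambda>z. 0)"
begin

lemma diff_in: "F \<in> V \<Longrightarrow> H \<in> V \<Longrightarrow> (\<lambda>z. F z - H z) \<in> V"
  using diff_le[of F H] by (auto simp: V A_entire_diff intro: le_less_trans)

lemma finite_diff: "F \<in> V \<Longrightarrow> H \<in> V \<Longrightarrow> n (\<lambda>z. F z - H z) < \<infinity>"
  using diff_in by (auto simp: V)

lemma metric: "Metric_space V (\<lambda>F H. enn2real (n (\<lambda>z. F z - H z)))"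
proof
  have swap: "n (\<lambda>z. F z - H z) = n (\<lambda>z. H z - F z)" for F H
    using uminus[of "\<lambda>z. F z - H z"] by simp
  show "enn2real (n (\<lambda>z. F z - H z)) = enn2real (n (\<lambda>z. H z - F z))" for F H
    by (rule arg_cong[OF swap])
  fix F H J assume FHJ: "F \<in> V" "H \<in> V" "J \<in> V"
  have "n (\<lambda>z. F z - J z) = n (\<lambda>z. (F z - H z) - (J z - H z))" by simp
  also have "\<dots> \<le> n (\<lambda>z. F z - H z) + n (\<lambda>z. J z - H z)"
    using FHJ by (intro diff_le A_entire_diff) (auto simp: V)
  also have "n (\<lambda>z. J z - H z) = n (\<lambda>z. H z - J z)" by (rule swap)
  finally show "enn2real (n (\<lambda>z. F z - J z)) \<le> enn2real (n (\<lambda>z. F z - H z)) + enn2real (n (\<lambda>z. H z - J z))"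
    using finite_diff FHJ by (subst enn2real_plus[symmetric]) (auto intro!: enn2real_mono)
next
  fix F H assume FH: "F \<in> V" "H \<in> V"
  show "enn2real (n (\<lambda>z. F z - H z)) = 0 \<longleftrightarrow> F = H"
  proof
    assume "enn2real (n (\<lambda>z. F z - H z)) = 0"
    then have "n (\<lambda>z. F z - H z) = 0" using finite_diff[OF FH] by (auto simp: enn2real_eq_0_iff)
    then have "(\<lambda>z. F z - H z) = (\<lambda>z. 0)" using FH by (intro eq_0 A_entire_diff) (auto simp: V)
    then show "F = H" by (auto simp: fun_eq_iff)
  qed (simp add: zero)
qed simp

end

text \<open>The maps a and b stand for the two projections in either order, which covers both orders
  of taking the norms.\<close>

lemma entire_norm_mixed:
  fixes a b :: "(real^'d) \<times> (real^'d) \<Rightarrow> real^'d"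
  assumes PQ: "1 \<le> P" "1 \<le> Q" and \<omega>: "weight \<omega>"
    and cont: "continuous_on UNIV a" "continuous_on UNIV b"
    and surj: "\<And>x \<xi>. \<exists>z. a z = x \<and> b z = \<xi>"
    and meas: "\<And>F. F \<in> A_entire \<Longrightarrow> (\<lambda>z. g_fun F \<omega> (a z) (b z)) \<in> borel_measurable lebesgue"
    and n: "\<And>F. n F = Lp_norm P (\<lambda>u. Lp_norm Q (\<lambda>v. ennreal (g_fun F \<omega> (a (u, v)) (b (u, v)))))"
  shows "entire_norm n {F \<in> A_entire. n F < \<infinity>}"
proof
  have \<omega>_pos: "0 < \<omega> z" for z using \<omega> by (simp add: weight_def)
  have nonneg: "0 \<le> g_fun F \<omega> x \<xi>" for F x \<xi>
    using \<omega>_pos[of "cvec x \<xi>"] by (simp add: g_fun_def)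
  have meas': "(\<lambda>z. ennreal (g_fun F \<omega> (a z) (b z))) \<in> borel_measurable lebesgue" if "F \<in> A_entire" for F
    using meas[OF that] by simp
  show "n (\<lambda>z. F z - H z) \<le> n F + n H" if F: "F \<in> A_entire" and H: "H \<in> A_entire" for F H
    unfolding n
  proof (rule Lp_norm_iterated_triangle[OF PQ meas'[OF F] meas'[OF H] meas'[OF A_entire_diff[OF F H]]])
    fix z
    have "g_fun (\<lambda>z. F z - H z) \<omega> (a z) (b z) \<le> g_fun F \<omega> (a z) (b z) + g_fun H \<omega> (a z) (b z)"
      unfolding g_fun_def distrib_left[symmetric] distrib_right[symmetric]
      using \<omega>_pos[of "cvec (a z) (b z)"]
      by (intro mult_right_mono mult_left_mono norm_triangle_ineq4) auto
    then show "ennreal (g_fun (\<lambda>z. F z - H z) \<omega> (a z) (b z)) \<le> ennreal (g_fun F \<omega> (a z) (b z)) + ennreal (g_fun H \<omega> (a z) (b z))"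
      using nonneg by (simp add: ennreal_plus[symmetric] ennreal_leI del: ennreal_plus)
  qed
  show "n (\<lambda>z. - F z) = n F" for F
    by (simp add: n g_fun_def)
  have "Lp_norm P (\<lambda>u. Lp_norm Q (\<lambda>v. (\<lambda>z. 0) (u :: real^'d, v :: real^'d)))
      = Lnorm lborel P (\<lambda>u. Lnorm lborel Q (\<lambda>v. (\<lambda>z. 0) (u :: real^'d, v :: real^'d)))"
    by (rule Lp_norm_iterated_cong) auto
  moreover have "Lnorm lborel R (\<lambda>u :: real^'d. 0) = 0" for R
  proof (cases "R = \<infinity>")
    case True
    have "Lnorm lborel top (\<lambda>u :: real^'d. 0) \<le> 0" by (rule Lnorm_top_le) simp
    then show ?thesis using True by simp
  qed (simp add: Lnorm_def)
  ultimately show "n (\<lambda>z. 0) = 0" by (simp add: n g_fun_def)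
  show "F = (\<lambda>z. 0)" if F: "F \<in> A_entire" and "n F = 0" for F
  proof -
    define h where "h z = F ((1 / sqrt 2) *\<^sub>R cvec (a z) (- b z))" for z
    have "AE z in lborel. ennreal (g_fun F \<omega> (a z) (b z)) = 0"
      using \<open>n F = 0\<close> unfolding n by (rule Lp_norm_iterated_eq_0[OF PQ meas'[OF F]])
    then have "AE z in lborel. h z = 0"
    proof eventually_elim
      case (elim z)
      then have "g_fun F \<omega> (a z) (b z) = 0" using nonneg[of F "a z" "b z"] by (simp add: ennreal_eq_0_iff)
      then show ?case using \<omega>_pos[of "cvec (a z) (b z)"] by (simp add: g_fun_def h_def)
    qed
    then have "AE z in lebesgue. z \<in> {z. h z = 0}" by (simp add: AE_completion_iff)
    \<comment> \<open>The norm detects F only up to null sets. By continuity the zero set is closed,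
      and a closed set of full measure is the whole space.\<close>
    moreover have "continuous_on UNIV h"
      unfolding h_def
      by (rule continuous_on_compose2[OF A_entire_continuous[OF F, of UNIV]]) (intro continuous_intros cont, simp)
    then have "closed {z. h z = 0}" by (intro closed_Collect_eq continuous_intros)
    ultimately have h0: "h z = 0" for z using mem_closed_if_AE_lebesgue[of "{z. h z = 0}" z] by simp
    show ?thesis
    proof
      fix w
      obtain z where z: "a z = (\<chi> i. sqrt 2 * Re (w $ i))" "b z = (\<chi> i. - (sqrt 2 * Im (w $ i)))"
        using surj by blast
      have "(1 / sqrt 2) *\<^sub>R cvec (a z) (- b z) = w"
        by (simp add: z cvec_def vec_eq_iff complex_eq_iff)
      then show "F w = 0" using h0[of z] by (simp add: h_def)
    qed
  qed
qed simp

lemma entire_norm_A: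
  assumes "1 \<le> p" "1 \<le> q" "weight \<omega>"
  shows "entire_norm (A_norm p q \<omega>) (A_space p q \<omega>)"
  unfolding A_space_def
  by (rule entire_norm_mixed[OF assms(2,1,3), of snd fst])
    (auto simp: A_norm_def intro!: continuous_intros g_fun_measurable(2)[OF _ assms(3)])

lemma entire_norm_A_star:
  assumes "1 \<le> p" "1 \<le> q" "weight \<omega>"
  shows "entire_norm (A_star_norm p q \<omega>) (A_star_space p q \<omega>)"
  unfolding A_star_space_def
  by (rule entire_norm_mixed[OF assms, of fst snd])
    (auto simp: A_star_norm_def intro!: continuous_intros g_fun_measurable(1)[OF _ assms(3)])

section \<open>Continuity, linearity and uniqueness of the extension\<close>

context kernel
begin

lemma metric_A: "Metric_space (A_space q' p' \<omega>1) (\<lambda>F H. enn2real (A_norm q' p' \<omega>1 (\<lambda>z. F z - H z)))"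
  by (rule entire_norm.metric[OF entire_norm_A[OF q' p' w1]])

lemma metric_A_star: "Metric_space (A_star_space p q \<omega>2) (\<lambda>F H. enn2real (A_star_norm p q \<omega>2 (\<lambda>z. F z - H z)))"
  by (rule entire_norm.metric[OF entire_norm_A_star[OF p q w2]])

lemma topspace_A_top: "topspace (A_top q' p' \<omega>1) = A_space q' p' \<omega>1"
  unfolding A_top_def by (rule Metric_space.topspace_mtopology[OF metric_A])

lemma T_diff:
  assumes "F \<in> A_space q' p' \<omega>1" "H \<in> A_space q' p' \<omega>1"
  shows "T (\<lambda>z. F z - H z) = (\<lambda>z. T F z - T H z)"
  using T_integrable[OF assms(1)] T_integrable[OF assms(2)]
  by (simp add: T_def[abs_def] right_diff_distrib)

lemma T_continuous: "continuous_map (A_top q' p' \<omega>1) (A_star_top p q \<omega>2) T"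
  unfolding A_top_def A_star_top_def
proof (rule Metric_space.metric_continuous_map[OF metric_A metric_A_star, THEN iffD2], intro conjI ballI allI impI)
  show "T ` A_space q' p' \<omega>1 \<subseteq> A_star_space p q \<omega>2" using T_in_A_star_space by blast
  fix F and \<epsilon> :: real assume F: "F \<in> A_space q' p' \<omega>1" and \<epsilon>: "0 < \<epsilon>"
  define c where "c = enn2real (ennreal const * Lpq_star_norm p q (G_KC K \<omega>))"
  have "ennreal const * Lpq_star_norm p q (G_KC K \<omega>) < top"
    using G by (simp add: Lpq_star_def ennreal_mult_less_top)
  then have c: "ennreal const * Lpq_star_norm p q (G_KC K \<omega>) = ennreal c"
    by (simp add: c_def)
  have c0: "0 \<le> c" by (simp add: c_def)
  show "\<exists>\<delta>>0. \<forall>H. H \<in> A_space q' p' \<omega>1 \<and> enn2real (A_norm q' p' \<omega>1 (\<lambda>z. F z - H z)) < \<delta> \<longrightarrow>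
      enn2real (A_star_norm p q \<omega>2 (\<lambda>z. T F z - T H z)) < \<epsilon>"
  \<comment> \<open>The divisor is c + 1 because c vanishes when the norm of
    \<open>G_KC K \<omega>\<close> does.\<close>
  proof (intro exI[of _ "\<epsilon> / (c + 1)"] conjI allI impI; (elim conjE)?)
    show "0 < \<epsilon> / (c + 1)" using c0 \<epsilon> by simp
    fix H assume H: "H \<in> A_space q' p' \<omega>1" and lt: "enn2real (A_norm q' p' \<omega>1 (\<lambda>z. F z - H z)) < \<epsilon> / (c + 1)"
    have D: "(\<lambda>z. F z - H z) \<in> A_space q' p' \<omega>1"
      by (rule entire_norm.diff_in[OF entire_norm_A[OF q' p' w1] F H])
    then have fin: "A_norm q' p' \<omega>1 (\<lambda>z. F z - H z) < top" by (simp add: A_space_def)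
    have "A_star_norm p q \<omega>2 (\<lambda>z. T F z - T H z) \<le> ennreal c * A_norm q' p' \<omega>1 (\<lambda>z. F z - H z)"
      using T_norm_le[OF D] by (simp only: T_diff[OF F H] c)
    then have "enn2real (A_star_norm p q \<omega>2 (\<lambda>z. T F z - T H z)) \<le> enn2real (ennreal c * A_norm q' p' \<omega>1 (\<lambda>z. F z - H z))"
      using fin by (intro enn2real_mono) (auto simp: ennreal_mult_less_top)
    also have "\<dots> = c * enn2real (A_norm q' p' \<omega>1 (\<lambda>z. F z - H z))"
      using c0 by (simp add: enn2real_mult)
    also have "\<dots> \<le> c * (\<epsilon> / (c + 1))"
      using lt c0 by (intro mult_left_mono) auto
    also have "\<dots> < \<epsilon>" using c0 \<epsilon> by (simp add: field_simps)
    finally show "enn2real (A_star_norm p q \<omega>2 (\<lambda>z. T F z - T H z)) < \<epsilon>" .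
  qed
qed

lemma T_extension: "continuous_extension (A_top q' p' \<omega>1) (A_star_top p q \<omega>2) K T"
  unfolding continuous_extension_def topspace_A_top
proof (intro conjI ballI T_continuous)
  fix F assume "F \<in> A_flat1 \<inter> A_space q' p' \<omega>1"
  then show "T F = T_op K F"
    using T_op_eq_integral[OF K _ T_integrable] by (auto simp: T_def[abs_def] fun_eq_iff)
qed

lemma T_linear: "linear_on (A_space q' p' \<omega>1) T"
  unfolding linear_on_def
proof (intro ballI allI)
  fix F H a b assume "F \<in> A_space q' p' \<omega>1" "H \<in> A_space q' p' \<omega>1"
  note i = T_integrable[OF this(1)] T_integrable[OF this(2)]
  show "T (\<lambda>z. a * F z + b * H z) = (\<lambda>z. a * T F z + b * T H z)"
  proof
    fix z
    have "T (\<lambda>z. a * F z + b * H z) z = (\<integral>w. a * (K (z, w) * F w) + b * (K (z, w) * H w) \<partial>gauss_measure)"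
      by (simp add: T_def algebra_simps)
    also have "\<dots> = a * T F z + b * T H z"
      using i[of z] by (simp add: T_def)
    finally show "T (\<lambda>z. a * F z + b * H z) z = a * T F z + b * T H z" .
  qed
qed

text \<open>Continuous maps into a Hausdorff space that agree on a set agree on its closure.\<close>

lemma T_unique:
  assumes T': "continuous_extension (A_top q' p' \<omega>1) (A_star_top p q \<omega>2) K T'"
    and F: "F \<in> A_top q' p' \<omega>1 closure_of A_flat1"
  shows "T' F = T F"
proof (rule forall_in_closure_of_eq[where f=T' and g=T and Y="A_star_top p q \<omega>2"
      and X="A_top q' p' \<omega>1" and S="topspace (A_top q' p' \<omega>1) \<inter> A_flat1"])
  \<comment> \<open>Functions of \<open>A_flat1\<close> outside the space do not contribute to the
    closure, and agreement of the two maps is known on the remaining ones.\<close>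
  show "F \<in> A_top q' p' \<omega>1 closure_of (topspace (A_top q' p' \<omega>1) \<inter> A_flat1)"
    using F by (simp flip: closure_of_restrict)
  show "Hausdorff_space (A_star_top p q \<omega>2)"
    unfolding A_star_top_def by (rule Metric_space.Hausdorff_space_mtopology[OF metric_A_star])
  show "T' H = T H" if "H \<in> topspace (A_top q' p' \<omega>1) \<inter> A_flat1" for H
    using T' T_extension that unfolding continuous_extension_def by auto
qed (use T' T_continuous in \<open>auto simp: continuous_extension_def\<close>)

end

theorem theorem4p5:
  fixes \<omega>\<^sub>1 \<omega>\<^sub>2 :: "complex ^ 'd \<Rightarrow> real"
    and \<omega> :: "(complex ^ 'd) \<times> (complex ^ 'd) \<Rightarrow> real"
    and p q p' q' :: ennreal
  assumes "weight \<omega>\<^sub>1" and "weight \<omega>\<^sub>2" and "weight \<omega>"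
    and "\<exists>c>0. \<forall>z w. \<omega>\<^sub>2 z / \<omega>\<^sub>1 w \<le> c * \<omega> (z, cnj_vec w)"
    and "1 \<le> p" and "1 \<le> q"
    and "1 / p + 1 / p' = 1" and "1 / q + 1 / q' = 1"
  shows "\<exists>c>0. \<forall>K \<in> A_tilde. G_KC K \<omega> \<in> Lpq_star p q \<longrightarrow>
    (\<exists>T. continuous_extension (A_top q' p' \<omega>\<^sub>1) (A_star_top p q \<omega>\<^sub>2) K T \<and>
      linear_on (A_space q' p' \<omega>\<^sub>1) T \<and>
      integral_operator_on (A_space q' p' \<omega>\<^sub>1) K T \<and>
      (\<forall>T'. continuous_extension (A_top q' p' \<omega>\<^sub>1) (A_star_top p q \<omega>\<^sub>2) K T' \<longrightarrow>
        (\<forall>F \<in> A_top q' p' \<omega>\<^sub>1 closure_of A_flat1. T' F = T F)) \<and>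
      (\<forall>F \<in> A_space q' p' \<omega>\<^sub>1.
        A_star_norm p q \<omega>\<^sub>2 (T F)
          \<le> ennreal c * Lpq_star_norm p q (G_KC K \<omega>) * A_norm q' p' \<omega>\<^sub>1 F))"
proof -
  obtain c0 where c0: "0 < c0" and ratio: "\<And>z w. \<omega>\<^sub>2 z / \<omega>\<^sub>1 w \<le> c0 * \<omega> (z, cnj_vec w)"
    using assms(4) by blast
  \<comment> \<open>Fixed before K is introduced: only the constant of the weight inequality and the
    dimension enter. It is the \<open>const\<close> of the locale.\<close>
  define c where "c = c0 * (2 * pi) powr (- real CARD('d)) * 4 ^ CARD('d)"
  show ?thesis
  proof (intro exI[of _ c] conjI ballI impI)
    show "0 < c" using c0 by (simp add: c_def)
    fix K :: "(complex ^ 'd) \<times> (complex ^ 'd) \<Rightarrow> complex"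
    assume "K \<in> A_tilde" "G_KC K \<omega> \<in> Lpq_star p q"
    then interpret kernel \<omega>\<^sub>1 \<omega>\<^sub>2 \<omega> c0 p q p' q' K
      using assms c0 ratio by unfold_locales auto
    have "const = c" by (simp add: const_def c_def)
    then show "\<exists>T. continuous_extension (A_top q' p' \<omega>\<^sub>1) (A_star_top p q \<omega>\<^sub>2) K T \<and>
      linear_on (A_space q' p' \<omega>\<^sub>1) T \<and>
      integral_operator_on (A_space q' p' \<omega>\<^sub>1) K T \<and>
      (\<forall>T'. continuous_extension (A_top q' p' \<omega>\<^sub>1) (A_star_top p q \<omega>\<^sub>2) K T' \<longrightarrow>
        (\<forall>F \<in> A_top q' p' \<omega>\<^sub>1 closure_of A_flat1. T' F = T F)) \<and>
      (\<forall>F \<in> A_space q' p' \<omega>\<^sub>1.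
        A_star_norm p q \<omega>\<^sub>2 (T F)
          \<le> ennreal c * Lpq_star_norm p q (G_KC K \<omega>) * A_norm q' p' \<omega>\<^sub>1 F)"
      using T_norm_le T_unique T_integrable
      by (intro exI[of _ T] conjI T_extension T_linear)
        (auto simp: integral_operator_on_def T_def)
  qed
qed

end
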